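(* For arbitrary even integers $x,y,z\in 2\mathbb{Z}$ there exists an oriented generic pair of immersions $K=K(S_1,S_2)$ such that $J^+(S_1)=x$, $J^+(S_2)=y$ and $J^{2+}(K)=z$.
   Context: An immersion is a smooth map $S:S^1\to\mathbb{C}$ with nowhere vanishing derivative; $S$ also denotes its image, and it is oriented by its parametrization. It is generic if its only singularities are transverse double points. A pair of immersions $K=K(S_1,S_2)$ is a map $K:S^1\sqcup S^1\to\mathbb{C}$ given by two immersions $S_1,S_2$ on the two circles; $K$ also denotes the image $S_1\cup S_2$. The pair is generic if its only singularities are transverse double points (self-intersections of $S_1$ or of $S_2$, or intersections of $S_1$ with $S_2$). For $X=S$ a generic immersion or $X=K$ a generic pair and a connected component $C$ of $\mathbb{C}\setminus X$, $\omega_C(X)$ is the winding number of $X$ around any point of $C$ (for a pair, the sum of the winding numbers of $S_1$ and $S_2$). For a double point $p$ of $X$, $ind_p(X)$ is the arithmetic mean of the winding numbers of the four components (quadrants, counted with multiplicity) adjacent to $p$. $J^+(S)$ is Arnold's $J^+$-invariant of a generic immersion $S$; by Viro's formula, $J^+(S)=1+n-\sum_{C\subset\mathbb{C}\setminus S}\omega_C(S)^2+\sum_p ind_p(S)^2$, with $n$ the number of double points of $S$. The encircling index is $u(K)=0$ if $S_1\cap S_2\neq\emptyset$, and otherwise $u(K)=\omega_{C_1}(S_2)+\omega_{C_2}(S_1)$, where $C_1$ is the component of $\mathbb{C}\setminus S_2$ containing $S_1$ and $C_2$ is the component of $\mathbb{C}\setminus S_1$ containing $S_2$. With $n$ the number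 of double points of $K$, $$J^{2+}(K):=2+n-\sum_{C\subset\mathbb{C}\setminus K}\omega_C(K)^2+\sum_p ind_p(K)^2+u(K)^2 .$$ *)

theory Defs
  imports "HOL-Complex_Analysis.Complex_Analysis"
begin

text \<open>A map \<open>S\<^sup>1 \<rightarrow> \<complex>\<close> is encoded as a 1-periodic function on the reals; its restriction to
  \<open>{0..1}\<close> is then a loop in the sense of the library, so that \<^const>\<open>path_image\<close> and
  \<^const>\<open>winding_number\<close> apply to it.\<close>

definition smooth :: "(real \<Rightarrow> complex) \<Rightarrow> bool" where
  "smooth f \<longleftrightarrow> (\<forall>n. ((\<lambda>g t. vector_derivative g (at t)) ^^ n) f differentiable_on UNIV)"

definition immersion :: "(real \<Rightarrow> complex) \<Rightarrow> bool" where
  "immersion S \<longleftrightarrow> (\<forall>t. S (t + 1) = S t) \<and> smooth S \<and> (\<forall>t. vector_derivative S (at t) \<noteq> 0)"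

text \<open>Single immersions and pairs are treated uniformly as lists \<open>X\<close> of curves, namely \<open>[S]\<close> and
  \<open>[S1, S2]\<close>. A point of the source is a pair \<open>(i, t)\<close> of a circle number and a parameter.\<close>

definition curves_image :: "(real \<Rightarrow> complex) list \<Rightarrow> complex set" where
  "curves_image X = (\<Union>S\<in>set X. path_image S)"

definition fiber :: "(real \<Rightarrow> complex) list \<Rightarrow> complex \<Rightarrow> (nat \<times> real) set" where
  "fiber X p = {(i, t). i < length X \<and> t \<in> {0..<1} \<and> (X ! i) t = p}"

definition tangent :: "(real \<Rightarrow> complex) list \<Rightarrow> nat \<times> real \<Rightarrow> complex" where
  "tangent X = (\<lambda>(i, t). vector_derivative (X ! i) (at t))"

definition generic :: "(real \<Rightarrow> complex) list \<Rightarrow> bool" where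
  "generic X \<longleftrightarrow> (\<forall>S\<in>set X. immersion S) \<and>
     (\<forall>p. finite (fiber X p) \<and> card (fiber X p) \<le> 2 \<and>
          (\<forall>a\<in>fiber X p. \<forall>b\<in>fiber X p. a \<noteq> b \<longrightarrow> span {tangent X a, tangent X b} = UNIV))"

abbreviation generic_immersion :: "(real \<Rightarrow> complex) \<Rightarrow> bool" where
  "generic_immersion S \<equiv> generic [S]"

abbreviation generic_pair :: "(real \<Rightarrow> complex) \<Rightarrow> (real \<Rightarrow> complex) \<Rightarrow> bool" where
  "generic_pair S1 S2 \<equiv> generic [S1, S2]"

definition double_points :: "(real \<Rightarrow> complex) list \<Rightarrow> complex set" where
  "double_points X = {p. card (fiber X p) = 2}"

definition omega :: "(real \<Rightarrow> complex) list \<Rightarrow> complex set \<Rightarrow> int" where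
  "omega X C = (THE k. \<forall>z\<in>C. (\<Sum>S\<leftarrow>X. winding_number S z) = of_int k)"

text \<open>At a transverse double point with tangent vectors \<open>v\<close> and \<open>w\<close>, the four local quadrants are
  the ones entered from \<open>p\<close> in the directions \<open>\<plusminus>v \<plusminus>w\<close>. A quadrant is thus given by a choice \<open>\<sigma>\<close> of
  a sign for each of the two preimages of \<open>p\<close>; distinct quadrants may lie in the same component.\<close>

definition quadrant :: "(real \<Rightarrow> complex) list \<Rightarrow> complex \<Rightarrow> (nat \<times> real \<Rightarrow> real) \<Rightarrow> complex set" where
  "quadrant X p \<sigma> = (THE C. C \<in> components (- curves_image X) \<and>
     (\<forall>\<^sub>F \<epsilon> in at_right 0. p + \<epsilon> *\<^sub>R (\<Sum>a\<in>fiber X p. \<sigma> a *\<^sub>R tangent X a) \<in> C))"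

definition ind :: "(real \<Rightarrow> complex) list \<Rightarrow> complex \<Rightarrow> real" where
  "ind X p = (\<Sum>\<sigma>\<in>fiber X p \<rightarrow>\<^sub>E {-1, 1}. real_of_int (omega X (quadrant X p \<sigma>))) / 4"

text \<open>Arnold's invariant of a generic immersion, in the form given by Viro's formula.\<close>

definition J_plus :: "(real \<Rightarrow> complex) \<Rightarrow> real" where
  "J_plus S = 1 + real (card (double_points [S]))
     - (\<Sum>C\<in>components (- curves_image [S]). (real_of_int (omega [S] C))\<^sup>2)
     + (\<Sum>p\<in>double_points [S]. (ind [S] p)\<^sup>2)"

definition encircling_index :: "(real \<Rightarrow> complex) \<Rightarrow> (real \<Rightarrow> complex) \<Rightarrow> int" where
  "encircling_index S1 S2 =
     (if path_image S1 \<inter> path_image S2 \<noteq> {} then 0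
      else omega [S2] (THE C. C \<in> components (- path_image S2) \<and> path_image S1 \<subseteq> C)
         + omega [S1] (THE C. C \<in> components (- path_image S1) \<and> path_image S2 \<subseteq> C))"

definition J2_plus :: "(real \<Rightarrow> complex) \<Rightarrow> (real \<Rightarrow> complex) \<Rightarrow> real" where
  "J2_plus S1 S2 = 2 + real (card (double_points [S1, S2]))
     - (\<Sum>C\<in>components (- curves_image [S1, S2]). (real_of_int (omega [S1, S2] C))\<^sup>2)
     + (\<Sum>p\<in>double_points [S1, S2]. (ind [S1, S2] p)\<^sup>2)
     + (real_of_int (encircling_index S1 S2))\<^sup>2"

end

theory Submission
  imports Defs
begin

text \<open>Both curves are closed braids around the origin: they run with the same constant angular speed \<open>m\<close> times
  around \<open>0\<close>, and together the \<open>L\<close> curves form \<open>M = L m\<close> strands, the graphs of radius functions over the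
  angle. The winding number at a point off the curves is the number of strands farther out. A crossing
  of the strands at positions \<open>j\<close> and \<open>j + 1\<close> (counted from outside) has index \<open>j\<close>, and if all levels \<open>0 < j < M\<close>
  contain a crossing, then the crossings of level \<open>j\<close> cut the annular region of winding number \<open>j\<close> into as many
  components as there are crossings. So everything cancels in Viro's sum except for the innermost component,
  and \<open>n - \<Sum>\<omega>\<^sup>2 + \<Sum>ind\<^sup>2 = n - M\<^sup>2\<close>. Two curves with \<open>m\<close> strands each, \<open>n\<^sub>1\<close> and \<open>n\<^sub>2\<close> self-crossings
  and \<open>e > 0\<close> mutual crossings therefore have the invariants \<open>1 + n\<^sub>1 - m\<^sup>2\<close>, \<open>1 + n\<^sub>2 - m\<^sup>2\<close> and
  \<open>2 + n\<^sub>1 + n\<^sub>2 + e - 4 m\<^sup>2\<close>. For large \<open>m\<close> the braid word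
  \<open>\<sigma>\<^sub>0\<^sup>p \<sigma>\<^sub>1 \<dots> \<sigma>\<^sub>m\<^sub>-\<^sub>2 \<sigma>\<^sub>m\<^sub>-\<^sub>1\<^sup>e \<sigma>\<^sub>m\<^sup>q \<sigma>\<^sub>m\<^sub>+\<^sub>1 \<dots> \<sigma>\<^sub>2\<^sub>m\<^sub>-\<^sub>2\<close> with \<open>p\<close>, \<open>q\<close> odd and \<open>e\<close> even
  realizes all values needed.\<close>

section \<open>Components\<close>

text \<open>The exponents are forced by parity. Odd \<open>p\<close> and \<open>q\<close> let one
  turn permute each block of \<open>m\<close> positions cyclically, so that the \<open>m\<close>
  strands of a block close up to one curve; even \<open>e\<close> brings the strands back to their
  blocks. The invariants of the curves are then p - 1 + m - m^2 and q - 1 + m - m^2, and that of the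
  pair is the sum of these plus e - 2 m^2: all of them even. Large \<open>m\<close> is needed
  because the exponents, solved for from the prescribed values, must be positive. As
  \<open>e > 0\<close>, the curves meet, which makes the encircling index vanish. A level without a
  crossing would be a full annulus, a component that no crossing cancels. The same word serves the
  pair and each curve alone: removing a curve leaves vacant positions, and a letter with a vacant
  position at most moves one strand. The word numbers positions from the innermost one, starting at
  0, whereas levels count strands from outside.\<close>

lemma in_componentsI:
  assumes "C \<noteq> {}" "C \<subseteq> S" "connected C"
    and "\<And>D. \<lbrakk>connected D; C \<subseteq> D; D \<subseteq> S\<rbrakk> \<Longrightarrow> D \<subseteq> C"
  shows "C \<in> components S"
  unfolding in_components_maximal using assms by (metis subset_antisym)

text \<open>A component of \<open>S\<close> lies in a single fibre of \<open>f\<close>, and a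
  connected subset of \<open>S\<close> that meets a component of a fibre stays in that fibre and so
  cannot enlarge it. Applied with the winding number as \<open>f\<close>, and with the side of a
  removed point.\<close>

lemma components_constant_on:
  fixes S :: "'a::topological_space set"
  assumes const: "\<And>D x y. \<lbrakk>connected D; D \<subseteq> S; x \<in> D; y \<in> D\<rbrakk> \<Longrightarrow> f x = f y" and J: "f ` S \<subseteq> J"
  shows "components S = (\<Union>j\<in>J. components {x \<in> S. f x = j})"
proof (intro equalityI subsetI)
  fix C assume C: "C \<in> components S"
  note C' = in_components_nonempty[OF C] in_components_subset[OF C] in_components_connected[OF C]
  from C'(1) obtain x where x: "x \<in> C" by blast
  have "C \<subseteq> {y \<in> S. f y = f x}"
    using const[OF C'(3,2)] x C'(2) by blast
  then have "C \<in> components {y \<in> S. f y = f x}"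
    using C components_intermediate_subset by blast
  then show "C \<in> (\<Union>j\<in>J. components {x \<in> S. f x = j})"
    using J x C'(2) by blast
next
  fix C assume "C \<in> (\<Union>j\<in>J. components {x \<in> S. f x = j})"
  then obtain j where j: "C \<in> components {x \<in> S. f x = j}" by blast
  note C = in_components_nonempty[OF j] in_components_subset[OF j] in_components_connected[OF j]
  from C(1) obtain c where c: "c \<in> C" by blast
  show "C \<in> components S"
  proof (rule in_componentsI)
    fix D assume D: "connected D" "C \<subseteq> D" "D \<subseteq> S"
    have "f x = j" if "x \<in> D" for x
      using const[OF D(1,3) that, of c] c C(2) D(2) by blast
    then have "D \<subseteq> {x \<in> S. f x = j}" using D by blast
    moreover have "C \<inter> D \<noteq> {}" using c D by blast
    ultimately show "D \<subseteq> C" using components_maximal[OF j D(1)] by blast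
  qed (use C in auto)
qed

text \<open>An open map with connected fibres pulls connected sets back to connected sets, so it
  neither splits nor merges components. This is how a planar region is replaced by the set of its
  angles.\<close>

lemma components_open_monotone_image:
  fixes f :: "'a::topological_space \<Rightarrow> 'b::topological_space"
  assumes contf: "continuous_on S f"
    and ST: "\<And>C. openin (top_of_set S) C \<Longrightarrow> openin (top_of_set (f ` S)) (f ` C)"
    and conn: "\<And>y. y \<in> f ` S \<Longrightarrow> connected (S \<inter> f -` {y})"
  shows "bij_betw (\<lambda>C. S \<inter> f -` C) (components (f ` S)) (components S)"
proof -
  have pre: "connected (S \<inter> f -` C)" if "connected C" "C \<subseteq> f ` S" for C
    using connected_open_monotone_preimage[OF contf refl ST conn that] .
  have img: "connected (f ` D)" if "connected D" "D \<subseteq> S" for D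
    using connected_continuous_image continuous_on_subset contf that by blast
  have mem: "S \<inter> f -` C \<in> components S" if C: "C \<in> components (f ` S)" for C
  proof (rule in_componentsI)
    note C' = in_components_nonempty[OF C] in_components_subset[OF C] in_components_connected[OF C]
    obtain x where x: "x \<in> S" "f x \<in> C" using C'(1,2) by blast
    show "S \<inter> f -` C \<noteq> {}" using x by blast
    show "connected (S \<inter> f -` C)" using pre C' by blast
    fix D assume D: "connected D" "S \<inter> f -` C \<subseteq> D" "D \<subseteq> S"
    have "f x \<in> C \<inter> f ` D" using x D by blast
    then have "f ` D \<subseteq> C"
      using components_maximal[OF C img[OF D(1,3)]] D(3) by blast
    then show "D \<subseteq> S \<inter> f -` C" using D(3) by blast
  qed blast
  have surj: "\<exists>C\<in>components (f ` S). D = S \<inter> f -` C" if D: "D \<in> components S" for D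
  proof -
    note D' = in_components_nonempty[OF D] in_components_subset[OF D] in_components_connected[OF D]
    have "f ` D \<subseteq> f ` S" "f ` S \<noteq> {}" using D' by blast+
    then obtain C where C: "C \<in> components (f ` S)" "f ` D \<subseteq> C"
      using exists_component_superset img[OF D'(3,2)] by metis
    have "D \<inter> (S \<inter> f -` C) \<noteq> {}" using C(2) D' by blast
    then have "D = S \<inter> f -` C"
      using components_nonoverlap[OF D mem[OF C(1)]] by blast
    then show ?thesis using C by blast
  qed
  show ?thesis
    unfolding bij_betw_def
  proof
    show "inj_on (\<lambda>C. S \<inter> f -` C) (components (f ` S))"
    proof (rule inj_onI)
      fix C D assume *: "C \<in> components (f ` S)" "D \<in> components (f ` S)" "S \<inter> f -` C = S \<inter> f -` D"
      have "C \<subseteq> f ` S" "D \<subseteq> f ` S" using *(1,2) in_components_subset by auto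
      then show "C = D" using *(3) by blast
    qed
    show "(\<lambda>C. S \<inter> f -` C) ` components (f ` S) = components S"
      using mem surj by (intro equalityI subsetI) (force, metis imageI)
  qed
qed

lemma components_connected:
  assumes "connected S" "S \<noteq> {}"
  shows "components S = {S}"
  using assms components_eq_sing_iff by auto

text \<open>Induction on the largest removed point \<open>z\<close>: it splits off the interval to
  its right, and the remaining points lie in \<open>{a<..<z}\<close>. Hence the right end varies in
  the induction.\<close>

lemma components_interval_minus_finite:
  fixes a b :: real
  assumes "finite Z" "Z \<subseteq> {a<..<b}" "a < b"
  shows "finite (components ({a<..<b} - Z)) \<and> card (components ({a<..<b} - Z)) = Suc (card Z)"
  using assms
proof (induction Z arbitrary: b rule: finite_linorder_max_induct)
  case empty
  have "{a<..<b} \<noteq> {}" using \<open>a < b\<close> by simp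
  then have "components {a<..<b} = {{a<..<b}}"
    by (intro components_connected) simp
  then show ?case by simp
next
  case (insert z Z)
  let ?U = "{a<..<b} - insert z Z"
  have z: "a < z" "z < b" "Z \<subseteq> {a<..<z}" using insert by auto
  have eq: "components ?U = (\<Union>j\<in>{True, False}. components {x \<in> ?U. (x < z) = j})"
  proof (rule components_constant_on)
    fix D x y assume D: "connected D" "D \<subseteq> ?U" "x \<in> D" "y \<in> D"
    have "\<not> (x < z \<and> z < y)" "\<not> (y < z \<and> z < x)"
      using D connectedD_interval[OF D(1)] by (meson DiffD2 insertI1 less_imp_le subsetD)+
    then show "(x < z) = (y < z)" using D by force
  qed auto
  have l: "{x \<in> ?U. (x < z) = True} = {a<..<z} - Z" using z by auto
  have r: "{x \<in> ?U. (x < z) = False} = {z<..<b}" using z by auto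
  have cr: "components {z<..<b} = {{z<..<b}}"
    using z by (intro components_connected) auto
  have IH: "finite (components ({a<..<z} - Z))" "card (components ({a<..<z} - Z)) = Suc (card Z)"
    using insert.IH[of z] z by auto
  have "{z<..<b} \<notin> components ({a<..<z} - Z)"
  proof
    assume "{z<..<b} \<in> components ({a<..<z} - Z)"
    then have "{z<..<b} \<subseteq> {a<..<z}" using in_components_subset by blast
    moreover have "(z+b)/2 \<in> {z<..<b}" using z by simp
    ultimately show False by fastforce
  qed
  moreover have "components ?U = insert {z<..<b} (components ({a<..<z} - Z))"
    unfolding eq using l r cr by simp
  moreover have "z \<notin> Z" using z by auto
  ultimately show ?case using IH insert.hyps by simp
qed

section \<open>Winding numbers of closed braids\<close>

lemma polar_eq_iff:
  fixes a b :: real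
  assumes "a > 0" "b > 0"
  shows "a *\<^sub>R cis x = b *\<^sub>R cis y \<longleftrightarrow> a = b \<and> (\<exists>n::int. x = y + 2 * pi * n)"
proof
  assume eq: "a *\<^sub>R cis x = b *\<^sub>R cis y"
  then have "norm (a *\<^sub>R cis x) = norm (b *\<^sub>R cis y)" by simp
  then have ab: "a = b" using assms by simp
  then have "cis x = cis y" using eq assms by simp
  then have "sin x = sin y \<and> cos x = cos y" by (simp add: complex_eq_iff)
  then show "a = b \<and> (\<exists>n::int. x = y + 2 * pi * n)"
    using ab unfolding sin_cos_eq_iff by (auto simp: mult_ac)
next
  assume "a = b \<and> (\<exists>n::int. x = y + 2 * pi * n)"
  then obtain n :: int where "a = b" "x = y + 2 * pi * n" by blast
  then have "sin x = sin y \<and> cos x = cos y"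
    unfolding sin_cos_eq_iff by (auto simp: mult_ac)
  then show "a *\<^sub>R cis x = b *\<^sub>R cis y" using \<open>a = b\<close> by (simp add: complex_eq_iff)
qed

text \<open>\<open>A\<close> and \<open>B\<close> are radius and angle of a moving loop, with time
  \<open>s\<close>. Closedness is required of the points, not of \<open>B\<close>, since a loop may
  make any number of turns.\<close>

lemma winding_number_polar_homotopy:
  fixes A B :: "real \<times> real \<Rightarrow> real"
  assumes "continuous_on UNIV A" "continuous_on UNIV B"
    and "\<And>s. A (s, 0) *\<^sub>R cis (B (s, 0)) = A (s, 1) *\<^sub>R cis (B (s, 1))"
    and "\<And>s u. s \<in> {0..1} \<Longrightarrow> u \<in> {0..1} \<Longrightarrow> A (s, u) *\<^sub>R cis (B (s, u)) \<noteq> z"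
  shows "winding_number (\<lambda>u. A (0, u) *\<^sub>R cis (B (0, u))) z
       = winding_number (\<lambda>u. A (1, u) *\<^sub>R cis (B (1, u))) z"
proof (rule winding_number_homotopic_loops)
  have "continuous_on UNIV (\<lambda>x. A x *\<^sub>R cis (B x))"
    using assms by (intro continuous_intros) auto
  then show "homotopic_loops (- {z}) (\<lambda>u. A (0, u) *\<^sub>R cis (B (0, u))) (\<lambda>u. A (1, u) *\<^sub>R cis (B (1, u)))"
    unfolding homotopic_loops using assms(3,4)
    by (intro exI[of _ "\<lambda>x. A x *\<^sub>R cis (B x)"])
      (fastforce simp: pathstart_def pathfinish_def intro: continuous_on_subset)
qed

text \<open>One turn, begun opposite to the given point, meets the direction of the point only at
  half time, at radius \<open>\<sigma> 0\<close>. So either the segment to 0 or the ray to infinity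
  leads from the point, off the loop, to a place where the winding number is known.\<close>

lemma winding_number_polar_loop:
  fixes \<sigma> :: "real \<Rightarrow> real" and r \<phi> :: real
  assumes cont: "continuous_on UNIV \<sigma>" and pos: "\<And>x. \<sigma> x > 0" and ends: "\<sigma> (1/2) = \<sigma> (-1/2)"
    and r: "r > 0" "\<sigma> 0 \<noteq> r"
  shows "winding_number (\<lambda>u. \<sigma> (u - 1/2) *\<^sub>R cis (2 * pi * (\<phi> + u - 1/2))) (r *\<^sub>R cis (2 * pi * \<phi>))
       = (if r < \<sigma> 0 then 1 else 0)"
proof -
  let ?l = "\<lambda>u. \<sigma> (u - 1/2) *\<^sub>R cis (2 * pi * (\<phi> + u - 1/2))"
  have contl: "continuous_on UNIV ?l"
    by (intro continuous_intros continuous_on_compose2[OF cont]) auto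
  then have path: "path ?l" unfolding path_def using continuous_on_subset by blast
  have "cis (2 * pi * (\<phi> + 0 - 1/2)) = cis (2 * pi * (\<phi> + 1 - 1/2))"
    using polar_eq_iff[of 1 1 "2 * pi * (\<phi> + 1 - 1/2)" "2 * pi * (\<phi> + 0 - 1/2)"]
    by (auto simp: algebra_simps intro: exI[of _ 1])
  then have loop: "pathfinish ?l = pathstart ?l"
    using ends by (simp add: pathstart_def pathfinish_def)
  have meet: "s = \<sigma> 0" if "s *\<^sub>R cis (2 * pi * \<phi>) \<in> path_image ?l" "s \<ge> 0" for s
  proof -
    from that obtain u where u: "u \<in> {0..1}" "?l u = s *\<^sub>R cis (2 * pi * \<phi>)"
      unfolding path_image_def by force
    have "s \<noteq> 0" using u(2) pos[of "u - 1/2"] by (auto simp: less_le)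
    then have "s > 0" using that by simp
    then obtain n :: int where n: "\<sigma> (u - 1/2) = s" "2 * pi * (\<phi> + u - 1/2) = 2 * pi * \<phi> + 2 * pi * n"
      using u(2) polar_eq_iff[OF pos[of "u - 1/2"] \<open>s > 0\<close>] by blast
    then have "2 * pi * (u - 1/2) = 2 * pi * n" by (simp add: algebra_simps)
    then have "u - 1/2 = n" by simp
    moreover have "\<bar>u - 1/2\<bar> < 1" using u(1) by (auto simp: abs_if)
    ultimately have "n = 0" by linarith
    then show "s = \<sigma> 0" using n \<open>u - 1/2 = n\<close> by simp
  qed
  show ?thesis
  proof (cases "r < \<sigma> 0")
    case True
    define S where "S = (\<lambda>s. s *\<^sub>R cis (2 * pi * \<phi>)) ` {0..r}"
    have "connected S" unfolding S_def
      by (intro connected_continuous_image continuous_intros) auto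
    moreover have "S \<inter> path_image ?l = {}" using meet True unfolding S_def by fastforce
    moreover have "0 \<in> S" "r *\<^sub>R cis (2 * pi * \<phi>) \<in> S" unfolding S_def using r by force+
    ultimately have "winding_number ?l (r *\<^sub>R cis (2 * pi * \<phi>)) = winding_number ?l 0"
      using winding_number_eq[OF path loop] by blast
    also have "winding_number ?l 0 = winding_number (circlepath 0 1) 0"
    proof -
      \<comment> \<open>The radius changes linearly to 1 while the initial angle
        \<open>\<phi> - 1/2\<close> is turned back to 0; the radius stays positive.\<close>
      define A where "A = (\<lambda>(s::real, u::real). (1 - s) * \<sigma> (u - 1/2) + s)"
      define B where "B = (\<lambda>(s::real, u::real). 2 * pi * (u + (1 - s) * (\<phi> - 1/2)))"
      have pA: "A (s, u) > 0" if "s \<in> {0..1}" for s u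
      proof (cases "s = 1")
        case False
        then have "(1 - s) * \<sigma> (u - 1/2) > 0" using that pos by auto
        then show ?thesis using that unfolding A_def by auto
      qed (simp add: A_def)
      have "winding_number (\<lambda>u. A (0, u) *\<^sub>R cis (B (0, u))) 0 = winding_number (\<lambda>u. A (1, u) *\<^sub>R cis (B (1, u))) 0"
      proof (rule winding_number_polar_homotopy)
        show "continuous_on UNIV A"
          unfolding A_def split_beta by (intro continuous_intros continuous_on_compose2[OF cont]) auto
        show "continuous_on UNIV B" unfolding B_def split_beta by (intro continuous_intros)
        fix s :: real
        have "A (s, 0) = A (s, 1)" using ends unfolding A_def by simp
        moreover have "cis (B (s, 1)) = cis (B (s, 0))"
          using polar_eq_iff[of 1 1 "B (s, 1)" "B (s, 0)"]
          by (auto simp: B_def algebra_simps intro: exI[of _ 1])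
        ultimately show "A (s, 0) *\<^sub>R cis (B (s, 0)) = A (s, 1) *\<^sub>R cis (B (s, 1))" by simp
      next
        fix s u :: real assume "s \<in> {0..1}" "u \<in> {0..1}"
        then show "A (s, u) *\<^sub>R cis (B (s, u)) \<noteq> 0" using pA[of s u] by simp
      qed
      moreover have "(\<lambda>u. A (0, u) *\<^sub>R cis (B (0, u))) = ?l"
        unfolding A_def B_def by (simp add: algebra_simps)
      moreover have "(\<lambda>u. A (1, u) *\<^sub>R cis (B (1, u))) = circlepath 0 1"
        unfolding A_def B_def circlepath by (auto simp: cis_conv_exp mult_ac)
      ultimately show ?thesis by simp
    qed
    also have "\<dots> = 1" by (rule winding_number_circlepath_centre) simp
    finally show ?thesis using True by simp
  next
    case False
    obtain b where b: "\<And>z. b \<le> norm z \<Longrightarrow> winding_number ?l z = 0"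
      using winding_number_zero_at_infinity[OF path loop] by blast
    define S where "S = (\<lambda>s. s *\<^sub>R cis (2 * pi * \<phi>)) ` {r..}"
    have "connected S" unfolding S_def
      by (intro connected_continuous_image continuous_intros) auto
    moreover have "S \<inter> path_image ?l = {}" using meet False r unfolding S_def by fastforce
    moreover have "max r b *\<^sub>R cis (2 * pi * \<phi>) \<in> S" "r *\<^sub>R cis (2 * pi * \<phi>) \<in> S" unfolding S_def by auto
    ultimately have "winding_number ?l (r *\<^sub>R cis (2 * pi * \<phi>)) = winding_number ?l (max r b *\<^sub>R cis (2 * pi * \<phi>))"
      using winding_number_eq[OF path loop] by blast
    also have "\<dots> = 0" using r by (intro b) auto
    finally show ?thesis using False by simp
  qed
qed

lemma periodic_shift_int:
  fixes f :: "real \<Rightarrow> 'a" and p :: real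
  assumes "\<And>t. f (t + p) = f t"
  shows "f (t + of_int n * p) = f t"
proof (induction n rule: int_induct[where k = 0])
  case (step1 i) then show ?case using assms[of "t + of_int i * p"] by (simp add: algebra_simps)
next
  case (step2 i) then show ?case using assms[of "t + of_int (i - 1) * p"] by (simp add: algebra_simps)
qed simp

text \<open>Damping the radius towards \<open>r\<close> by \<open>cos\<^sup>2\<close> fixes it over the direction of \<open>z\<close>, so \<open>z\<close> is never
  crossed, and makes all \<open>m\<close> turns close up over the opposite direction.\<close>

lemma winding_number_closed_braid:
  fixes \<rho> :: "real \<Rightarrow> real" and r \<phi> :: real and m :: nat
  assumes cont: "continuous_on UNIV \<rho>" and pos: "\<And>x. \<rho> x > 0" and per: "\<And>x. \<rho> (x + real m) = \<rho> x"
    and m: "m > 0" and r: "r > 0" and off: "\<And>k. k < m \<Longrightarrow> \<rho> (\<phi> + k) \<noteq> r"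
  shows "winding_number (\<lambda>u. \<rho> (m * u) *\<^sub>R cis (2 * pi * (m * u))) (r *\<^sub>R cis (2 * pi * \<phi>))
       = of_nat (card {k \<in> {..<m}. r < \<rho> (\<phi> + k)})"
proof -
  let ?z = "r *\<^sub>R cis (2 * pi * \<phi>)"
  have offint: "\<rho> (\<phi> + of_int n) \<noteq> r" for n :: int
  proof -
    have "\<phi> + real_of_int n = \<phi> + nat (n mod m) + of_int (n div m) * real m"
    proof -
      have "real_of_int n = real_of_int (n div m * m + n mod m)" by simp
      also have "\<dots> = of_int (n div m) * real m + nat (n mod m)"
        using m by (simp only: of_int_add of_int_mult of_int_of_nat_eq) (simp add: of_nat_nat)
      finally show ?thesis by simp
    qed
    then have "\<rho> (\<phi> + of_int n) = \<rho> (\<phi> + nat (n mod m))"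
      using periodic_shift_int[of \<rho> "real m" "\<phi> + nat (n mod m)" "n div m"] per by (simp add: add.assoc)
    moreover have "nat (n mod m) < m" using m by (simp add: nat_less_iff)
    ultimately show ?thesis using off by metis
  qed
  have int_of: "\<exists>n::int. y = x + n" if "2 * pi * y = 2 * pi * x + 2 * pi * real_of_int n" for x y n
  proof -
    have "2 * pi * y = 2 * pi * (x + n)" using that by (simp add: algebra_simps)
    then show ?thesis by auto
  qed
  define \<rho>' where "\<rho>' = (\<lambda>x. r + (\<rho> (\<phi> + x) - r) * (cos (pi * x))\<^sup>2)"
  have cont': "continuous_on UNIV \<rho>'"
    unfolding \<rho>'_def by (intro continuous_intros continuous_on_compose2[OF cont]) auto
  have conv: "r + (\<rho> x - r) * c > 0" if "0 \<le> c" "c \<le> 1" for x c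
  proof -
    have "r + (\<rho> x - r) * c = (1 - c) * r + c * \<rho> x" by (simp add: algebra_simps)
    moreover have "(1 - c) * r \<ge> 0" "c * \<rho> x \<ge> 0" using that r pos[of x] by auto
    moreover have "(1 - c) * r > 0 \<or> c * \<rho> x > 0" using that r pos[of x] by (cases "c = 1") auto
    ultimately show ?thesis by linarith
  qed
  have c2: "0 \<le> (cos x)\<^sup>2" "(cos x)\<^sup>2 \<le> 1" for x :: real by (auto simp: abs_square_le_1)
  have pos': "\<rho>' x > 0" for x unfolding \<rho>'_def using conv c2 by blast
  \<comment> \<open>Starting half a turn before the direction of the point puts the break points
    \<open>k / m\<close> opposite to it, where the damped radius is \<open>r\<close>.\<close>
  define g where "g = (\<lambda>u::real. \<rho>' (m * u - 1/2) *\<^sub>R cis (2 * pi * (\<phi> + m * u - 1/2)))"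
  \<comment> \<open>The starting point slides along the curve itself, which never passes through the
    point.\<close>
  have "winding_number (\<lambda>u. \<rho> (m * u) *\<^sub>R cis (2 * pi * (m * u))) ?z
      = winding_number (\<lambda>u. \<rho> (m * u + (\<phi> - 1/2)) *\<^sub>R cis (2 * pi * (m * u + (\<phi> - 1/2)))) ?z"
  proof -
    define A where "A = (\<lambda>(s::real, u::real). \<rho> (m * u + s * (\<phi> - 1/2)))"
    define B where "B = (\<lambda>(s::real, u::real). 2 * pi * (m * u + s * (\<phi> - 1/2)))"
    have "winding_number (\<lambda>u. A (0, u) *\<^sub>R cis (B (0, u))) ?z = winding_number (\<lambda>u. A (1, u) *\<^sub>R cis (B (1, u))) ?z"
    proof (rule winding_number_polar_homotopy)
      show "continuous_on UNIV A"
        unfolding A_def split_beta by (intro continuous_on_compose2[OF cont] continuous_intros) auto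
      show "continuous_on UNIV B" unfolding B_def split_beta by (intro continuous_intros)
      fix s :: real
      have "A (s, 1) = A (s, 0)" using per[of "s * (\<phi> - 1/2)"] by (simp add: A_def add_ac)
      moreover have "cis (B (s, 1)) = cis (B (s, 0))"
        using polar_eq_iff[of 1 1 "B (s, 1)" "B (s, 0)"]
        by (auto simp: B_def algebra_simps intro: exI[of _ "int m"])
      ultimately show "A (s, 0) *\<^sub>R cis (B (s, 0)) = A (s, 1) *\<^sub>R cis (B (s, 1))" by simp
    next
      fix s u :: real
      show "A (s, u) *\<^sub>R cis (B (s, u)) \<noteq> ?z"
      proof
        assume eq: "A (s, u) *\<^sub>R cis (B (s, u)) = ?z"
        have "A (s, u) > 0" using pos by (simp add: A_def)
        then obtain n :: int where n: "A (s, u) = r" "B (s, u) = 2 * pi * \<phi> + 2 * pi * n"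
          using eq polar_eq_iff r by blast
        then obtain n :: int where "m * u + s * (\<phi> - 1/2) = \<phi> + n"
          using int_of[of "m * u + s * (\<phi> - 1/2)" \<phi> n] unfolding B_def by auto
        then show False using n(1) offint[of n] by (simp add: A_def)
      qed
    qed
    then show ?thesis by (simp add: A_def B_def)
  qed
  also have "\<dots> = winding_number g ?z"
  proof -
    \<comment> \<open>The damping is switched on gradually. Over the direction of the point the
      squared cosine is 1, so there the radius keeps its value, which differs from
      \<open>r\<close>.\<close>
    define A where "A = (\<lambda>(s::real, u::real). r + (\<rho> (m * u + (\<phi> - 1/2)) - r) * (1 - s + s * (cos (pi * (m * u - 1/2)))\<^sup>2))"
    define B where "B = (\<lambda>(s::real, u::real). 2 * pi * (m * u + (\<phi> - 1/2)) + 0 * s)"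
    have "winding_number (\<lambda>u. A (0, u) *\<^sub>R cis (B (0, u))) ?z = winding_number (\<lambda>u. A (1, u) *\<^sub>R cis (B (1, u))) ?z"
    proof (rule winding_number_polar_homotopy)
      show "continuous_on UNIV A"
        unfolding A_def split_beta by (intro continuous_on_compose2[OF cont] continuous_intros) auto
      show "continuous_on UNIV B" unfolding B_def split_beta by (intro continuous_intros)
      fix s :: real
      have c: "(cos (pi * (real m - 1/2)))\<^sup>2 = (cos (pi * (- 1/2)))\<^sup>2"
      proof -
        have "cos (pi * (real m - 1/2)) = cos (pi * m) * cos (pi / 2) + sin (pi * m) * sin (pi / 2)"
          using cos_diff[of "pi * m" "pi/2"] by (simp add: algebra_simps)
        also have "\<dots> = 0" using sin_npi2[of m] by simp
        finally show ?thesis by simp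
      qed
      have "A (s, 1) = A (s, 0)" using per[of "\<phi> - 1/2"] c by (simp add: A_def add_ac)
      moreover have "cis (B (s, 1)) = cis (B (s, 0))"
        using polar_eq_iff[of 1 1 "B (s, 1)" "B (s, 0)"]
        by (auto simp: B_def algebra_simps intro: exI[of _ "int m"])
      ultimately show "A (s, 0) *\<^sub>R cis (B (s, 0)) = A (s, 1) *\<^sub>R cis (B (s, 1))" by simp
    next
      fix s u :: real assume s: "s \<in> {0..1}"
      show "A (s, u) *\<^sub>R cis (B (s, u)) \<noteq> ?z"
      proof
        assume eq: "A (s, u) *\<^sub>R cis (B (s, u)) = ?z"
        let ?c = "(cos (pi * (m * u - 1/2)))\<^sup>2"
        have "s * ?c \<ge> 0" "s * ?c \<le> s" using s c2[of "pi * (m * u - 1/2)"] by (auto simp: mult_left_le)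
        then have "A (s, u) > 0" unfolding A_def split using s by (intro conv) auto
        then obtain n :: int where n: "A (s, u) = r" "B (s, u) = 2 * pi * \<phi> + 2 * pi * n"
          using eq polar_eq_iff r by blast
        then obtain n :: int where n': "m * u + (\<phi> - 1/2) = \<phi> + n"
          using int_of[of "m * u + (\<phi> - 1/2)" \<phi> n] unfolding B_def by auto
        then have "m * u - 1/2 = n" by simp
        then have "?c = 1" by (metis cos_int_times_real cos_npi_int power2_eq_1_iff mult.commute)
        then show False using n(1) offint[of n] n' by (simp add: A_def)
      qed
    qed
    then show ?thesis by (simp add: A_def B_def g_def \<rho>'_def algebra_simps)
  qed
  also have "\<dots> = of_nat (card {k \<in> {..<m}. r < \<rho> (\<phi> + k)})"
  proof -
    have "continuous_on UNIV g"
      unfolding g_def by (intro continuous_intros continuous_on_compose2[OF cont']) auto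
    then have path: "path g" unfolding path_def using continuous_on_subset by blast
    have cosk: "(cos (pi * real k))\<^sup>2 = 1" for k using cos_npi2[of k] by (simp add: power2_eq_1_iff flip: power_mult)
    have notin: "?z \<notin> path_image g"
    proof
      assume "?z \<in> path_image g"
      then obtain u where "g u = ?z" unfolding path_image_def by auto
      then obtain n :: int where n: "\<rho>' (m * u - 1/2) = r" "2 * pi * (\<phi> + m * u - 1/2) = 2 * pi * \<phi> + 2 * pi * n"
        using polar_eq_iff[OF pos' r] unfolding g_def by blast
      then obtain n :: int where n': "\<phi> + m * u - 1/2 = \<phi> + n"
        using int_of by blast
      then have n'': "m * u - 1/2 = n" by simp
      then have "(cos (pi * (m * u - 1/2)))\<^sup>2 = 1"
        by (metis cos_npi_int power2_eq_1_iff mult.commute)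
      then show False using n(1) offint[of n] n'' unfolding \<rho>'_def by simp
    qed
    \<comment> \<open>Each turn of the damped loop is closed by itself and meets the direction of
      the point at radius \<open>\<rho> (\<phi> + k)\<close>.\<close>
    have turn: "winding_number (subpath (k / m) (Suc k / m) g) ?z = (if r < \<rho> (\<phi> + k) then 1 else 0)"
      if k: "k < m" for k :: nat
    proof -
      let ?\<sigma> = "\<lambda>x::real. \<rho>' (k + x)"
      have half: "cos (pi * (real k + 1/2)) = 0" "cos (pi * (real k - 1/2)) = 0"
        using cos_add[of "pi * k" "pi/2"] cos_diff[of "pi * k" "pi/2"] sin_npi2[of k] by (simp_all add: algebra_simps)
      have \<sigma>0: "?\<sigma> 0 = \<rho> (\<phi> + k)" unfolding \<rho>'_def using cosk[of k] by simp
      have "winding_number (\<lambda>u. ?\<sigma> (u - 1/2) *\<^sub>R cis (2 * pi * (\<phi> + u - 1/2))) ?z = (if r < ?\<sigma> 0 then 1 else 0)"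
      proof (rule winding_number_polar_loop)
        show "continuous_on UNIV ?\<sigma>" by (intro continuous_on_compose2[OF cont'] continuous_intros) auto
        show "?\<sigma> (1/2) = ?\<sigma> (- 1/2)" unfolding \<rho>'_def using half by simp
        show "?\<sigma> 0 \<noteq> r" using \<sigma>0 off k by simp
      qed (use pos' r in auto)
      moreover have "subpath (k / m) (Suc k / m) g = (\<lambda>u. ?\<sigma> (u - 1/2) *\<^sub>R cis (2 * pi * (\<phi> + u - 1/2)))"
      proof
        fix u :: real
        have e: "m * ((real (Suc k) / m - k / m) * u + k / m) = k + u" using m by (simp add: field_simps)
        have "cis (2 * pi * (\<phi> + (k + u) - 1/2)) = cis (2 * pi * (\<phi> + u - 1/2))"
          using polar_eq_iff[of 1 1 "2 * pi * (\<phi> + (k + u) - 1/2)" "2 * pi * (\<phi> + u - 1/2)"]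
          by (auto simp: algebra_simps intro: exI[of _ "int k"])
        then show "subpath (k / m) (Suc k / m) g u = ?\<sigma> (u - 1/2) *\<^sub>R cis (2 * pi * (\<phi> + u - 1/2))"
          unfolding subpath_def g_def e by (simp add: add_diff_eq)
      qed
      ultimately show ?thesis using \<sigma>0 by simp
    qed
    have "winding_number (subpath 0 (k / m) g) ?z = (\<Sum>j<k. if r < \<rho> (\<phi> + j) then 1 else 0)" if "k \<le> m" for k :: nat
      using that
    proof (induction k)
      case 0
      have "g 0 \<noteq> ?z" using notin by (metis pathstart_def pathstart_in_path_image)
      then show ?case by simp
    next
      case (Suc k)
      have "real k / m \<in> {0..1}" "real (Suc k) / m \<in> {0..1}" using Suc.prems m by (auto simp: field_simps)
      then have "winding_number (subpath 0 (Suc k / m) g) ?z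
          = winding_number (subpath 0 (k / m) g) ?z + winding_number (subpath (k / m) (Suc k / m) g) ?z"
        using winding_number_subpath_combine[OF path notin, of 0 "k/m" "Suc k / m"] by auto
      then show ?case using Suc turn[of k] by simp
    qed
    from this[of m] have "winding_number g ?z = (\<Sum>j<m. if r < \<rho> (\<phi> + j) then 1 else 0)"
      using m by simp
    also have "\<dots> = of_nat (card {k \<in> {..<m}. r < \<rho> (\<phi> + k)})"
      by (simp add: sum.If_cases Int_def)
    finally show ?thesis .
  qed
  finally show ?thesis .
qed

section \<open>Curves winding around the origin\<close>

text \<open>Let \<open>r\<close> be the \<open>j\<close>-th largest value, counted with
  multiplicity. If exactly \<open>j\<close> values are at least \<open>r\<close>, there is a gap
  just below \<open>r\<close>; otherwise there are more, and \<open>r\<close> is a double value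
  taking the ranks \<open>j\<close> and \<open>j + 1\<close>.\<close>

lemma order_gap:
  fixes f :: "'a \<Rightarrow> real"
  assumes fin: "finite I" and pos: "\<And>a. a \<in> I \<Longrightarrow> f a > 0"
    and two: "\<And>r. card {a \<in> I. f a = r} \<le> 2" and j: "0 < j" "j < card I"
  shows "(\<exists>r>0. r \<notin> f ` I \<and> card {a \<in> I. r < f a} = j)
       \<or> (\<exists>r>0. card {a \<in> I. f a = r} = 2 \<and> Suc (card {a \<in> I. r < f a}) = j)"
proof -
  define V where "V = {r \<in> f ` I. j \<le> card {a \<in> I. r \<le> f a}}"
  have finV: "finite V" unfolding V_def using fin by simp
  have "I \<noteq> {}" using j by auto
  have "Min (f ` I) \<in> V"
  proof -
    have "{a \<in> I. Min (f ` I) \<le> f a} = I" using fin by auto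
    then show ?thesis unfolding V_def using j fin \<open>I \<noteq> {}\<close> by simp
  qed
  then have neV: "V \<noteq> {}" by blast
  define r where "r = Max V"
  have rV: "r \<in> V" unfolding r_def using finV neV by simp
  then have rI: "r \<in> f ` I" and ge: "j \<le> card {a \<in> I. r \<le> f a}" unfolding V_def by auto
  then have rpos: "r > 0" using pos by auto
  have less: "card {a \<in> I. r < f a} < j"
  proof (rule ccontr)
    assume *: "\<not> card {a \<in> I. r < f a} < j"
    let ?U = "{x \<in> f ` I. r < x}"
    have "{a \<in> I. r < f a} \<noteq> {}" using * j by (metis card.empty)
    then have ne: "?U \<noteq> {}" "finite ?U" using fin by auto
    then have m: "Min ?U \<in> ?U" using Min_in by blast
    have "{a \<in> I. Min ?U \<le> f a} = {a \<in> I. r < f a}"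
    proof (intro equalityI subsetI)
      fix a assume "a \<in> {a \<in> I. r < f a}"
      then show "a \<in> {a \<in> I. Min ?U \<le> f a}" using ne(2) Min_le[of ?U "f a"] by blast
    qed (use m in force)
    then have "Min ?U \<in> V" unfolding V_def using m * by auto
    then have "Min ?U \<le> r" unfolding r_def using finV by simp
    then show False using m by auto
  qed
  have split: "card {a \<in> I. r \<le> f a} = card {a \<in> I. r < f a} + card {a \<in> I. f a = r}"
  proof -
    have "{a \<in> I. r \<le> f a} = {a \<in> I. r < f a} \<union> {a \<in> I. f a = r}" by auto
    then show ?thesis using fin by (simp add: card_Un_disjoint disjoint_iff)
  qed
  show ?thesis
  proof (cases "card {a \<in> I. r \<le> f a} = j")
    case True
    \<comment> \<open>The element 0 keeps the gap below \<open>r\<close> within the positive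
      numbers.\<close>
    let ?B = "insert 0 {x \<in> f ` I. x < r}"
    have finB: "finite ?B" using fin by simp
    define l where "l = Max ?B"
    have lr: "0 \<le> l" "l < r" unfolding l_def using finB rpos by auto
    have lB: "x \<le> l" if "x \<in> f ` I" "x < r" for x unfolding l_def using finB that by (intro Max_ge) auto
    have "(l + r) / 2 \<notin> f ` I" using lB[of "(l + r) / 2"] lr by fastforce
    moreover have "{a \<in> I. (l + r) / 2 < f a} = {a \<in> I. r \<le> f a}"
    proof (intro equalityI subsetI)
      fix a assume a: "a \<in> {a \<in> I. (l + r) / 2 < f a}"
      then have "\<not> f a \<le> l" using lr by auto
      then show "a \<in> {a \<in> I. r \<le> f a}" using lB[of "f a"] a by force
    qed (use lr in auto)
    moreover have "(l + r) / 2 > 0" using lr by simp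
    ultimately show ?thesis using True by metis
  next
    case False
    then have "card {a \<in> I. f a = r} = 2 \<and> Suc (card {a \<in> I. r < f a}) = j"
      using ge less split two[of r] by linarith
    then show ?thesis using rpos by blast
  qed
qed

text \<open>Angles are measured in turns: they are ambiguous up to integers and grow by
  \<open>m\<close> over one period of a curve.\<close>

abbreviation polar :: "real \<Rightarrow> real \<Rightarrow> complex" where
  "polar r \<phi> \<equiv> r *\<^sub>R cis (2 * pi * \<phi>)"

lemma polar_angle:
  assumes "r > 0" "s > 0" "polar r x = polar s y"
  shows "r = s" "\<exists>n::int. x = y + n"
proof -
  obtain n :: int where n: "r = s" "2 * pi * x = 2 * pi * y + 2 * pi * n"
    using polar_eq_iff[OF assms(1,2)] assms(3) by blast
  then have "2 * pi * x = 2 * pi * (y + n)" by (simp add: algebra_simps)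
  then show "r = s" "\<exists>n::int. x = y + n" using n by auto
qed

lemma polar_add_int: "polar r (x + of_int n) = polar r x"
proof -
  have "cis (2 * pi * (x + of_int n)) = cis (2 * pi * x)"
    using polar_eq_iff[of 1 1 "2 * pi * (x + of_int n)" "2 * pi * x"] by (auto simp: algebra_simps)
  then show ?thesis by simp
qed

lemma polar_Arg2pi: "polar (cmod z) (Arg2pi z / (2 * pi)) = z"
proof -
  have "2 * pi * (Arg2pi z / (2 * pi)) = Arg2pi z" by simp
  then show ?thesis using Arg2pi_eq[of z] by (simp only: cis_conv_exp scaleR_conv_of_real)
qed

lemma polar_exhaust:
  assumes "z \<noteq> 0"
  obtains r \<phi> where "r > 0" "0 \<le> \<phi>" "\<phi> < 1" "z = polar r \<phi>"
proof
  show "z = polar (cmod z) (Arg2pi z / (2 * pi))" by (rule polar_Arg2pi[symmetric])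
qed (use assms Arg2pi_ge_0[of z] Arg2pi_lt_2pi[of z] in auto)

lemma Arg2pi_polar:
  assumes "r > 0" "0 \<le> x" "x < 1"
  shows "Arg2pi (polar r x) = 2 * pi * x"
  using assms by (intro Arg2pi_unique[of r]) (auto simp: cis_conv_exp scaleR_conv_of_real)

text \<open>\<open>L = 2\<close> will give the pair and \<open>L = 1\<close> each curve alone.
  \<open>R i\<close> is the radius of curve \<open>i\<close> as a function of its parameter, and
  \<open>R' i\<close> its derivative.\<close>

locale braid_curves =
  fixes L m :: nat and R R' :: "nat \<Rightarrow> real \<Rightarrow> real"
  assumes L_pos: "L > 0" and m_pos: "m > 0"
    and R_periodic: "\<And>i t. i < L \<Longrightarrow> R i (t + 1) = R i t"
    and R_pos: "\<And>i t. i < L \<Longrightarrow> R i t > 0"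
    and R_deriv: "\<And>i t. i < L \<Longrightarrow> (R i has_real_derivative R' i t) (at t)"
begin

definition curve :: "nat \<Rightarrow> real \<Rightarrow> complex" where
  "curve i t = polar (R i t) (real m * t)"

definition curves :: "(real \<Rightarrow> complex) list" where
  "curves = map curve [0..<L]"

text \<open>Strand \<open>(i, k)\<close> is the \<open>k\<close>-th turn of curve
  \<open>i\<close>.\<close>

definition strands :: "(nat \<times> nat) set" where
  "strands = {..<L} \<times> {..<m}"

definition radius :: "nat \<times> nat \<Rightarrow> real \<Rightarrow> real" where
  "radius a \<phi> = R (fst a) ((\<phi> + snd a) / m)"

text \<open>Derivative with respect to the parameter of the curve; the slope of
  \<open>radius a\<close> over the angle is this divided by \<open>m\<close>.\<close>

definition radius' :: "nat \<times> nat \<Rightarrow> real \<Rightarrow> real" where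
  "radius' a \<phi> = R' (fst a) ((\<phi> + snd a) / m)"

definition count :: "(real \<Rightarrow> bool) \<Rightarrow> real \<Rightarrow> nat" where
  "count P \<phi> = card {a \<in> strands. P (radius a \<phi>)}"

lemma finite_strands [simp]: "finite strands" and card_strands: "card strands = L * m"
  unfolding strands_def by auto

lemma radius_pos: "a \<in> strands \<Longrightarrow> radius a \<phi> > 0"
  unfolding strands_def radius_def using R_pos by auto

lemma R_cont: "i < L \<Longrightarrow> continuous_on UNIV (R i)"
  by (meson DERIV_isCont R_deriv continuous_at_imp_continuous_on)

lemma radius_deriv:
  assumes "a \<in> strands" shows "(radius a has_real_derivative radius' a \<phi> / m) (at \<phi>)"
proof -
  have "((\<lambda>x. R (fst a) ((x + snd a) / m)) has_real_derivative radius' a \<phi> * (1 / m)) (at \<phi>)"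
    unfolding radius'_def
    by (rule DERIV_chain2[OF R_deriv]) (use assms in \<open>auto simp: strands_def intro!: derivative_eq_intros\<close>)
  then show ?thesis unfolding radius_def by simp
qed

lemma R_periodic_int: "i < L \<Longrightarrow> R i (t + of_int n) = R i t"
  using periodic_shift_int[of "R i" 1] R_periodic by simp

lemma curve_periodic_int:
  assumes "i < L" shows "curve i (t + of_int n) = curve i t"
proof -
  have "real m * (t + of_int n) = real m * t + of_int (int m * n)" by (simp add: algebra_simps)
  then show ?thesis unfolding curve_def R_periodic_int[OF assms] by (simp only: polar_add_int)
qed

lemma radius_add_int:
  assumes "i < L"
  shows "R i ((\<phi> + real_of_int n) / m) = radius (i, nat (n mod m)) \<phi>"
proof -
  have "real_of_int n = real_of_int (n div m * m + n mod m)" by simp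
  also have "\<dots> = of_int (n div m) * real m + nat (n mod m)"
    using m_pos by (simp only: of_int_add of_int_mult of_int_of_nat_eq) (simp add: of_nat_nat)
  finally have "(\<phi> + real_of_int n) / m = (\<phi> + nat (n mod m)) / m + of_int (n div m)"
    using m_pos by (simp add: field_simps)
  then show ?thesis using R_periodic_int[OF assms] unfolding radius_def by simp
qed

lemma nat_mod_strand: "i < L \<Longrightarrow> (i, nat (n mod int m)) \<in> strands"
  unfolding strands_def using m_pos by (simp add: nat_less_iff)

lemma curve_radius: "curve i ((\<phi> + real k) / m) = polar (radius (i, k) \<phi>) \<phi>"
proof -
  have "real m * ((\<phi> + real k) / m) = \<phi> + of_int (int k)" using m_pos by simp
  then have "curve i ((\<phi> + real k) / m) = polar (radius (i, k) \<phi>) (\<phi> + of_int (int k))"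
    unfolding curve_def radius_def fst_conv snd_conv by (rule arg_cong)
  then show ?thesis unfolding polar_add_int .
qed

lemma path_curve: "i < L \<Longrightarrow> path (curve i)"
  unfolding path_def curve_def
  by (intro continuous_intros continuous_on_subset[OF R_cont]) auto

lemma loop_curve: "i < L \<Longrightarrow> pathfinish (curve i) = pathstart (curve i)"
  using curve_periodic_int[of i 0 1] unfolding pathfinish_def pathstart_def by simp

lemma curve_eq_polar:
  assumes i: "i < L" and r: "r > 0" and eq: "curve i t = polar r \<phi>"
  obtains n :: int where "t = (\<phi> + n) / m" "radius (i, nat (n mod m)) \<phi> = r"
proof -
  obtain n :: int where n: "m * t = \<phi> + n" and Rt: "R i t = r"
    using polar_angle[OF R_pos[OF i] r] eq unfolding curve_def by blast
  then have t: "t = (\<phi> + n) / m" using m_pos by (simp add: field_simps)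
  then show thesis using that[of n] Rt radius_add_int[OF i] by simp
qed

lemma path_image_curve_iff:
  assumes i: "i < L" and r: "r > 0"
  shows "polar r \<phi> \<in> path_image (curve i) \<longleftrightarrow> (\<exists>k<m. radius (i, k) \<phi> = r)"
proof
  assume "polar r \<phi> \<in> path_image (curve i)"
  then obtain t where "curve i t = polar r \<phi>" unfolding path_image_def by auto
  then obtain n :: int where "radius (i, nat (n mod m)) \<phi> = r" using curve_eq_polar[OF i r] by metis
  then show "\<exists>k<m. radius (i, k) \<phi> = r" using nat_mod_strand[OF i, of n] unfolding strands_def by blast
next
  assume "\<exists>k<m. radius (i, k) \<phi> = r"
  then obtain k where k: "k < m" "radius (i, k) \<phi> = r" by blast
  let ?t = "(\<phi> + real k) / m"
  have "curve i (frac ?t) = curve i ?t"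
    using curve_periodic_int[OF i, of "frac ?t" "\<lfloor>?t\<rfloor>"] by (simp add: frac_def)
  then have "curve i (frac ?t) = polar r \<phi>" using curve_radius k by simp
  moreover have "frac ?t \<in> {0..1}" using frac_lt_1[of ?t] by simp
  ultimately show "polar r \<phi> \<in> path_image (curve i)" unfolding path_image_def by (metis imageI)
qed

lemma curves_image_iff:
  assumes "r > 0"
  shows "polar r \<phi> \<in> curves_image curves \<longleftrightarrow> (\<exists>a\<in>strands. radius a \<phi> = r)"
  unfolding curves_image_def curves_def strands_def using path_image_curve_iff[OF _ assms] by auto

lemma zero_notin_image: "0 \<notin> curves_image curves"
proof
  assume "0 \<in> curves_image curves"
  then obtain i t where "i < L" "0 = curve i t"
    unfolding curves_image_def curves_def path_image_def by auto
  then show False using R_pos[of i t] unfolding curve_def by simp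
qed

lemma open_complement: "open (- curves_image curves)"
  unfolding curves_image_def curves_def using path_curve
  by (intro open_Compl closed_UN) (auto intro!: closed_path_image)

text \<open>A full turn shifts the strands of each curve cyclically, because the curve closes after
  \<open>m\<close> turns. So the radii are only permuted.\<close>

lemma count_add_int: "count P (\<phi> + real_of_int n) = count P \<phi>"
proof -
  define s where "s = (\<lambda>a::nat \<times> nat. (fst a, nat ((int (snd a) + n) mod m)))"
  have inj: "inj_on s strands"
  proof (rule inj_onI)
    fix a b assume ab: "a \<in> strands" "b \<in> strands" "s a = s b"
    then have "(int (snd a) + n) mod m = (int (snd b) + n) mod m"
      unfolding s_def using m_pos by (simp add: nat_eq_iff2)
    then have "int (snd a) mod m = int (snd b) mod m" by (metis add_diff_cancel_right' mod_diff_left_eq)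
    then have "snd a = snd b" using ab unfolding strands_def by auto
    then show "a = b" using ab unfolding s_def by (simp add: prod_eq_iff)
  qed
  have sub: "s ` strands \<subseteq> strands" using nat_mod_strand unfolding s_def strands_def by auto
  then have im: "s ` strands = strands" by (intro endo_inj_surj finite_strands inj)
  have rad: "radius (s a) \<phi> = radius a (\<phi> + real_of_int n)" if "a \<in> strands" for a
  proof -
    have "fst a < L" using that unfolding strands_def by auto
    then show ?thesis
      using radius_add_int[of "fst a" \<phi> "int (snd a) + n"] unfolding s_def radius_def by (simp add: add_ac)
  qed
  have "{a \<in> strands. P (radius a \<phi>)} = s ` {a \<in> strands. P (radius a (\<phi> + real_of_int n))}"
  proof (intro equalityI subsetI)
    fix b assume b: "b \<in> {a \<in> strands. P (radius a \<phi>)}"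
    then obtain a where "a \<in> strands" "b = s a" using im by blast
    then show "b \<in> s ` {a \<in> strands. P (radius a (\<phi> + real_of_int n))}" using rad b by auto
  qed (use rad sub in auto)
  moreover have "card (s ` {a \<in> strands. P (radius a (\<phi> + real_of_int n))}) = card {a \<in> strands. P (radius a (\<phi> + real_of_int n))}"
    by (rule card_image) (rule inj_on_subset[OF inj], blast)
  ultimately show ?thesis unfolding count_def by simp
qed

text \<open>The number of strands strictly farther out. It is defined on the curves too: at a
  crossing it will be the index minus 1. At 0, where \<open>Arg2pi\<close> is 0, all strands
  count.\<close>

definition level :: "complex \<Rightarrow> nat" where
  "level z = count (\<lambda>x. cmod z < x) (Arg2pi z / (2 * pi))"

lemma level_polar:
  assumes "r > 0" shows "level (polar r \<phi>) = count (\<lambda>x. r < x) \<phi>"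
proof -
  let ?z = "polar r \<phi>"
  have nz: "cmod ?z = r" using assms by simp
  have "?z = polar r (Arg2pi ?z / (2 * pi))"
    using polar_Arg2pi[of ?z] unfolding nz by (rule sym)
  then obtain n :: int where "Arg2pi ?z / (2 * pi) = \<phi> + n"
    using polar_angle(2)[OF assms assms] by metis
  then show ?thesis unfolding level_def using nz count_add_int by simp
qed

definition total_winding :: "complex \<Rightarrow> complex" where
  "total_winding z = (\<Sum>S\<leftarrow>curves. winding_number S z)"

lemma total_winding_sum: "total_winding z = (\<Sum>i<L. winding_number (curve i) z)"
  unfolding total_winding_def curves_def
  by (simp add: o_def interv_sum_list_conv_sum_set_nat atLeast0LessThan)

lemma total_winding_const:
  assumes "connected D" "D \<subseteq> - curves_image curves" "x \<in> D" "y \<in> D"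
  shows "total_winding x = total_winding y"
proof -
  have "winding_number (curve i) x = winding_number (curve i) y" if "i < L" for i
  proof (rule winding_number_eq[OF path_curve loop_curve assms(3,4,1)])
    show "D \<inter> path_image (curve i) = {}"
      using assms(2) that unfolding curves_image_def curves_def by auto
  qed (use that in auto)
  then show ?thesis unfolding total_winding_sum by simp
qed

lemma total_winding_polar:
  assumes r: "r > 0" and off: "polar r \<phi> \<notin> curves_image curves"
  shows "total_winding (polar r \<phi>) = of_nat (count (\<lambda>x. r < x) \<phi>)"
proof -
  have w: "winding_number (curve i) (polar r \<phi>) = of_nat (card {k \<in> {..<m}. r < radius (i, k) \<phi>})" if i: "i < L" for i
  proof -
    have "winding_number (\<lambda>u. (\<lambda>x. R i (x / m)) (m * u) *\<^sub>R cis (2 * pi * (m * u))) (polar r \<phi>)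
       = of_nat (card {k \<in> {..<m}. r < (\<lambda>x. R i (x / m)) (\<phi> + k)})"
    proof (rule winding_number_closed_braid)
      show "continuous_on UNIV (\<lambda>x. R i (x / m))"
        by (intro continuous_on_compose2[OF R_cont[OF i]] continuous_intros) (auto simp: m_pos)
      show "R i ((x + m) / m) = R i (x / m)" for x :: real
        using R_periodic[OF i, of "x / m"] m_pos by (simp add: add_divide_distrib)
      show "R i ((\<phi> + k) / m) \<noteq> r" if "k < m" for k :: nat
        using off that i unfolding curves_image_iff[OF r] strands_def radius_def by force
    qed (use m_pos r R_pos[OF i] in auto)
    then show ?thesis using m_pos unfolding curve_def radius_def by simp
  qed
  have "total_winding (polar r \<phi>) = (\<Sum>i<L. winding_number (curve i) (polar r \<phi>))"
    by (rule total_winding_sum)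
  also have "\<dots> = of_nat (\<Sum>i<L. card {k \<in> {..<m}. r < radius (i, k) \<phi>})" using w by simp
  also have "(\<Sum>i<L. card {k \<in> {..<m}. r < radius (i, k) \<phi>}) = card (SIGMA i:{..<L}. {k \<in> {..<m}. r < radius (i, k) \<phi>})"
    by simp
  also have "(SIGMA i:{..<L}. {k \<in> {..<m}. r < radius (i, k) \<phi>}) = {a \<in> strands. r < radius a \<phi>}"
    unfolding strands_def by auto
  finally show ?thesis unfolding count_def .
qed

lemma total_winding_level:
  assumes "z \<notin> curves_image curves" shows "total_winding z = of_nat (level z)"
proof (cases "z = 0")
  case False
  then obtain r \<phi> where "r > 0" "z = polar r \<phi>" using polar_exhaust by metis
  then show ?thesis using total_winding_polar level_polar assms by simp
next
  case True
  \<comment> \<open>The origin has no direction, so its winding number is read off at another point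
    of a disc around it that avoids the curves.\<close>
  obtain e where e: "e > 0" "ball 0 e \<subseteq> - curves_image curves"
    using open_complement zero_notin_image unfolding open_contains_ball by blast
  have b: "polar (e / 2) 0 \<in> ball 0 e" "z \<in> ball 0 e" using e(1) True by auto
  have off: "polar (e / 2) 0 \<notin> curves_image curves" using b(1) e(2) by blast
  have "total_winding z = total_winding (polar (e / 2) 0)"
    by (rule total_winding_const[OF connected_ball e(2) b(2,1)])
  also have "\<dots> = of_nat (count (\<lambda>x. e / 2 < x) 0)"
    by (rule total_winding_polar[OF _ off]) (use e(1) in simp)
  also have "count (\<lambda>x. e / 2 < x) 0 = count (\<lambda>x. 0 < x) 0"
  proof -
    have "e / 2 < radius a 0" if "a \<in> strands" for a
    proof (rule ccontr)
      assume "\<not> e / 2 < radius a 0"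
      then have "polar (radius a 0) 0 \<in> ball 0 e" using radius_pos[OF that, of 0] e(1) by simp
      then have "polar (radius a 0) 0 \<notin> curves_image curves" using e(2) by blast
      then show False using curves_image_iff[OF radius_pos[OF that, of 0], of 0] that by blast
    qed
    then have "{a \<in> strands. e / 2 < radius a 0} = {a \<in> strands. 0 < radius a 0}"
      using radius_pos by auto
    then show ?thesis unfolding count_def by simp
  qed
  finally show ?thesis using True unfolding level_def by (simp add: Arg2pi_0)
qed

text \<open>Off the curves the level is a winding number, which gives its constancy without
  following the strands continuously.\<close>

lemma level_const:
  assumes "connected D" "D \<subseteq> - curves_image curves" "x \<in> D" "y \<in> D"
  shows "level x = level y"
proof -
  have "x \<notin> curves_image curves" "y \<notin> curves_image curves" using assms(2-4) by auto
  then have "(of_nat (level x) :: complex) = of_nat (level y)"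
    using total_winding_const[OF assms] by (simp add: total_winding_level)
  then show ?thesis by simp
qed

lemma omega_level:
  assumes C: "C \<in> components (- curves_image curves)" and z: "z \<in> C"
  shows "omega curves C = int (level z)"
proof -
  have eq: "(\<Sum>S\<leftarrow>curves. winding_number S w) = of_nat (level z)" if w: "w \<in> C" for w
  proof -
    have "w \<notin> curves_image curves" using in_components_subset[OF C] w by (meson ComplD subsetD)
    then have "(\<Sum>S\<leftarrow>curves. winding_number S w) = of_nat (level w)"
      using total_winding_level unfolding total_winding_def by metis
    also have "level w = level z"
      by (rule level_const[OF in_components_connected[OF C] in_components_subset[OF C] w z])
    finally show ?thesis .
  qed
  have "k = int (level z)" if k: "\<forall>w\<in>C. (\<Sum>S\<leftarrow>curves. winding_number S w) = of_int k" for k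
  proof -
    have "(of_nat (level z) :: complex) = of_int k" using eq[OF z] k z by metis
    then show ?thesis by (metis of_int_eq_iff of_int_of_nat_eq)
  qed
  moreover have "\<forall>w\<in>C. (\<Sum>S\<leftarrow>curves. winding_number S w) = of_int (int (level z))"
    using eq by (metis of_int_of_nat_eq)
  ultimately show ?thesis unfolding omega_def by (intro the_equality) metis+
qed

end

section \<open>Generic braids: crossings and regions of constant level\<close>

text \<open>Since all strands have the same angular speed, transversality amounts to distinct radial
  speeds. In \<open>all_levels\<close>, \<open>j - 1\<close> strands lie outside the crossing, which
  itself takes the positions \<open>j\<close> and \<open>j + 1\<close>.\<close>

locale generic_braid = braid_curves +
  assumes transversal: "\<And>a b \<phi>. \<lbrakk>a \<in> strands; b \<in> strands; a \<noteq> b; radius a \<phi> = radius b \<phi>\<rbrakk>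
      \<Longrightarrow> radius' a \<phi> \<noteq> radius' b \<phi>"
    and no_triple: "\<And>r \<phi>. count (\<lambda>x. x = r) \<phi> \<le> 2"
    and finite_crossings: "finite {\<phi> \<in> {0..<1}. \<exists>r. count (\<lambda>x. x = r) \<phi> = 2}"
    and all_levels: "\<And>j. \<lbrakk>0 < j; j < L * m\<rbrakk>
      \<Longrightarrow> \<exists>r \<phi>. count (\<lambda>x. x = r) \<phi> = 2 \<and> Suc (count (\<lambda>x. r < x) \<phi>) = j"
begin

lemma count_radius_pos:
  assumes "count (\<lambda>x. x = r) \<phi> > 0" shows "r > 0"
proof -
  have "{a \<in> strands. radius a \<phi> = r} \<noteq> {}" using assms unfolding count_def by (metis card.empty less_irrefl)
  then show ?thesis using radius_pos by auto
qed

text \<open>\<open>fiber\<close> takes parameters in the half-open unit interval. An angle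
  normalised to \<open>[0, 1)\<close> makes \<open>(\<phi> + k) / m\<close> with
  \<open>k < m\<close> run exactly through the parameters over that direction.\<close>

lemma bij_betw_fiber:
  assumes r: "r > 0" and \<phi>: "0 \<le> \<phi>" "\<phi> < 1"
  shows "bij_betw (\<lambda>a. (fst a, (\<phi> + real (snd a)) / m)) {a \<in> strands. radius a \<phi> = r} (fiber curves (polar r \<phi>))"
  unfolding bij_betw_def
proof
  show "inj_on (\<lambda>a. (fst a, (\<phi> + real (snd a)) / m)) {a \<in> strands. radius a \<phi> = r}"
  proof (rule inj_onI)
    fix a b assume "(fst a, (\<phi> + real (snd a)) / m) = (fst b, (\<phi> + real (snd b)) / m)"
    then have "fst a = fst b" "\<phi> + real (snd a) = \<phi> + real (snd b)" using m_pos by auto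
    then show "a = b" by (intro prod_eqI) auto
  qed
  show "(\<lambda>a. (fst a, (\<phi> + real (snd a)) / m)) ` {a \<in> strands. radius a \<phi> = r} = fiber curves (polar r \<phi>)"
  proof (intro equalityI subsetI)
    fix p assume "p \<in> (\<lambda>a. (fst a, (\<phi> + real (snd a)) / m)) ` {a \<in> strands. radius a \<phi> = r}"
    then obtain i k where a: "(i, k) \<in> strands" "radius (i, k) \<phi> = r" "p = (i, (\<phi> + real k) / m)" by auto
    then have ik: "i < L" "k < m" unfolding strands_def by auto
    have "real k + 1 \<le> real m" using ik by linarith
    then have "\<phi> + real k < m" using \<phi> by linarith
    then have "(\<phi> + real k) / m \<in> {0..<1}" using \<phi> m_pos by simp
    moreover have "curve i ((\<phi> + real k) / m) = polar r \<phi>" using curve_radius[of i \<phi> k] a(2) by simp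
    ultimately show "p \<in> fiber curves (polar r \<phi>)" unfolding fiber_def curves_def using ik a(3) by simp
  next
    fix p assume p: "p \<in> fiber curves (polar r \<phi>)"
    obtain i t where pit: "p = (i, t)" by (cases p)
    then have i: "i < L" and t: "0 \<le> t" "t < 1" and eq: "curve i t = polar r \<phi>"
      using p unfolding fiber_def curves_def by auto
    obtain n :: int where n: "t = (\<phi> + n) / m" "radius (i, nat (n mod m)) \<phi> = r"
      using curve_eq_polar[OF i r eq] by blast
    have mt: "real m * t = \<phi> + n" using n(1) m_pos by (simp add: field_simps)
    have "0 \<le> real m * t" "real m * t < m" using t m_pos by auto
    then have "- 1 < n" "n < int m" using mt \<phi> by linarith+
    then have "n mod m = n" "nat n < m" "real (nat n) = n" by auto
    then have "(i, nat n) \<in> {a \<in> strands. radius a \<phi> = r}" "p = (i, (\<phi> + real (nat n)) / m)"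
      using n i pit unfolding strands_def by auto
    then show "p \<in> (\<lambda>a. (fst a, (\<phi> + real (snd a)) / m)) ` {a \<in> strands. radius a \<phi> = r}"
      by (intro image_eqI[of _ _ "(i, nat n)"]) auto
  qed
qed

lemma polar_frac: "polar r (frac \<phi>) = polar r \<phi>"
proof -
  have "polar r (frac \<phi> + of_int \<lfloor>\<phi>\<rfloor>) = polar r (frac \<phi>)" by (rule polar_add_int)
  moreover have "frac \<phi> + of_int \<lfloor>\<phi>\<rfloor> = \<phi>" by (simp add: frac_def)
  ultimately show ?thesis by metis
qed

lemma count_frac: "count P (frac \<phi>) = count P \<phi>"
proof -
  have "count P (frac \<phi> + of_int \<lfloor>\<phi>\<rfloor>) = count P (frac \<phi>)" by (rule count_add_int)
  then show ?thesis by (simp add: frac_def)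
qed

lemma card_fiber_polar:
  assumes r: "r > 0" shows "card (fiber curves (polar r \<phi>)) = count (\<lambda>x. x = r) \<phi>"
proof -
  have "card (fiber curves (polar r (frac \<phi>))) = count (\<lambda>x. x = r) (frac \<phi>)"
    using bij_betw_same_card[OF bij_betw_fiber[OF r, of "frac \<phi>"]] frac_lt_1[of \<phi>] unfolding count_def by simp
  then show ?thesis unfolding polar_frac count_frac .
qed

lemma fiber_zero: "fiber curves 0 = {}"
proof -
  have "curve i t \<noteq> 0" if "i < L" for i t using R_pos[OF that, of t] unfolding curve_def by simp
  then show ?thesis unfolding fiber_def curves_def by auto
qed

lemma double_points_polar:
  assumes "p \<in> double_points curves"
  obtains r \<phi> where "r > 0" "0 \<le> \<phi>" "\<phi> < 1" "p = polar r \<phi>" "count (\<lambda>x. x = r) \<phi> = 2"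
proof -
  have c: "card (fiber curves p) = 2" using assms unfolding double_points_def by simp
  then have "p \<noteq> 0" using fiber_zero by auto
  then obtain r \<phi> where "r > 0" "0 \<le> \<phi>" "\<phi> < 1" "p = polar r \<phi>" using polar_exhaust by blast
  then show thesis using that card_fiber_polar c by metis
qed

lemma polar_double_point: "count (\<lambda>x. x = r) \<phi> = 2 \<Longrightarrow> polar r \<phi> \<in> double_points curves"
  using count_radius_pos[of r \<phi>] card_fiber_polar[of r \<phi>] unfolding double_points_def by simp

lemma finite_double_points: "finite (double_points curves)"
proof (rule finite_subset)
  let ?\<Phi> = "{\<phi> \<in> {0..<1}. \<exists>r. count (\<lambda>x. x = r) \<phi> = 2}"
  show "double_points curves \<subseteq> (\<Union>\<phi>\<in>?\<Phi>. (\<lambda>a. polar (radius a \<phi>) \<phi>) ` strands)"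
  proof
    fix p assume "p \<in> double_points curves"
    then obtain r \<phi> where p: "r > 0" "0 \<le> \<phi>" "\<phi> < 1" "p = polar r \<phi>" "count (\<lambda>x. x = r) \<phi> = 2"
      using double_points_polar by blast
    then have "{a \<in> strands. radius a \<phi> = r} \<noteq> {}" unfolding count_def by (metis card.empty zero_neq_numeral)
    then obtain a where "a \<in> strands" "radius a \<phi> = r" by blast
    moreover have "\<phi> \<in> ?\<Phi>" using p by auto
    ultimately show "p \<in> (\<Union>\<phi>\<in>?\<Phi>. (\<lambda>a. polar (radius a \<phi>) \<phi>) ` strands)" using p(4) by blast
  qed
  show "finite (\<Union>\<phi>\<in>?\<Phi>. (\<lambda>a. polar (radius a \<phi>) \<phi>) ` strands)"
    using finite_crossings by simp
qed

lemma count_mono: "(\<And>x. P x \<Longrightarrow> Q x) \<Longrightarrow> count P \<phi> \<le> count Q \<phi>"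
  unfolding count_def by (intro card_mono) auto

lemma count_le: "count P \<phi> \<le> L * m"
  unfolding count_def card_strands[symmetric] by (intro card_mono) auto

lemma count_ge: "count (\<lambda>x. r \<le> x) \<phi> = count (\<lambda>x. r < x) \<phi> + count (\<lambda>x. x = r) \<phi>"
proof -
  have "{a \<in> strands. r \<le> radius a \<phi>} = {a \<in> strands. r < radius a \<phi>} \<union> {a \<in> strands. radius a \<phi> = r}" by auto
  then show ?thesis unfolding count_def by (simp add: card_Un_disjoint disjoint_iff)
qed

lemma complement_iff: "r > 0 \<Longrightarrow> polar r \<phi> \<in> - curves_image curves \<longleftrightarrow> count (\<lambda>x. x = r) \<phi> = 0"
  using curves_image_iff[of r \<phi>] unfolding count_def by auto

definition region :: "nat \<Rightarrow> complex set" where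
  "region j = {z \<in> - curves_image curves. level z = j}"

text \<open>Double points grouped by index: \<open>level\<close> counts the strands strictly
  outside, so the crossing takes the positions \<open>j\<close> and \<open>j + 1\<close> from
  outside.\<close>

definition crossings :: "nat \<Rightarrow> complex set" where
  "crossings j = {p \<in> double_points curves. Suc (level p) = j}"

lemma region_iff:
  "r > 0 \<Longrightarrow> polar r \<phi> \<in> region j \<longleftrightarrow> count (\<lambda>x. x = r) \<phi> = 0 \<and> count (\<lambda>x. r < x) \<phi> = j"
  by (simp only: region_def mem_Collect_eq complement_iff level_polar)

lemma level_le: "level z \<le> L * m"
  unfolding level_def by (rule count_le)

lemma components_complement:
  "components (- curves_image curves) = (\<Union>j\<in>{..L * m}. components (region j))"
  unfolding region_def
proof (rule components_constant_on)
  show "level ` (- curves_image curves) \<subseteq> {..L * m}" using level_le by auto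
qed (rule level_const)

lemma open_region: "open (region j)"
  unfolding open_contains_ball
proof
  fix z assume z: "z \<in> region j"
  then obtain e where e: "e > 0" "ball z e \<subseteq> - curves_image curves"
    using open_complement unfolding open_contains_ball region_def by blast
  have "level w = level z" if "w \<in> ball z e" for w
    by (rule level_const[OF connected_ball e(2) that]) (use e(1) in simp)
  moreover have "level z = j" using z unfolding region_def by blast
  ultimately have "ball z e \<subseteq> region j" using e(2) unfolding region_def by blast
  then show "\<exists>e>0. ball z e \<subseteq> region j" using e(1) by blast
qed

text \<open>Over every angle the region of level \<open>j\<close> is either present or pinched off
  by a crossing of index \<open>j\<close>, never both. One of them occurs by the gap argument for
  the ordered radii; both cannot, since the number of strands outside is monotone in the
  radius.\<close>

lemma gap_iff:
  assumes j: "0 < j" "j < L * m"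
  shows "(\<exists>r>0. polar r \<phi> \<in> region j) \<longleftrightarrow> \<not> (\<exists>r>0. polar r \<phi> \<in> crossings j)"
proof -
  have cr: "polar r \<phi> \<in> crossings j \<longleftrightarrow> count (\<lambda>x. x = r) \<phi> = 2 \<and> Suc (count (\<lambda>x. r < x) \<phi>) = j" if "r > 0" for r
    using card_fiber_polar[OF that, of \<phi>] level_polar[OF that, of \<phi>] unfolding crossings_def double_points_def by simp
  have "(\<exists>r>0. polar r \<phi> \<in> region j) \<or> (\<exists>r>0. polar r \<phi> \<in> crossings j)"
  proof -
    have "(\<exists>r>0. r \<notin> (\<lambda>a. radius a \<phi>) ` strands \<and> card {a \<in> strands. r < radius a \<phi>} = j)
       \<or> (\<exists>r>0. card {a \<in> strands. radius a \<phi> = r} = 2 \<and> Suc (card {a \<in> strands. r < radius a \<phi>}) = j)"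
      by (rule order_gap) (use radius_pos j card_strands no_triple in \<open>auto simp: count_def\<close>)
    moreover have "polar r \<phi> \<in> region j"
      if "r > 0" "r \<notin> (\<lambda>a. radius a \<phi>) ` strands" "card {a \<in> strands. r < radius a \<phi>} = j" for r
      using that curves_image_iff[OF that(1)] level_polar[OF that(1)] unfolding region_def count_def by auto
    ultimately show ?thesis using cr unfolding count_def by blast
  qed
  moreover have False if r: "r > 0" "polar r \<phi> \<in> region j" and s: "s > 0" "polar s \<phi> \<in> crossings j" for r s
  proof -
    have *: "count (\<lambda>x. x = r) \<phi> = 0" "count (\<lambda>x. r < x) \<phi> = j" using r region_iff by auto
    have **: "count (\<lambda>x. x = s) \<phi> = 2" "Suc (count (\<lambda>x. s < x) \<phi>) = j" using s cr by auto
    \<comment> \<open>A crossing at \<open>s\<close> has \<open>j + 1\<close> strands at radius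
      \<open>s\<close> or more, too many for a point farther in; a point not farther in has at most
      \<open>j - 1\<close> strands outside.\<close>
    show False
    proof (cases "r < s")
      case True
      then have "count (\<lambda>x. s \<le> x) \<phi> \<le> count (\<lambda>x. r < x) \<phi>" by (intro count_mono) auto
      then show False using * ** count_ge[of s \<phi>] by simp
    next
      case False
      then have "count (\<lambda>x. r < x) \<phi> \<le> count (\<lambda>x. s < x) \<phi>" by (intro count_mono) auto
      then show False using * ** by simp
    qed
  qed
  ultimately show ?thesis by blast
qed

text \<open>The inner of two such crossings would have at least \<open>j + 1\<close> strands
  outside, but it has \<open>j - 1\<close>.\<close>

lemma crossings_unique_radius:
  assumes "r > 0" "s > 0" "polar r \<phi> \<in> crossings j" "polar s \<phi> \<in> crossings j"
  shows "r = s"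
proof -
  have cr: "count (\<lambda>x. x = r) \<phi> = 2 \<and> Suc (count (\<lambda>x. r < x) \<phi>) = j"
    if "r > 0" "polar r \<phi> \<in> crossings j" for r
    using that card_fiber_polar[of r \<phi>] level_polar[of r \<phi>] unfolding crossings_def double_points_def by simp
  have "\<not> r < s" if "r > 0" "s > 0" "polar r \<phi> \<in> crossings j" "polar s \<phi> \<in> crossings j" for r s
  proof
    assume "r < s"
    then have "count (\<lambda>x. s \<le> x) \<phi> \<le> count (\<lambda>x. r < x) \<phi>" by (intro count_mono) auto
    then show False using cr[OF that(1,3)] cr[OF that(2,4)] count_ge[of s \<phi>] by simp
  qed
  then show ?thesis using assms by (meson linorder_neqE_linordered_idom)
qed

text \<open>The numbers of strands beyond, and at or beyond, a given radius are monotone, so their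
  common value at two radii persists between them. The admissible radii form an interval.\<close>

lemma connected_region_ray: "connected ((\<lambda>r. polar r \<phi>) ` {r. r > 0 \<and> polar r \<phi> \<in> region j})"
proof (intro connected_continuous_image continuous_intros)
  have "is_interval {r. r > 0 \<and> polar r \<phi> \<in> region j}"
    unfolding is_interval_1
  proof safe
    fix a b x :: real
    assume ab: "a > 0" "polar a \<phi> \<in> region j" "b > 0" "polar b \<phi> \<in> region j" "a \<le> x" "x \<le> b"
    then show "x > 0" by simp
    have A: "count (\<lambda>x. x = a) \<phi> = 0" "count (\<lambda>x. a < x) \<phi> = j" "count (\<lambda>x. x = b) \<phi> = 0" "count (\<lambda>x. b < x) \<phi> = j"
      using ab region_iff by auto
    have "count (\<lambda>y. b < y) \<phi> \<le> count (\<lambda>y. x < y) \<phi>" "count (\<lambda>y. x \<le> y) \<phi> \<le> count (\<lambda>y. a \<le> y) \<phi>"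
      using ab by (auto intro!: count_mono)
    then have "count (\<lambda>y. y = x) \<phi> = 0" "count (\<lambda>y. x < y) \<phi> = j"
      using A count_ge[of x \<phi>] count_ge[of a \<phi>] by auto
    then show "polar x \<phi> \<in> region j" using region_iff \<open>x > 0\<close> by blast
  qed
  then show "connected {r. r > 0 \<and> polar r \<phi> \<in> region j}" by (simp add: is_interval_connected)
qed

end

section \<open>Components of the complement\<close>

context generic_braid
begin

lemma level_zero: "level 0 = L * m"
proof -
  have "{a \<in> strands. 0 < radius a 0} = strands" using radius_pos by auto
  then show ?thesis unfolding level_def count_def by (simp add: card_strands)
qed

text \<open>Angles are measured from one crossing \<open>p0\<close> of index \<open>j\<close>, which
  cuts the annulus open. The angle then maps the region openly and with connected fibres onto an
  open interval without the angles of the other crossings. With \<open>c\<close> crossings,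
  \<open>c - 1\<close> points are removed, which leaves \<open>c\<close> pieces.\<close>

lemma card_components_region:
  assumes j: "0 < j" "j < L * m"
  shows "finite (components (region j)) \<and> card (components (region j)) = card (crossings j)"
proof -
  obtain r0 \<phi>0 where c0: "count (\<lambda>x. x = r0) \<phi>0 = 2" "Suc (count (\<lambda>x. r0 < x) \<phi>0) = j"
    using all_levels[OF j] by blast
  define p0 where "p0 = polar r0 \<phi>0"
  have r0: "r0 > 0" by (rule count_radius_pos[of r0 \<phi>0]) (simp add: c0)
  have p0: "p0 \<in> crossings j"
    unfolding crossings_def p0_def using c0 polar_double_point level_polar[OF r0] by simp
  \<comment> \<open>Rotating by the direction of \<open>p0\<close> puts the jump of
    \<open>Arg2pi\<close> on a ray that the region does not meet.\<close>
  define f where "f = (\<lambda>z. Arg2pi (z / cis (2 * pi * \<phi>0)))"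
  have f: "f (polar r (\<phi>0 + x)) = 2 * pi * x" if "r > 0" "0 \<le> x" "x < 1" for r x
  proof -
    have "polar r (\<phi>0 + x) / cis (2 * pi * \<phi>0) = polar r x"
      by (simp add: distrib_left cis_mult[symmetric] scaleR_conv_of_real)
    then show ?thesis unfolding f_def using Arg2pi_polar[OF that] by simp
  qed
  have exh: "\<exists>r x. r > 0 \<and> 0 \<le> x \<and> x < 1 \<and> z = polar r (\<phi>0 + x)" if "z \<noteq> 0" for z
  proof -
    obtain r \<phi> where r: "r > 0" "z = polar r \<phi>" using polar_exhaust[OF \<open>z \<noteq> 0\<close>] by metis
    have "polar r (\<phi>0 + frac (\<phi> - \<phi>0) + of_int \<lfloor>\<phi> - \<phi>0\<rfloor>) = polar r (\<phi>0 + frac (\<phi> - \<phi>0))"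
      by (rule polar_add_int)
    moreover have "\<phi>0 + frac (\<phi> - \<phi>0) + of_int \<lfloor>\<phi> - \<phi>0\<rfloor> = \<phi>" by (simp add: frac_def)
    ultimately have "z = polar r (\<phi>0 + frac (\<phi> - \<phi>0))" using r(2) by metis
    then show ?thesis using r(1) frac_ge_0[of "\<phi> - \<phi>0"] frac_lt_1[of "\<phi> - \<phi>0"] by blast
  qed
  have nz: "z \<noteq> 0" if "z \<in> region j \<or> z \<in> crossings j" for z
  proof
    assume "z = 0"
    then have "z \<notin> region j" using level_zero j(2) unfolding region_def by simp
    moreover have "z \<notin> crossings j" using \<open>z = 0\<close> fiber_zero unfolding crossings_def double_points_def by simp
    ultimately show False using that by blast
  qed
  have f0: "f p0 = 0" using f[of r0 0] r0 unfolding p0_def by simp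
  have inj: "inj_on f (crossings j)"
  proof (rule inj_onI)
    fix p q assume pq: "p \<in> crossings j" "q \<in> crossings j" "f p = f q"
    obtain r x where p: "r > 0" "0 \<le> x" "x < 1" "p = polar r (\<phi>0 + x)" using exh nz pq(1) by metis
    obtain s y where q: "s > 0" "0 \<le> y" "y < 1" "q = polar s (\<phi>0 + y)" using exh nz pq(2) by metis
    have "2 * pi * x = 2 * pi * y" using pq(3) f[OF p(1-3)] f[OF q(1-3)] p(4) q(4) by metis
    then have "x = y" by simp
    then have "r = s" using crossings_unique_radius[OF p(1) q(1)] pq(1,2) p(4) q(4) by metis
    then show "p = q" using p(4) q(4) \<open>x = y\<close> by simp
  qed
  \<comment> \<open>Angles of the crossings other than \<open>p0\<close>; the angle of
    \<open>p0\<close> has become the ends of the interval.\<close>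
  let ?Z = "f ` (crossings j - {p0})"
  have finc: "finite (crossings j)" unfolding crossings_def using finite_double_points by simp
  have finZ: "finite ?Z" using finc by simp
  have "card ?Z = card (crossings j - {p0})" using inj by (intro card_image) (auto intro: inj_on_subset)
  also have "\<dots> = card (crossings j) - 1" using p0 finc by simp
  finally have cardZ: "Suc (card ?Z) = card (crossings j)"
    using p0 finc by (metis Suc_pred' card_gt_0_iff empty_iff)
  have subZ: "?Z \<subseteq> {0<..<2 * pi}"
  proof
    fix \<theta> assume "\<theta> \<in> ?Z"
    then obtain q where q: "q \<in> crossings j" "q \<noteq> p0" "\<theta> = f q" by blast
    then have "f q \<noteq> f p0" using inj p0 by (meson inj_onD)
    moreover have "0 \<le> f q" "f q < 2 * pi" unfolding f_def using Arg2pi_ge_0 Arg2pi_lt_2pi by auto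
    ultimately show "\<theta> \<in> {0<..<2 * pi}" using q(3) f0 by simp
  qed
  have fS: "f ` region j = {0<..<2 * pi} - ?Z"
  proof (intro equalityI subsetI)
    fix \<theta> assume "\<theta> \<in> f ` region j"
    then obtain z where z: "z \<in> region j" "\<theta> = f z" by blast
    obtain r x where x: "r > 0" "0 \<le> x" "x < 1" "z = polar r (\<phi>0 + x)" using exh nz z(1) by metis
    have \<theta>: "\<theta> = 2 * pi * x" using f[OF x(1-3)] z(2) x(4) by simp
    have no: "\<not> (\<exists>s>0. polar s (\<phi>0 + x) \<in> crossings j)" using gap_iff[OF j] z(1) x(1,4) by blast
    have "x \<noteq> 0"
    proof
      assume "x = 0"
      then have "polar r0 (\<phi>0 + x) \<in> crossings j" using p0 unfolding p0_def by simp
      then show False using no r0 by blast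
    qed
    moreover have "\<theta> \<notin> ?Z"
    proof
      assume "\<theta> \<in> ?Z"
      then obtain q where q: "q \<in> crossings j" "\<theta> = f q" by blast
      obtain s y where y: "s > 0" "0 \<le> y" "y < 1" "q = polar s (\<phi>0 + y)" using exh nz q(1) by metis
      have "2 * pi * y = 2 * pi * x" using f[OF y(1-3)] q(2) y(4) \<theta> by metis
      then have "y = x" by simp
      then show False using no q(1) y(1,4) by blast
    qed
    ultimately show "\<theta> \<in> {0<..<2 * pi} - ?Z" using \<theta> x(2,3) by simp
  next
    fix \<theta> assume \<theta>: "\<theta> \<in> {0<..<2 * pi} - ?Z"
    define x where "x = \<theta> / (2 * pi)"
    have x: "0 < x" "x < 1" "2 * pi * x = \<theta>" using \<theta> unfolding x_def by auto
    have "\<not> (\<exists>s>0. polar s (\<phi>0 + x) \<in> crossings j)"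
    proof
      assume "\<exists>s>0. polar s (\<phi>0 + x) \<in> crossings j"
      then obtain s where s: "s > 0" "polar s (\<phi>0 + x) \<in> crossings j" by blast
      have fs: "f (polar s (\<phi>0 + x)) = \<theta>" using f[of s x] s x by simp
      then have "polar s (\<phi>0 + x) \<noteq> p0" using f0 \<theta> by auto
      then have "\<theta> \<in> ?Z" using fs s(2) by blast
      then show False using \<theta> by blast
    qed
    then obtain r where r: "r > 0" "polar r (\<phi>0 + x) \<in> region j" using gap_iff[OF j] by blast
    then show "\<theta> \<in> f ` region j" using f[of r x] x by (metis image_eqI less_imp_le)
  qed
  have "bij_betw (\<lambda>C. region j \<inter> f -` C) (components (f ` region j)) (components (region j))"
  proof (rule components_open_monotone_image)
    show "continuous_on (region j) f"
    proof (rule continuous_at_imp_continuous_on, rule ballI)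
      fix z assume z: "z \<in> region j"
      have "f z \<noteq> 0" using z fS by force
      then have "z / cis (2 * pi * \<phi>0) \<notin> \<real>\<^sub>\<ge>\<^sub>0"
        unfolding f_def Arg2pi_eq_0 by (auto simp: complex_nonneg_Reals_iff complex_is_Real_iff)
      then show "isCont f z"
        unfolding f_def by (intro isCont_o2[of z _ Arg2pi] continuous_at_Arg2pi) auto
    qed
  next
    fix C assume "openin (top_of_set (region j)) C"
    then have C: "open C" "C \<subseteq> region j"
      using openin_open_eq[OF open_region] by blast+
    \<comment> \<open>Openness: the image of \<open>C\<close> is the union over all radii
      \<open>r\<close> of the sets of angles at which the circle of radius \<open>r\<close> runs in
      \<open>C\<close>, and these are open.\<close>
    let ?g = "\<lambda>r \<theta>. polar r (\<phi>0 + \<theta> / (2 * pi))"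
    have fC: "f ` C = {0<..<2 * pi} \<inter> (\<Union>r\<in>{0<..}. ?g r -` C)"
    proof (intro equalityI subsetI)
      fix \<theta> assume "\<theta> \<in> f ` C"
      then obtain z where z: "z \<in> C" "\<theta> = f z" by blast
      then have zr: "z \<in> region j" using C(2) by blast
      obtain r x where x: "r > 0" "0 \<le> x" "x < 1" "z = polar r (\<phi>0 + x)" using exh nz zr by metis
      have \<theta>: "\<theta> = 2 * pi * x" using f[OF x(1-3)] z(2) x(4) by simp
      then have "?g r \<theta> \<in> C" using z(1) x(4) by simp
      moreover have "\<theta> \<in> {0<..<2 * pi}" using fS zr z(2) by blast
      ultimately show "\<theta> \<in> {0<..<2 * pi} \<inter> (\<Union>r\<in>{0<..}. ?g r -` C)" using x(1) by blast
    next
      fix \<theta> assume "\<theta> \<in> {0<..<2 * pi} \<inter> (\<Union>r\<in>{0<..}. ?g r -` C)"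
      then obtain r where r: "r > 0" "?g r \<theta> \<in> C" "0 < \<theta>" "\<theta> < 2 * pi" by auto
      then have "f (?g r \<theta>) = \<theta>" using f[of r "\<theta> / (2 * pi)"] by simp
      then show "\<theta> \<in> f ` C" using r(2) by (metis imageI)
    qed
    have "open (?g r -` C)" for r
      by (rule open_vimage[OF C(1)]) (intro continuous_intros, auto)
    then have "open (f ` C)" unfolding fC by (intro open_Int open_UN ballI) auto
    then show "openin (top_of_set (f ` region j)) (f ` C)" using C(2) by (intro open_subset) auto
  next
    fix y assume y: "y \<in> f ` region j"
    then have y': "0 < y" "y < 2 * pi" using fS by auto
    let ?x = "\<phi>0 + y / (2 * pi)"
    have "region j \<inter> f -` {y} = (\<lambda>r. polar r ?x) ` {r. r > 0 \<and> polar r ?x \<in> region j}"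
    proof (intro equalityI subsetI)
      fix z assume z: "z \<in> region j \<inter> f -` {y}"
      then obtain r x where x: "r > 0" "0 \<le> x" "x < 1" "z = polar r (\<phi>0 + x)" using exh nz by (metis IntD1)
      have "y = 2 * pi * x" using f[OF x(1-3)] z x(4) by auto
      then have "z = polar r ?x" using x(4) by simp
      then show "z \<in> (\<lambda>r. polar r ?x) ` {r. r > 0 \<and> polar r ?x \<in> region j}" using z x(1) by blast
    next
      fix z assume "z \<in> (\<lambda>r. polar r ?x) ` {r. r > 0 \<and> polar r ?x \<in> region j}"
      then obtain r where r: "r > 0" "z = polar r ?x" "z \<in> region j" by blast
      then have "f z = y" using f[of r "y / (2 * pi)"] y' by simp
      then show "z \<in> region j \<inter> f -` {y}" using r(3) by blast
    qed
    then show "connected (region j \<inter> f -` {y})" using connected_region_ray[of ?x j] by simp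
  qed
  then have bij: "bij_betw (\<lambda>C. region j \<inter> f -` C) (components ({0<..<2 * pi} - ?Z)) (components (region j))"
    unfolding fS .
  have "finite (components ({0<..<2 * pi} - ?Z)) \<and> card (components ({0<..<2 * pi} - ?Z)) = Suc (card ?Z)"
    by (rule components_interval_minus_finite[OF finZ subZ]) simp
  then show ?thesis using bij_betw_finite[OF bij] bij_betw_same_card[OF bij] cardZ by simp
qed

text \<open>Moving towards 0 can only increase the number of strands outside, which is maximal
  already. So this region is star-shaped about 0.\<close>

lemma connected_inner_region: "connected (region (L * m))"
proof (rule starlike_imp_connected)
  have 0: "0 \<in> region (L * m)" unfolding region_def using zero_notin_image level_zero by simp
  have "closed_segment 0 z \<subseteq> region (L * m)" if z: "z \<in> region (L * m)" for z
  proof (cases "z = 0")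
    case False
    then obtain r \<phi> where r: "r > 0" "z = polar r \<phi>" using polar_exhaust by metis
    then have c: "count (\<lambda>x. r < x) \<phi> = L * m" using z region_iff by blast
    have "u *\<^sub>R z \<in> region (L * m)" if u: "0 \<le> u" "u \<le> 1" for u
    proof (cases "u = 0")
      case False
      then have ur: "u * r > 0" "u * r \<le> r" using u r(1) by (auto simp: mult_left_le_one_le)
      have "L * m \<le> count (\<lambda>x. u * r < x) \<phi>" using ur(2) unfolding c[symmetric] by (intro count_mono) auto
      then have "count (\<lambda>x. u * r < x) \<phi> = L * m" "count (\<lambda>x. x = u * r) \<phi> = 0"
        using count_le[of "\<lambda>x. u * r \<le> x" \<phi>] count_ge[of "u * r" \<phi>] by auto
      then have "polar (u * r) \<phi> \<in> region (L * m)" using region_iff[OF ur(1)] by blast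
      then show ?thesis using r(2) by simp
    qed (use 0 in simp)
    then show ?thesis by (auto simp: closed_segment_def)
  qed (use 0 in simp)
  then show "starlike (region (L * m))" unfolding starlike_def using 0 by blast
qed

text \<open>Moving outwards never raises the level, so each point is joined by a ray to the exterior
  of a large disc, which is connected.\<close>

lemma connected_outer_region: "connected (region 0)" "region 0 \<noteq> {}"
proof -
  have "compact (curves_image curves)"
    unfolding curves_image_def curves_def using path_curve by (intro compact_UN) (auto intro!: compact_path_image)
  then obtain b where b: "b > 0" "curves_image curves \<subseteq> ball 0 b"
    using bounded_subset_ballD[OF compact_imp_bounded, of _ 0] by blast
  have out: "polar s \<phi> \<in> region 0" if "s > 0" "count (\<lambda>x. s \<le> x) \<phi> = 0" for s \<phi>
    using region_iff[OF that(1), of \<phi> 0] that(2) count_ge[of s \<phi>] by simp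
  have far: "polar s \<phi> \<in> region 0" if s: "s \<ge> b" for s \<phi>
  proof (rule out)
    have "\<not> s \<le> radius a \<phi>" if a: "a \<in> strands" for a
    proof
      assume "s \<le> radius a \<phi>"
      then have "polar (radius a \<phi>) \<phi> \<notin> ball 0 b" using s b(1) by simp
      then show False using b(2) curves_image_iff[OF radius_pos[OF a, of \<phi>], of \<phi>] a by blast
    qed
    then have "{a \<in> strands. s \<le> radius a \<phi>} = {}" by blast
    then show "count (\<lambda>x. s \<le> x) \<phi> = 0" unfolding count_def by (simp only: card.empty)
  qed (use s b(1) in simp)
  show ne: "region 0 \<noteq> {}" using far by blast
  define ray where "ray = (\<lambda>(r, \<phi>). (\<lambda>s. polar s \<phi>) ` {r..} \<union> - ball 0 b)"
  define \<T> where "\<T> = ray ` {(r, \<phi>). r > 0 \<and> polar r \<phi> \<in> region 0}"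
  have "connected (\<Union> \<T>)"
  proof (rule connected_Union)
    fix T assume "T \<in> \<T>"
    then obtain r \<phi> where T: "T = (\<lambda>s. polar s \<phi>) ` {r..} \<union> - ball 0 b" "r > 0" unfolding \<T>_def ray_def by auto
    have "connected ((\<lambda>s. polar s \<phi>) ` {r..})"
      by (intro connected_continuous_image continuous_intros) auto
    moreover have "connected (- ball (0::complex) b)" by (rule connected_complement_bounded_convex) auto
    moreover have "polar (max r b) \<phi> \<in> (\<lambda>s. polar s \<phi>) ` {r..} \<inter> - ball 0 b" using T(2) by auto
    ultimately show "connected T" unfolding T(1) by (intro connected_Un) blast+
  next
    have "polar b 0 \<in> - ball 0 b" using b(1) by simp
    then show "\<Inter> \<T> \<noteq> {}" unfolding \<T>_def ray_def by blast
  qed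
  moreover have "\<Union> \<T> = region 0"
  proof (intro equalityI subsetI)
    fix z assume "z \<in> \<Union> \<T>"
    then consider r \<phi> s where "r > 0" "polar r \<phi> \<in> region 0" "s \<ge> r" "z = polar s \<phi>" | "z \<notin> ball 0 b"
      unfolding \<T>_def ray_def by auto
    then show "z \<in> region 0"
    proof cases
      case 1
      show ?thesis
      proof (cases "s = r")
        case False
        then have "count (\<lambda>x. s \<le> x) \<phi> \<le> count (\<lambda>x. r < x) \<phi>" using 1(3) by (intro count_mono) auto
        then show ?thesis using 1 out[of s \<phi>] region_iff[OF 1(1)] by simp
      qed (use 1 in simp)
    next
      case 2
      then have "z \<noteq> 0" using b(1) by auto
      then obtain r \<phi> where "r > 0" "z = polar r \<phi>" using polar_exhaust by metis
      then show ?thesis using 2 far[of r \<phi>] by simp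
    qed
  next
    fix z assume z: "z \<in> region 0"
    have "z \<noteq> 0" using z level_zero L_pos m_pos unfolding region_def by auto
    then obtain r \<phi> where r: "r > 0" "z = polar r \<phi>" using polar_exhaust by metis
    then have "z \<in> ray (r, \<phi>)" unfolding ray_def by auto
    then show "z \<in> \<Union> \<T>" unfolding \<T>_def using r z by blast
  qed
  ultimately show "connected (region 0)" by simp
qed

lemma Suc_level_less:
  assumes "p \<in> double_points curves" shows "Suc (level p) < L * m"
proof -
  obtain r \<phi> where p: "r > 0" "p = polar r \<phi>" "count (\<lambda>x. x = r) \<phi> = 2"
    using double_points_polar[OF assms] by metis
  then show ?thesis using count_ge[of r \<phi>] count_le[of "\<lambda>x. r \<le> x" \<phi>] level_polar[of r \<phi>] by simp
qed

text \<open>For \<open>j\<close> strictly between 0 and \<open>L * m\<close> there are as many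
  components of level \<open>j\<close> as crossings of index \<open>j\<close>, so their squares are
  charged to the crossings. Level 0 contributes nothing, and the innermost component leaves the
  square of \<open>L * m\<close>.\<close>

lemma sum_omega_squares:
  "(\<Sum>C\<in>components (- curves_image curves). (real_of_int (omega curves C))\<^sup>2)
   = (L * m)\<^sup>2 + (\<Sum>p\<in>double_points curves. (real (Suc (level p)))\<^sup>2)"
proof -
  have LM: "0 < L * m" using L_pos m_pos by simp
  have "region (L * m) \<noteq> {}" unfolding region_def using zero_notin_image level_zero by blast
  then have inner: "components (region (L * m)) = {region (L * m)}"
    using components_connected connected_inner_region by blast
  have outer: "components (region 0) = {region 0}"
    using components_connected connected_outer_region by blast
  have fin: "finite (components (region j))" if "j \<le> L * m" for j
    using that inner outer card_components_region[of j] by (cases "j = 0 \<or> j = L * m") auto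
  have om: "omega curves C = int j" if C: "C \<in> components (region j)" and j: "j \<le> L * m" for C j
  proof -
    obtain z where z: "z \<in> C" using in_components_nonempty[OF C] by blast
    have "C \<in> components (- curves_image curves)" unfolding components_complement using C j by blast
    then show ?thesis using omega_level z in_components_subset[OF C] unfolding region_def by blast
  qed
  have disj: "components (region i) \<inter> components (region j) = {}" if "i \<noteq> j" for i j
  proof (rule ccontr)
    assume "components (region i) \<inter> components (region j) \<noteq> {}"
    then obtain C where C: "C \<in> components (region i)" "C \<in> components (region j)" by blast
    obtain z where "z \<in> C" using in_components_nonempty[OF C(1)] by blast
    then have "z \<in> region i" "z \<in> region j" using in_components_subset C by blast+
    then show False using that unfolding region_def by auto
  qed
  have "(\<Sum>C\<in>components (- curves_image curves). (real_of_int (omega curves C))\<^sup>2)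
      = (\<Sum>j\<in>{..L * m}. \<Sum>C\<in>components (region j). (real_of_int (omega curves C))\<^sup>2)"
    unfolding components_complement using fin disj by (intro sum.UNION_disjoint) auto
  also have "\<dots> = (\<Sum>j\<in>{..L * m}. real (card (components (region j))) * (real j)\<^sup>2)"
    using om by (intro sum.cong) auto
  also have "{..L * m} = insert 0 (insert (L * m) {0<..<L * m})" using LM by auto
  also have "(\<Sum>j\<in>\<dots>. real (card (components (region j))) * (real j)\<^sup>2)
      = (L * m)\<^sup>2 + (\<Sum>j\<in>{0<..<L * m}. real (card (components (region j))) * (real j)\<^sup>2)"
    using LM inner by simp
  also have "(\<Sum>j\<in>{0<..<L * m}. real (card (components (region j))) * (real j)\<^sup>2)
      = (\<Sum>j\<in>{0<..<L * m}. \<Sum>p\<in>crossings j. (real (Suc (level p)))\<^sup>2)"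
    using card_components_region by (intro sum.cong) (auto simp: crossings_def)
  also have "\<dots> = (\<Sum>p\<in>(\<Union>j\<in>{0<..<L * m}. crossings j). (real (Suc (level p)))\<^sup>2)"
    by (rule sum.UNION_disjoint[symmetric]) (auto simp: crossings_def finite_double_points)
  also have "(\<Union>j\<in>{0<..<L * m}. crossings j) = double_points curves"
    using Suc_level_less unfolding crossings_def by auto
  finally show ?thesis by simp
qed

end

section \<open>Quadrants and indices of double points\<close>

lemma Complex_eq_polar:
  assumes "x > 0"
  shows "Complex x y = sqrt (x\<^sup>2 + y\<^sup>2) *\<^sub>R cis (arctan (y / x))"
proof -
  have "sqrt (x\<^sup>2 + y\<^sup>2) = x * sqrt (1 + (y / x)\<^sup>2)"
  proof -
    have "x\<^sup>2 + y\<^sup>2 = x\<^sup>2 * (1 + (y / x)\<^sup>2)" using assms by (simp add: field_simps)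
    then show ?thesis using assms by (simp add: real_sqrt_mult)
  qed
  moreover have "sqrt (1 + (y / x)\<^sup>2) > 0" by (smt (verit) real_sqrt_gt_zero zero_le_power2)
  ultimately show ?thesis using assms
    by (simp add: complex_eq_iff cos_arctan sin_arctan field_simps)
qed

lemma eventually_sgn_right:
  fixes g :: "real \<Rightarrow> real"
  assumes g: "g 0 = 0" "(g has_real_derivative l) (at 0)" and l: "l \<noteq> 0"
  shows "\<forall>\<^sub>F e in at_right 0. sgn (g e) = sgn l"
proof (cases "l > 0")
  case True
  then obtain d where "d > 0" "\<forall>h>0. h < d \<longrightarrow> g 0 < g (0 + h)"
    using has_real_derivative_pos_inc_right[OF g(2)] by auto
  then show ?thesis using True g(1) unfolding eventually_at_right_field by (intro exI[of _ d]) auto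
next
  case False
  then have "l < 0" using l by simp
  then obtain d where "d > 0" "\<forall>h>0. h < d \<longrightarrow> g 0 > g (0 + h)"
    using has_real_derivative_neg_dec_right[OF g(2)] by auto
  then show ?thesis using \<open>l < 0\<close> g(1) unfolding eventually_at_right_field by (intro exI[of _ d]) auto
qed

lemma eventually_sgn_isCont:
  fixes g :: "real \<Rightarrow> real"
  assumes "isCont g 0" "g 0 \<noteq> 0"
  shows "\<forall>\<^sub>F e in at_right 0. sgn (g e) = sgn (g 0)"
proof -
  have lim: "(g \<longlongrightarrow> g 0) (at_right 0)"
    using assms(1) unfolding isCont_def by (rule filterlim_mono) (auto simp: at_within_le_at)
  show ?thesis
  proof (cases "g 0 > 0")
    case True
    then show ?thesis using order_tendstoD(1)[OF lim, of 0] by (auto elim: eventually_mono)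
  next
    case False
    then have "g 0 < 0" using assms(2) by simp
    then show ?thesis using order_tendstoD(2)[OF lim, of 0] by (auto elim: eventually_mono)
  qed
qed

lemma sum_PiE_pair:
  assumes "a \<noteq> b"
  shows "(\<Sum>\<sigma>\<in>{a, b} \<rightarrow>\<^sub>E {-1, 1 :: real}. G (\<sigma> a) (\<sigma> b) :: real) = G (-1) (-1) + G (-1) 1 + G 1 (-1) + G 1 1"
proof -
  have "(\<Sum>\<sigma>\<in>{a, b} \<rightarrow>\<^sub>E {-1, 1 :: real}. G (\<sigma> a) (\<sigma> b)) = (\<Sum>(x, y)\<in>{-1, 1} \<times> {-1, 1 :: real}. G x y)"
  proof (rule sum.reindex_bij_witness[of _ "\<lambda>(x, y). (\<lambda>_. undefined)(a := x, b := y)" "\<lambda>\<sigma>. (\<sigma> a, \<sigma> b)"])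
    fix \<sigma> assume \<sigma>: "\<sigma> \<in> {a, b} \<rightarrow>\<^sub>E {-1, 1 :: real}"
    show "(case (\<sigma> a, \<sigma> b) of (x, y) \<Rightarrow> (\<lambda>_. undefined)(a := x, b := y)) = \<sigma>"
      using PiE_arb[OF \<sigma>] by (auto simp: fun_eq_iff)
  qed (use assms in \<open>auto simp: PiE_iff extensional_def\<close>)
  also have "\<dots> = G (-1) (-1) + G (-1) 1 + G 1 (-1) + G 1 1"
    by (simp add: sum.cartesian_product[symmetric])
  finally show ?thesis .
qed

context braid_curves
begin

lemma curve_vector_derivative:
  fixes t :: real
  assumes "i < L"
  shows "(curve i has_vector_derivative Complex (R' i t) (2 * pi * m * R i t) * cis (2 * pi * (real m * t))) (at t)"
proof -
  have c: "((\<lambda>t. cis (2 * pi * (real m * t))) has_vector_derivative (2 * pi * m) *\<^sub>R (\<i> * cis (2 * pi * (real m * t)))) (at t)"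
    unfolding has_vector_derivative_def
    by (auto intro!: derivative_eq_intros simp: scaleR_conv_of_real algebra_simps)
  have "((\<lambda>t. R i t *\<^sub>R cis (2 * pi * (real m * t))) has_vector_derivative
      R i t *\<^sub>R ((2 * pi * m) *\<^sub>R (\<i> * cis (2 * pi * (real m * t)))) + R' i t *\<^sub>R cis (2 * pi * (real m * t))) (at t)"
    by (rule has_vector_derivative_scaleR[OF R_deriv[OF assms] c])
  moreover have "R i t *\<^sub>R ((2 * pi * m) *\<^sub>R (\<i> * cis (2 * pi * (real m * t)))) + R' i t *\<^sub>R cis (2 * pi * (real m * t))
      = Complex (R' i t) (2 * pi * m * R i t) * cis (2 * pi * (real m * t))"
    by (simp add: complex_eq_iff algebra_simps)
  ultimately show ?thesis unfolding curve_def by simp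
qed

text \<open>In the frame turned by the angle, the two components are the radial and the tangential
  speed. The tangential one depends on the radius alone, so both strands at a crossing share
  it.\<close>

lemma tangent_curves:
  assumes "a \<in> strands"
  shows "tangent curves (fst a, (\<phi> + real (snd a)) / m)
       = Complex (radius' a \<phi>) (2 * pi * m * radius a \<phi>) * cis (2 * pi * \<phi>)"
proof -
  have a: "fst a < L" using assms unfolding strands_def by auto
  have "real m * ((\<phi> + real (snd a)) / m) = \<phi> + of_int (int (snd a))" using m_pos by simp
  then have "polar 1 (real m * ((\<phi> + real (snd a)) / m)) = polar 1 \<phi>" using polar_add_int by metis
  then show ?thesis
    using vector_derivative_at[OF curve_vector_derivative[OF a, of "(\<phi> + real (snd a)) / m"]] a
    unfolding tangent_def curves_def radius_def radius'_def by simp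
qed

text \<open>A short open segment from \<open>p\<close> into the quadrant is connected and off the
  curves, so it singles out one component. The level along it is all that has to be known.\<close>

lemma omega_quadrant:
  assumes ev: "\<forall>\<^sub>F e in at_right 0. p + e *\<^sub>R (\<Sum>a\<in>fiber curves p. \<sigma> a *\<^sub>R tangent curves a) \<in> - curves_image curves
      \<and> level (p + e *\<^sub>R (\<Sum>a\<in>fiber curves p. \<sigma> a *\<^sub>R tangent curves a)) = j"
  shows "omega curves (quadrant curves p \<sigma>) = int j"
proof -
  define q where "q = (\<lambda>e::real. p + e *\<^sub>R (\<Sum>a\<in>fiber curves p. \<sigma> a *\<^sub>R tangent curves a))"
  obtain d where d: "d > 0" "\<And>e. 0 < e \<Longrightarrow> e < d \<Longrightarrow> q e \<in> - curves_image curves \<and> level (q e) = j"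
    using ev unfolding eventually_at_right_field q_def by (metis (no_types, lifting))
  have "connected (q ` {0<..<d})"
    unfolding q_def by (intro connected_continuous_image continuous_intros) auto
  moreover have "q ` {0<..<d} \<subseteq> - curves_image curves" using d(2) by auto
  moreover have "- curves_image curves \<noteq> {}" using zero_notin_image by auto
  ultimately obtain C where C: "C \<in> components (- curves_image curves)" "q ` {0<..<d} \<subseteq> C"
    using exists_component_superset by metis
  have evC: "\<forall>\<^sub>F e in at_right 0. q e \<in> C"
    unfolding eventually_at_right_field using C(2) d(1) by (intro exI[of _ d]) auto
  have uniq: "D = C" if D: "D \<in> components (- curves_image curves)" "\<forall>\<^sub>F e in at_right 0. q e \<in> D" for D
  proof -
    have "\<forall>\<^sub>F e in at_right 0. q e \<in> D \<inter> C" using D(2) evC by eventually_elim blast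
    then have "D \<inter> C \<noteq> {}" using eventually_happens'[OF trivial_limit_at_right_real] by force
    then show ?thesis using components_nonoverlap[OF D(1) C(1)] by blast
  qed
  have "quadrant curves p \<sigma> = C"
    using C(1) evC uniq unfolding quadrant_def q_def by (intro the_equality) blast+
  moreover have "q (d / 2) \<in> C" "level (q (d / 2)) = j" using C(2) d by auto
  ultimately show ?thesis using omega_level[OF C(1)] by auto
qed

end

context generic_braid
begin

lemma crossing_strands:
  assumes "count (\<lambda>x. x = r) \<phi> = 2"
  obtains a b where "a \<in> strands" "b \<in> strands" "a \<noteq> b" "{c \<in> strands. radius c \<phi> = r} = {a, b}"
  using assms unfolding count_def card_2_iff by (metis (no_types, lifting) insertI1 insert_commute mem_Collect_eq)

text \<open>All strands have the same angular speed. So when the point moves in direction \<open>x v + y w\<close>, its radial offset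
  from the first strand grows at rate \<open>y \<delta>\<close> and that from the second strand at rate \<open>- x \<delta>\<close>.\<close>

lemma eventually_level_quadrant:
  assumes r: "r > 0" and ab: "a \<in> strands" "b \<in> strands" "a \<noteq> b" "{c \<in> strands. radius c \<phi> = r} = {a, b}"
    and xy: "x \<noteq> 0" "y \<noteq> 0"
  defines "\<delta> \<equiv> radius' b \<phi> - radius' a \<phi>"
  defines "q \<equiv> \<lambda>e. polar r \<phi> + e *\<^sub>R
      (x *\<^sub>R (Complex (radius' a \<phi>) (2 * pi * m * r) * cis (2 * pi * \<phi>)) +
       y *\<^sub>R (Complex (radius' b \<phi>) (2 * pi * m * r) * cis (2 * pi * \<phi>)))"
  shows "\<forall>\<^sub>F e in at_right 0. q e \<in> - curves_image curves \<and>
      level (q e) = count (\<lambda>x. r < x) \<phi> + of_bool (y * \<delta> < 0) + of_bool (x * \<delta> > 0)"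
proof -
  \<comment> \<open>Radial and tangential velocity of the point in the frame turned by
    \<open>\<phi>\<close>; \<open>\<rho>\<close> and \<open>\<psi>\<close> are its polar
    coordinates.\<close>
  define u where "u = x * radius' a \<phi> + y * radius' b \<phi>"
  define v where "v = 2 * pi * m * r * (x + y)"
  define \<rho> where "\<rho> = (\<lambda>e. sqrt ((r + e * u)\<^sup>2 + (e * v)\<^sup>2))"
  define \<psi> where "\<psi> = (\<lambda>e. \<phi> + arctan (e * v / (r + e * u)) / (2 * pi))"
  have rad: "radius a \<phi> = r" "radius b \<phi> = r" using ab(4) by blast+
  have \<delta>: "\<delta> \<noteq> 0" using transversal[OF ab(1-3), of \<phi>] rad unfolding \<delta>_def by simp
  have q: "q e = polar (\<rho> e) (\<psi> e)" if "r + e * u > 0" for e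
  proof -
    have "q e = Complex (r + e * u) (e * v) * cis (2 * pi * \<phi>)"
      unfolding q_def u_def v_def by (simp add: complex_eq_iff algebra_simps)
    also have "\<dots> = \<rho> e *\<^sub>R (cis (arctan (e * v / (r + e * u))) * cis (2 * pi * \<phi>))"
      unfolding Complex_eq_polar[OF that] \<rho>_def by simp
    also have "cis (arctan (e * v / (r + e * u))) * cis (2 * pi * \<phi>) = cis (2 * pi * \<psi> e)"
      unfolding cis_mult \<psi>_def by (simp add: distrib_left add.commute)
    finally show ?thesis .
  qed
  have der\<rho>: "(\<rho> has_real_derivative u) (at 0)"
    unfolding \<rho>_def using r
    by (auto intro!: derivative_eq_intros simp: power2_eq_square field_simps)
  have der\<psi>: "(\<psi> has_real_derivative m * (x + y)) (at 0)"
    unfolding \<psi>_def using r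
    by (auto intro!: derivative_eq_intros simp: v_def power2_eq_square field_simps)
  have zero: "\<rho> 0 = r" "\<psi> 0 = \<phi>" unfolding \<rho>_def \<psi>_def using r by auto
  \<comment> \<open>Sign of the radial offset of the point from each strand just after the start:
    for the two strands through the crossing it comes from the derivative, for the others from the
    nonzero initial offset.\<close>
  define s where "s = (\<lambda>c. if c = a then sgn (y * \<delta>) else if c = b then sgn (- x * \<delta>) else sgn (r - radius c \<phi>))"
  have D: "((\<lambda>e. \<rho> e - radius c (\<psi> e)) has_real_derivative u - radius' c \<phi> * (x + y)) (at 0)" if c: "c \<in> strands" for c
  proof -
    have "((\<lambda>e. \<rho> e - radius c (\<psi> e)) has_real_derivative u - radius' c \<phi> / m * (m * (x + y))) (at 0)"
      by (intro DERIV_diff der\<rho> DERIV_chain2[OF _ der\<psi>]) (use radius_deriv[OF c] zero in simp)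
    then show ?thesis using m_pos by simp
  qed
  have "\<forall>\<^sub>F e in at_right 0. sgn (\<rho> e - radius c (\<psi> e)) = s c" if c: "c \<in> strands" for c
  proof -
    consider "c = a" | "c = b" "c \<noteq> a" | "c \<noteq> a" "c \<noteq> b" by blast
    then show ?thesis
    proof cases
      case 1
      have "u - radius' c \<phi> * (x + y) = y * \<delta>" unfolding u_def \<delta>_def 1 by (simp add: algebra_simps)
      then show ?thesis
        using eventually_sgn_right[OF _ D[OF c]] zero rad xy \<delta> 1 unfolding s_def by simp
    next
      case 2
      have "u - radius' c \<phi> * (x + y) = - x * \<delta>" unfolding u_def \<delta>_def 2 by (simp add: algebra_simps)
      then show ?thesis
        using eventually_sgn_right[OF _ D[OF c]] zero rad xy \<delta> 2 unfolding s_def by simp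
    next
      case 3
      then have "radius c \<phi> \<noteq> r" using ab(4) c by blast
      then show ?thesis
        using eventually_sgn_isCont[OF DERIV_isCont[OF D[OF c]]] zero 3 unfolding s_def by simp
    qed
  qed
  then have "\<forall>\<^sub>F e in at_right 0. \<forall>c\<in>strands. sgn (\<rho> e - radius c (\<psi> e)) = s c"
    by (intro eventually_ball_finite) auto
  moreover have "\<forall>\<^sub>F e in at_right 0. r + e * u > 0"
  proof -
    have "((\<lambda>e. r + e * u) \<longlongrightarrow> r + 0 * u) (at_right 0)" by (intro tendsto_intros)
    then show ?thesis using order_tendstoD(1)[of _ _ _ 0] r by auto
  qed
  ultimately show ?thesis
  proof eventually_elim
    case (elim e)
    have \<rho>: "\<rho> e > 0" unfolding \<rho>_def using elim(2) by (simp add: add_pos_nonneg)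
    have s0: "s c \<noteq> 0" if "c \<in> strands" for c
      using xy \<delta> ab(4) that unfolding s_def by (auto simp: sgn_0_0)
    have "{c \<in> strands. radius c (\<psi> e) = \<rho> e} = {}"
    proof -
      have "radius c (\<psi> e) \<noteq> \<rho> e" if "c \<in> strands" for c
        using elim(1) s0[OF that] that by force
      then show ?thesis by blast
    qed
    then have "count (\<lambda>x. x = \<rho> e) (\<psi> e) = 0" unfolding count_def by (simp only: card.empty)
    then have off: "q e \<in> - curves_image curves" using complement_iff[OF \<rho>] q[OF elim(2)] by metis
    let ?N = "{c \<in> strands. r < radius c \<phi>}"
    have lt: "\<rho> e < radius c (\<psi> e) \<longleftrightarrow> s c < 0" if "c \<in> strands" for c
      using elim(1) that by (metis sgn_less diff_less_0_iff_less)
    have "{c \<in> strands. \<rho> e < radius c (\<psi> e)} = {c \<in> strands. s c < 0}" using lt by blast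
    also have "\<dots> = ?N \<union> (if y * \<delta> < 0 then {a} else {}) \<union> (if x * \<delta> > 0 then {b} else {})"
    proof (intro set_eqI)
      fix c
      have "c \<in> strands \<and> s c < 0 \<longleftrightarrow> c \<in> ?N" if "c \<noteq> a" "c \<noteq> b" using that unfolding s_def by auto
      moreover have "a \<notin> ?N" "b \<notin> ?N" using rad by auto
      moreover have "s a < 0 \<longleftrightarrow> y * \<delta> < 0" "s b < 0 \<longleftrightarrow> x * \<delta> > 0" using ab(3) unfolding s_def by auto
      ultimately show "c \<in> {c \<in> strands. s c < 0} \<longleftrightarrow>
          c \<in> ?N \<union> (if y * \<delta> < 0 then {a} else {}) \<union> (if x * \<delta> > 0 then {b} else {})"
        using ab(1-3) by (cases "c = a"; cases "c = b") auto
    qed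
    also have "card \<dots> = card ?N + of_bool (y * \<delta> < 0) + of_bool (x * \<delta> > 0)"
      using rad ab(3) by (auto simp: card_insert_if)
    finally have "count (\<lambda>x. \<rho> e < x) (\<psi> e) = count (\<lambda>x. r < x) \<phi> + of_bool (y * \<delta> < 0) + of_bool (x * \<delta> > 0)"
      unfolding count_def .
    then show ?case using off level_polar[OF \<rho>] q[OF elim(2)] by simp
  qed
qed

text \<open>In the four quadrants the two strands add 0, 1, 1 and 2 to the level, on average 1. The
  sign of \<open>\<delta>\<close> only decides which quadrant is which.\<close>

lemma ind_level:
  assumes "p \<in> double_points curves"
  shows "ind curves p = real (Suc (level p))"
proof -
  obtain r \<phi> where p: "r > 0" "0 \<le> \<phi>" "\<phi> < 1" "p = polar r \<phi>" "count (\<lambda>x. x = r) \<phi> = 2"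
    using double_points_polar[OF assms] .
  obtain a b where ab: "a \<in> strands" "b \<in> strands" "a \<noteq> b" "{c \<in> strands. radius c \<phi> = r} = {a, b}"
    using crossing_strands[OF p(5)] .
  have rad: "radius a \<phi> = r" "radius b \<phi> = r" using ab(4) by blast+
  define h where "h = (\<lambda>a::nat \<times> nat. (fst a, (\<phi> + real (snd a)) / m))"
  have h: "bij_betw h {a, b} (fiber curves p)"
    using bij_betw_fiber[OF p(1-3)] ab(4) p(4) unfolding h_def by simp
  then have fib: "fiber curves p = {h a, h b}" "h a \<noteq> h b"
    using ab(3) unfolding bij_betw_def by (auto simp: inj_on_def)
  define \<delta> where "\<delta> = radius' b \<phi> - radius' a \<phi>"
  have \<delta>: "\<delta> \<noteq> 0" using transversal[OF ab(1-3), of \<phi>] rad unfolding \<delta>_def by simp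
  define G where "G = (\<lambda>x y. real (level p + of_bool (y * \<delta> < 0) + of_bool (x * \<delta> > 0)))"
  have tan: "tangent curves (h a) = Complex (radius' a \<phi>) (2 * pi * m * r) * cis (2 * pi * \<phi>)"
      "tangent curves (h b) = Complex (radius' b \<phi>) (2 * pi * m * r) * cis (2 * pi * \<phi>)"
    unfolding h_def using tangent_curves[OF ab(1)] tangent_curves[OF ab(2)] rad by simp_all
  have om: "real_of_int (omega curves (quadrant curves p \<sigma>)) = G (\<sigma> (h a)) (\<sigma> (h b))"
    if \<sigma>: "\<sigma> \<in> fiber curves p \<rightarrow>\<^sub>E {-1, 1}" for \<sigma>
  proof -
    have xy: "\<sigma> (h a) \<noteq> 0" "\<sigma> (h b) \<noteq> 0" using PiE_mem[OF \<sigma>] fib(1) by fastforce+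
    have "(\<Sum>a\<in>fiber curves p. \<sigma> a *\<^sub>R tangent curves a)
        = \<sigma> (h a) *\<^sub>R (Complex (radius' a \<phi>) (2 * pi * m * r) * cis (2 * pi * \<phi>)) +
          \<sigma> (h b) *\<^sub>R (Complex (radius' b \<phi>) (2 * pi * m * r) * cis (2 * pi * \<phi>))"
      unfolding fib(1) using fib(2) tan by simp
    then have "omega curves (quadrant curves p \<sigma>)
        = int (level p + of_bool (\<sigma> (h b) * \<delta> < 0) + of_bool (\<sigma> (h a) * \<delta> > 0))"
      using eventually_level_quadrant[OF p(1) ab xy] level_polar[OF p(1), of \<phi>] p(4)
      unfolding \<delta>_def by (intro omega_quadrant) simp
    then show ?thesis unfolding G_def by simp
  qed
  have "(\<Sum>\<sigma>\<in>fiber curves p \<rightarrow>\<^sub>E {-1, 1}. real_of_int (omega curves (quadrant curves p \<sigma>)))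
      = (\<Sum>\<sigma>\<in>{h a, h b} \<rightarrow>\<^sub>E {-1, 1}. G (\<sigma> (h a)) (\<sigma> (h b)))"
    using om fib(1) by (intro sum.cong) simp_all
  also have "\<dots> = G (-1) (-1) + G (-1) 1 + G 1 (-1) + G 1 1" by (rule sum_PiE_pair[OF fib(2)])
  also have "\<dots> = 4 * real (Suc (level p))" unfolding G_def using \<delta> by auto
  finally show ?thesis unfolding ind_def by simp
qed

lemma sum_ind_omega:
  "(\<Sum>p\<in>double_points curves. (ind curves p)\<^sup>2)
   - (\<Sum>C\<in>components (- curves_image curves). (real_of_int (omega curves C))\<^sup>2) = - (real (L * m))\<^sup>2"
  using ind_level sum_omega_squares by simp

lemma generic_curves:
  assumes smooth: "\<And>i. i < L \<Longrightarrow> smooth (curve i)"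
  shows "generic curves"
  unfolding generic_def
proof (intro conjI ballI allI)
  fix S assume "S \<in> set curves"
  then obtain i where i: "i < L" "S = curve i" unfolding curves_def by auto
  have "vector_derivative (curve i) (at t) \<noteq> 0" for t :: real
  proof -
    have "Complex (R' i t) (2 * pi * m * R i t) \<noteq> 0"
      using R_pos[OF i(1), of t] m_pos by (simp add: complex_eq_iff)
    then show ?thesis
      using vector_derivative_at[OF curve_vector_derivative[OF i(1), of t]] by simp
  qed
  then show "immersion S"
    unfolding immersion_def i(2) using smooth[OF i(1)] curve_periodic_int[OF i(1), of _ 1] by simp
next
  fix p
  have "card (fiber curves p) \<le> 2 \<and> finite (fiber curves p) \<and>
      (\<forall>\<alpha>\<in>fiber curves p. \<forall>\<beta>\<in>fiber curves p. \<alpha> \<noteq> \<beta> \<longrightarrow> span {tangent curves \<alpha>, tangent curves \<beta>} = UNIV)"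
  proof (cases "p = 0")
    case False
    then obtain r \<phi> where p: "r > 0" "0 \<le> \<phi>" "\<phi> < 1" "p = polar r \<phi>" using polar_exhaust by metis
    note bij = bij_betw_fiber[OF p(1-3), folded p(4)]
    have "span {tangent curves \<alpha>, tangent curves \<beta>} = UNIV"
      if \<alpha>\<beta>: "\<alpha> \<in> fiber curves p" "\<beta> \<in> fiber curves p" "\<alpha> \<noteq> \<beta>" for \<alpha> \<beta>
    proof -
      have im: "fiber curves p = (\<lambda>a. (fst a, (\<phi> + real (snd a)) / m)) ` {a \<in> strands. radius a \<phi> = r}"
        using bij unfolding bij_betw_def by simp
      obtain a where a: "a \<in> strands" "radius a \<phi> = r" "\<alpha> = (fst a, (\<phi> + real (snd a)) / m)"
        using \<alpha>\<beta>(1) unfolding im by blast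
      obtain b where b: "b \<in> strands" "radius b \<phi> = r" "\<beta> = (fst b, (\<phi> + real (snd b)) / m)"
        using \<alpha>\<beta>(2) unfolding im by blast
      have "a \<noteq> b" using \<alpha>\<beta>(3) a(3) b(3) by blast
      then have ne: "radius' a \<phi> - radius' b \<phi> \<noteq> 0" using transversal[OF a(1) b(1)] a(2) b(2) by simp
      \<comment> \<open>The radial unit vector. The difference of the tangents is a nonzero multiple
        of it, and removing the radial part of one tangent leaves a nonzero multiple of
        \<open>\<i> * c\<close>.\<close>
      define c where "c = cis (2 * pi * \<phi>)"
      have ta: "tangent curves \<alpha> = Complex (radius' a \<phi>) (2 * pi * m * r) * c"
        using tangent_curves[OF a(1)] a(2,3) unfolding c_def by simp
      have tb: "tangent curves \<beta> = Complex (radius' b \<phi>) (2 * pi * m * r) * c"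
        using tangent_curves[OF b(1)] b(2,3) unfolding c_def by simp
      let ?V = "span {tangent curves \<alpha>, tangent curves \<beta>}"
      have V: "tangent curves \<alpha> \<in> ?V" "tangent curves \<beta> \<in> ?V" by (auto intro: span_base)
      have "(1 / (radius' a \<phi> - radius' b \<phi>)) *\<^sub>R (tangent curves \<alpha> - tangent curves \<beta>) \<in> ?V"
        using V by (intro span_scale span_diff)
      moreover have "tangent curves \<alpha> - tangent curves \<beta> = (radius' a \<phi> - radius' b \<phi>) *\<^sub>R c"
        unfolding ta tb by (simp add: complex_eq_iff algebra_simps)
      ultimately have cV: "c \<in> ?V" using ne by simp
      have \<kappa>: "2 * pi * m * r \<noteq> 0" using m_pos p(1) by simp
      have "(1 / (2 * pi * m * r)) *\<^sub>R (tangent curves \<alpha> - radius' a \<phi> *\<^sub>R c) \<in> ?V"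
        using V cV by (intro span_scale span_diff)
      moreover have "tangent curves \<alpha> - radius' a \<phi> *\<^sub>R c = (2 * pi * m * r) *\<^sub>R (\<i> * c)"
        unfolding ta by (simp add: complex_eq_iff algebra_simps)
      ultimately have icV: "\<i> * c \<in> ?V" using \<kappa> by simp
      have "z \<in> ?V" for z
      proof -
        have "Re (z / c) *\<^sub>R c + Im (z / c) *\<^sub>R (\<i> * c) \<in> ?V"
          using cV icV by (intro span_add span_scale)
        moreover have "Re w *\<^sub>R c + Im w *\<^sub>R (\<i> * c) = w * c" for w
          by (simp add: complex_eq_iff algebra_simps)
        moreover have "c \<noteq> 0" unfolding c_def by simp
        ultimately show ?thesis by (metis nonzero_eq_divide_eq)
      qed
      then show ?thesis by blast
    qed
    moreover have "finite (fiber curves p)" using bij_betw_finite[OF bij] by simp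
    moreover have "card (fiber curves p) \<le> 2" using card_fiber_polar[OF p(1)] no_triple p(4) by simp
    ultimately show ?thesis by blast
  qed (simp add: fiber_zero)
  then show "finite (fiber curves p)" "card (fiber curves p) \<le> 2"
    "\<And>\<alpha> \<beta>. \<alpha> \<in> fiber curves p \<Longrightarrow> \<beta> \<in> fiber curves p \<Longrightarrow> \<alpha> \<noteq> \<beta> \<longrightarrow> span {tangent curves \<alpha>, tangent curves \<beta>} = UNIV"
    by blast+
qed

end

section \<open>Smooth functions\<close>

text \<open>The last rule makes membership a local property, which covers piecewise defined functions.\<close>

inductive_set smooth_class :: "(real \<Rightarrow> complex) set" where
  const: "(\<lambda>_. c) \<in> smooth_class"
| ident: "complex_of_real \<in> smooth_class"
| flat: "(\<lambda>x. complex_of_real (if x > 0 then (1 / x) ^ k * exp (- 1 / x) else 0)) \<in> smooth_class"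
| add: "\<lbrakk>f \<in> smooth_class; g \<in> smooth_class\<rbrakk> \<Longrightarrow> (\<lambda>x. f x + g x) \<in> smooth_class"
| mult: "\<lbrakk>f \<in> smooth_class; g \<in> smooth_class\<rbrakk> \<Longrightarrow> (\<lambda>x. f x * g x) \<in> smooth_class"
| inverse: "\<lbrakk>f \<in> smooth_class; \<And>x. f x \<noteq> 0\<rbrakk> \<Longrightarrow> (\<lambda>x. inverse (f x)) \<in> smooth_class"
| exp: "f \<in> smooth_class \<Longrightarrow> (\<lambda>x. exp (f x)) \<in> smooth_class"
| affine: "f \<in> smooth_class \<Longrightarrow> (\<lambda>x. f (a * x + b)) \<in> smooth_class"
| local: "(\<And>x. \<exists>g. g \<in> smooth_class \<and> (\<forall>\<^sub>F y in nhds x. f y = g y)) \<Longrightarrow> f \<in> smooth_class"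

text \<open>All powers are included because the derivative is a combination of the members
  \<open>k + 1\<close> and \<open>k + 2\<close>. The member \<open>k = 0\<close> is the usual flat
  function.\<close>

definition flat :: "nat \<Rightarrow> real \<Rightarrow> real" where
  "flat k x = (if x > 0 then (1 / x) ^ k * exp (- 1 / x) else 0)"

lemma flat_tendsto_0: "(flat k \<longlongrightarrow> 0) (at 0)"
proof (rule filterlim_split_at)
  have "\<forall>\<^sub>F x::real in at_left 0. x < 0" by (simp add: eventually_at_filter)
  then have "\<forall>\<^sub>F x in at_left 0. flat k x = 0" by eventually_elim (simp add: flat_def)
  then show "(flat k \<longlongrightarrow> 0) (at_left 0)" by (rule tendsto_eventually)
  have "((\<lambda>x. inverse x ^ k / exp (inverse x)) \<longlongrightarrow> (0::real)) (at_right 0)"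
    by (rule filterlim_compose[OF tendsto_power_div_exp_0 filterlim_inverse_at_top_right])
  moreover have "\<forall>\<^sub>F x::real in at_right 0. x > 0" by (simp add: eventually_at_filter)
  then have "\<forall>\<^sub>F x::real in at_right 0. inverse x ^ k / exp (inverse x) = flat k x"
    by eventually_elim (simp add: flat_def divide_inverse exp_minus)
  ultimately show "(flat k \<longlongrightarrow> 0) (at_right 0)" using Lim_transform_eventually by blast
qed

lemma flat_deriv: "(flat k has_real_derivative flat (k + 2) x - k * flat (k + 1) x) (at x)"
proof -
  consider "x < 0" | "x = 0" | "x > 0" by linarith
  then show ?thesis
  proof cases
    case 1
    have "(flat k has_real_derivative 0) (at x)"
      by (rule has_field_derivative_transform_within_open[where f = "\<lambda>_. 0" and S = "{..<0}"])
        (use 1 in \<open>auto simp: flat_def\<close>)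
    then show ?thesis using 1 by (simp add: flat_def)
  next
    case 2
    \<comment> \<open>At 0 the difference quotient is the next member of the family, so the
      derivative there is again a limit of this kind.\<close>
    have eq: "(\<lambda>y. (flat k y - flat k 0) / (y - 0)) = flat (k + 1)"
      by (auto simp: flat_def)
    have "(flat k has_real_derivative 0) (at 0)"
      unfolding has_field_derivative_iff eq by (rule flat_tendsto_0)
    then show ?thesis using 2 by (simp add: flat_def)
  next
    case 3
    have "((\<lambda>x. (1 / x) ^ k * exp (- 1 / x)) has_real_derivative flat (k + 2) x - k * flat (k + 1) x) (at x)"
    proof -
      have p: "((\<lambda>x. 1 / x) has_real_derivative - (1 / x)\<^sup>2) (at x)"
        using 3 by (auto intro!: derivative_eq_intros simp: power2_eq_square)
      have e: "((\<lambda>x. exp (- 1 / x)) has_real_derivative exp (- 1 / x) * (1 / x)\<^sup>2) (at x)"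
        using 3 by (auto intro!: derivative_eq_intros simp: power2_eq_square)
      have "real k * (- (1 / x)\<^sup>2 * (1 / x) ^ (k - Suc 0)) * exp (- 1 / x) + exp (- 1 / x) * (1 / x)\<^sup>2 * (1 / x) ^ k
          = flat (k + 2) x - k * flat (k + 1) x"
        using 3 by (cases k) (simp_all add: flat_def power2_eq_square algebra_simps)
      then show ?thesis using DERIV_mult[OF DERIV_power[OF p, of k] e] by simp
    qed
    then show ?thesis
      by (rule has_field_derivative_transform_within_open[where S = "{0<..}"]) (use 3 in \<open>auto simp: flat_def\<close>)
  qed
qed

lemma flat_in_smooth_class: "(\<lambda>x. complex_of_real (flat k x)) \<in> smooth_class"
  unfolding flat_def by (rule smooth_class.flat)

text \<open>The class is closed under differentiation, so one derivative yields derivatives of all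
  orders.\<close>

lemma smooth_class_derivative:
  assumes "f \<in> smooth_class"
  shows "\<exists>f'\<in>smooth_class. \<forall>x. (f has_vector_derivative f' x) (at x)"
  using assms
proof induction
  case (const c)
  show ?case by (rule bexI[OF _ smooth_class.const[of 0]]) simp
next
  case ident
  show ?case
    by (rule bexI[OF _ smooth_class.const[of 1]])
      (auto simp: has_vector_derivative_def scaleR_conv_of_real intro!: derivative_eq_intros)
next
  case (flat k)
  let ?f' = "\<lambda>x. complex_of_real (flat (k + 2) x) + (- of_nat k) * complex_of_real (flat (k + 1) x)"
  have "?f' \<in> smooth_class"
    by (intro smooth_class.add smooth_class.mult smooth_class.const flat_in_smooth_class)
  moreover have "((\<lambda>x. complex_of_real (flat k x)) has_vector_derivative ?f' x) (at x)" for x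
    using has_vector_derivative_of_real[OF flat_deriv[of k x]] by simp
  ultimately have "\<exists>f'\<in>smooth_class. \<forall>x. ((\<lambda>x. complex_of_real (flat k x)) has_vector_derivative f' x) (at x)"
    by (intro bexI[of _ ?f'] allI)
  then show ?case unfolding flat_def .
next
  case (add f g)
  then obtain f' g' where "f' \<in> smooth_class" "g' \<in> smooth_class"
      "\<forall>x. (f has_vector_derivative f' x) (at x)" "\<forall>x. (g has_vector_derivative g' x) (at x)" by blast
  then show ?case
    by (intro bexI[of _ "\<lambda>x. f' x + g' x"] allI has_vector_derivative_add smooth_class.add) auto
next
  case (mult f g)
  then obtain f' g' where *: "f' \<in> smooth_class" "g' \<in> smooth_class"
      "\<forall>x. (f has_vector_derivative f' x) (at x)" "\<forall>x. (g has_vector_derivative g' x) (at x)" by blast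
  then show ?case using mult.hyps
    by (intro bexI[of _ "\<lambda>x. f x * g' x + f' x * g x"] allI has_vector_derivative_mult
        smooth_class.add smooth_class.mult) auto
next
  case (inverse f)
  then obtain f' where *: "f' \<in> smooth_class" "\<forall>x. (f has_vector_derivative f' x) (at x)" by blast
  let ?i = "\<lambda>x. inverse (f x)"
  have "((\<lambda>x. inverse (f x)) has_vector_derivative (- 1) * (f' x * (?i x * ?i x))) (at x)" for x
  proof -
    have "(inverse has_field_derivative - (?i x * ?i x)) (at (f x))"
      using DERIV_inverse[OF inverse.hyps(2)[of x]] by (simp add: power2_eq_square)
    then have "((inverse \<circ> f) has_vector_derivative f' x * - (?i x * ?i x)) (at x)"
      using * by (intro field_vector_diff_chain_at) auto
    then show ?thesis by (simp add: o_def)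
  qed
  moreover have "(\<lambda>x. (- 1) * (f' x * (?i x * ?i x))) \<in> smooth_class"
    by (intro smooth_class.mult smooth_class.const * smooth_class.inverse inverse.hyps)
  ultimately show ?case by (intro bexI[of _ "\<lambda>x. (- 1) * (f' x * (?i x * ?i x))"] allI)
next
  case (exp f)
  then obtain f' where *: "f' \<in> smooth_class" "\<forall>x. (f has_vector_derivative f' x) (at x)" by blast
  have "((\<lambda>x. exp (f x)) has_vector_derivative f' x * exp (f x)) (at x)" for x
  proof -
    have "((exp \<circ> f) has_vector_derivative f' x * exp (f x)) (at x)"
      using * DERIV_exp by (intro field_vector_diff_chain_at) auto
    then show ?thesis by (simp add: o_def)
  qed
  moreover have "(\<lambda>x. f' x * exp (f x)) \<in> smooth_class"
    by (intro smooth_class.mult smooth_class.exp * exp.hyps)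
  ultimately show ?case by (intro bexI[of _ "\<lambda>x. f' x * exp (f x)"] allI)
next
  case (affine f a b)
  then obtain f' where *: "f' \<in> smooth_class" "\<forall>x. (f has_vector_derivative f' x) (at x)" by blast
  have "((\<lambda>x. f (a * x + b)) has_vector_derivative of_real a * f' (a * x + b)) (at x)" for x
  proof -
    have "((\<lambda>x. a * x + b) has_vector_derivative a) (at x)"
      by (auto simp: has_vector_derivative_def intro!: derivative_eq_intros)
    then have "((f \<circ> (\<lambda>x. a * x + b)) has_vector_derivative a *\<^sub>R f' (a * x + b)) (at x)"
      using * by (intro vector_diff_chain_at) auto
    then show ?thesis by (simp add: o_def scaleR_conv_of_real)
  qed
  moreover have "(\<lambda>x. of_real a * f' (a * x + b)) \<in> smooth_class"
    by (intro smooth_class.mult smooth_class.const smooth_class.affine *)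
  ultimately show ?case by (intro bexI[of _ "\<lambda>x. of_real a * f' (a * x + b)"] allI)
next
  case (local f)
  \<comment> \<open>Near each point the derivative of \<open>f\<close> agrees with that of a member,
    so it belongs to the class by the local rule again.\<close>
  define f' where "f' = (\<lambda>x. vector_derivative f (at x))"
  have near: "\<exists>g'. g' \<in> smooth_class \<and> (\<forall>\<^sub>F y in nhds x. (f has_vector_derivative g' y) (at y))" for x
  proof -
    obtain g g' where g: "\<forall>\<^sub>F y in nhds x. f y = g y" "g' \<in> smooth_class"
        "\<And>y. (g has_vector_derivative g' y) (at y)"
      using local[of x] by blast
    then obtain U where U: "open U" "x \<in> U" "\<And>y. y \<in> U \<Longrightarrow> f y = g y"
      unfolding eventually_nhds by blast
    have "(f has_vector_derivative g' y) (at y)" if "y \<in> U" for y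
      using has_vector_derivative_transform_within_open[OF g(3) U(1) that, of f] U(3) by auto
    then show ?thesis using g(2) U(1,2) unfolding eventually_nhds by blast
  qed
  have "(f has_vector_derivative f' x) (at x)" for x
  proof -
    obtain g' where "\<forall>\<^sub>F y in nhds x. (f has_vector_derivative g' y) (at y)" using near by blast
    then have "(f has_vector_derivative g' x) (at x)" by (rule eventually_nhds_x_imp_x)
    then show ?thesis unfolding f'_def using vector_derivative_at by metis
  qed
  moreover have "f' \<in> smooth_class"
  proof (rule smooth_class.local)
    fix x
    obtain g' where g': "g' \<in> smooth_class" "\<forall>\<^sub>F y in nhds x. (f has_vector_derivative g' y) (at y)"
      using near by blast
    have "\<forall>\<^sub>F y in nhds x. f' y = g' y"
      using g'(2) by eventually_elim (simp add: f'_def vector_derivative_at)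
    then show "\<exists>g. g \<in> smooth_class \<and> (\<forall>\<^sub>F y in nhds x. f' y = g y)" using g'(1) by blast
  qed
  ultimately show ?case by blast
qed

lemma smooth_class_smooth:
  assumes "f \<in> smooth_class" shows "smooth f"
  unfolding smooth_def
proof
  fix n
  have "((\<lambda>g t. vector_derivative g (at t)) ^^ n) f \<in> smooth_class"
  proof (induction n)
    case (Suc n)
    let ?g = "((\<lambda>g t. vector_derivative g (at t)) ^^ n) f"
    obtain g' where g': "g' \<in> smooth_class" "\<forall>x. (?g has_vector_derivative g' x) (at x)"
      using smooth_class_derivative[OF Suc] by blast
    then have "(\<lambda>t. vector_derivative ?g (at t)) = g'" using vector_derivative_at by blast
    then show ?case using g'(1) by simp
  qed (simp add: assms)
  from smooth_class_derivative[OF this]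
  show "((\<lambda>g t. vector_derivative g (at t)) ^^ n) f differentiable_on UNIV"
    unfolding differentiable_on_def differentiable_def has_vector_derivative_def by blast
qed

section \<open>A smooth transition function and interpolation\<close>

text \<open>Rises from 0 to 1 on the unit interval and is constant outside. Replacing
  \<open>x\<close> by \<open>1 - x\<close> turns it into its complement to 1, hence the value 1/2 at
  1/2, where two exchanging strands will meet.\<close>

definition step :: "real \<Rightarrow> real" where
  "step x = flat 0 x / (flat 0 x + flat 0 (1 - x))"

text \<open>The quotient rule after cancellation, with \<open>flat 2\<close> as derivative of
  \<open>flat 0\<close>. In this form positivity is visible.\<close>

definition step' :: "real \<Rightarrow> real" where
  "step' x = (flat 2 x * flat 0 (1 - x) + flat 0 x * flat 2 (1 - x)) / (flat 0 x + flat 0 (1 - x))\<^sup>2"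

lemma flat_nonneg: "flat k x \<ge> 0" unfolding flat_def by simp

lemma step_denominator: "flat 0 x + flat 0 (1 - x) > 0"
  using flat_nonneg[of 0 x] flat_nonneg[of 0 "1 - x"] by (cases "x > 0") (auto simp: flat_def add_pos_nonneg)

lemma step_deriv: "(step has_real_derivative step' x) (at x)"
proof -
  have d: "(flat 0 has_real_derivative flat 2 y) (at y)" for y
    using flat_deriv[of 0 y] by (simp add: numeral_2_eq_2)
  have "((\<lambda>x. flat 0 (1 - x)) has_real_derivative - flat 2 (1 - x)) (at x)"
    by (rule DERIV_chain2[where g = "\<lambda>x. 1 - x" and Db = "-1", OF d, simplified]) (auto intro!: derivative_eq_intros)
  then show ?thesis
    unfolding step_def step'_def using step_denominator[of x] d
    by (auto intro!: derivative_eq_intros simp: power2_eq_square algebra_simps)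
qed

lemma step_le_0: "x \<le> 0 \<Longrightarrow> step x = 0"
  and step_ge_1: "x \<ge> 1 \<Longrightarrow> step x = 1"
  and step_half: "step (1/2) = 1/2"
  unfolding step_def flat_def by (auto simp: field_simps)

lemma step'_pos: "\<lbrakk>0 < x; x < 1\<rbrakk> \<Longrightarrow> step' x > 0"
  unfolding step'_def flat_def by (auto intro!: divide_pos_pos add_pos_pos mult_pos_pos zero_less_power)

lemma step_strict_mono: "\<lbrakk>0 \<le> x; x < y; y \<le> 1\<rbrakk> \<Longrightarrow> step x < step y"
proof -
  assume xy: "0 \<le> x" "x < y" "y \<le> 1"
  show ?thesis
  proof (rule DERIV_pos_imp_increasing_open[OF xy(2)])
    fix z assume "x < z" "z < y"
    then show "\<exists>d. (step has_real_derivative d) (at z) \<and> d > 0"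
      using step_deriv[of z] step'_pos[of z] xy by auto
  next
    show "continuous_on {x..y} step"
      by (meson DERIV_isCont continuous_at_imp_continuous_on step_deriv)
  qed
qed

lemma step_in_smooth_class: "(\<lambda>x. complex_of_real (step x)) \<in> smooth_class"
proof -
  let ?g = "\<lambda>x. complex_of_real (flat 0 x) + complex_of_real (flat 0 ((-1) * x + 1))"
  have g: "?g x = complex_of_real (flat 0 x + flat 0 (1 - x))" for x by simp
  have ne: "?g x \<noteq> 0" for x unfolding g of_real_eq_0_iff using step_denominator[of x] by simp
  have "(\<lambda>x. complex_of_real (flat 0 x) * inverse (?g x)) \<in> smooth_class"
    using smooth_class.affine[OF flat_in_smooth_class[of 0], of "-1" 1]
    by (intro smooth_class.mult smooth_class.inverse smooth_class.add flat_in_smooth_class ne)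
  moreover have "complex_of_real (flat 0 x) * inverse (?g x) = complex_of_real (step x)" for x
    unfolding g step_def by (simp add: divide_inverse)
  ultimately show ?thesis by simp
qed

section \<open>Braid words\<close>

lemma step_nonneg: "0 \<le> step x" and step_le_1: "step x \<le> 1"
  unfolding step_def using step_denominator[of x] flat_nonneg[of 0 x] flat_nonneg[of 0 "1 - x"]
  by (simp_all add: divide_le_eq)

text \<open>A smooth function with the values \<open>h\<close> at the integers. All its derivatives
  vanish there, so the pieces join smoothly.\<close>

definition interp :: "(int \<Rightarrow> real) \<Rightarrow> real \<Rightarrow> real" where
  "interp h x = h \<lfloor>x\<rfloor> + (h (\<lfloor>x\<rfloor> + 1) - h \<lfloor>x\<rfloor>) * step (frac x)"

definition interp' :: "(int \<Rightarrow> real) \<Rightarrow> real \<Rightarrow> real" where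
  "interp' h x = (h (\<lfloor>x\<rfloor> + 1) - h \<lfloor>x\<rfloor>) * step' (frac x)"

text \<open>On either side of \<open>n\<close> one of the two transitions is constant, so a single
  formula without floors covers both sides. It settles smoothness at the integers.\<close>

lemma interp_local:
  assumes "of_int n - 1 < x" "x < of_int n + 1"
  shows "interp h x = h (n - 1) + (h n - h (n - 1)) * step (x - of_int (n - 1)) + (h (n + 1) - h n) * step (x - of_int n)"
proof (cases "x < of_int n")
  case True
  then have "\<lfloor>x\<rfloor> = n - 1" using assms by linarith
  then show ?thesis using True by (simp add: interp_def frac_def step_le_0)
next
  case False
  then have "\<lfloor>x\<rfloor> = n" using assms by linarith
  then show ?thesis using False by (simp add: interp_def frac_def step_ge_1)
qed

lemma step'_outside: "x \<le> 0 \<or> x \<ge> 1 \<Longrightarrow> step' x = 0"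
  unfolding step'_def flat_def by auto

lemma interp_deriv: "(interp h has_real_derivative interp' h x) (at x)"
proof -
  define n where "n = \<lfloor>x\<rfloor>"
  have x: "of_int n - 1 < x" "x < of_int n + 1" unfolding n_def by linarith+
  have s: "((\<lambda>x. step (x - of_int k)) has_real_derivative step' (x - of_int k)) (at x)" for k
  proof -
    have "((\<lambda>x. x - of_int k) has_real_derivative 1) (at x)" by (auto intro!: derivative_eq_intros)
    from DERIV_chain2[OF step_deriv this] show ?thesis by simp
  qed
  have "((\<lambda>x. h (n - 1) + (h n - h (n - 1)) * step (x - of_int (n - 1)) + (h (n + 1) - h n) * step (x - of_int n))
      has_real_derivative (h n - h (n - 1)) * step' (x - of_int (n - 1)) + (h (n + 1) - h n) * step' (x - of_int n)) (at x)"
    by (auto intro!: derivative_eq_intros s[of "n - 1", simplified] s[of n])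
  moreover have "step' (x - of_int (n - 1)) = 0" by (rule step'_outside) (use n_def in linarith)
  ultimately have "((\<lambda>x. h (n - 1) + (h n - h (n - 1)) * step (x - of_int (n - 1)) + (h (n + 1) - h n) * step (x - of_int n))
      has_real_derivative interp' h x) (at x)"
    by (simp add: interp'_def n_def frac_def)
  then show ?thesis
    by (rule has_field_derivative_transform_within_open[where S = "{of_int n - 1<..<of_int n + 1}"])
      (use x in \<open>auto simp: interp_local\<close>)
qed

lemma interp_in_smooth_class: "(\<lambda>x. complex_of_real (interp h x)) \<in> smooth_class"
proof (rule smooth_class.local)
  fix x :: real
  define n where "n = \<lfloor>x\<rfloor>"
  have x: "x \<in> {of_int n - 1<..<of_int n + 1}" unfolding n_def by auto linarith+
  let ?g = "\<lambda>x. complex_of_real (h (n - 1)) + complex_of_real (h n - h (n - 1)) * complex_of_real (step (1 * x + - of_int (n - 1)))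
      + complex_of_real (h (n + 1) - h n) * complex_of_real (step (1 * x + - of_int n))"
  have "?g \<in> smooth_class"
    by (intro smooth_class.add smooth_class.mult smooth_class.const smooth_class.affine[OF step_in_smooth_class])
  moreover have "\<forall>\<^sub>F y in nhds x. complex_of_real (interp h y) = ?g y"
    unfolding eventually_nhds
    by (rule exI[of _ "{of_int n - 1<..<of_int n + 1}"]) (use x in \<open>auto simp: interp_local simp del: of_int_diff\<close>)
  ultimately show "\<exists>g. g \<in> smooth_class \<and> (\<forall>\<^sub>F y in nhds x. complex_of_real (interp h y) = g y)" by blast
qed

lemma floor_frac_add_int: "\<lfloor>x + of_int n\<rfloor> = \<lfloor>x\<rfloor> + n" "frac (x + of_int n) = frac x"
  by (auto simp: frac_def)

lemma interp_shift: "interp h (x + of_int n) = interp (\<lambda>k. h (k + n)) x"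
    "interp' h (x + of_int n) = interp' (\<lambda>k. h (k + n)) x"
  unfolding interp_def interp'_def floor_frac_add_int by (simp_all add: algebra_simps)

text \<open>The letter \<open>a\<close> of a braid word stands for the crossing of the strands at positions \<open>a\<close> and \<open>a + 1\<close>.\<close>

definition swap :: "nat \<Rightarrow> nat \<Rightarrow> nat" where
  "swap a x = (if x = a then Suc a else if x = Suc a then a else x)"

lemma swap_swap [simp]: "swap a (swap a x) = x"
  unfolding swap_def by auto

lemma bij_swap: "bij (swap a)"
  by (rule o_bij[of "swap a"]) (auto simp: fun_eq_iff)

text \<open>The letters act from left to right: \<open>perm W x\<close> is the position after the
  word of the strand that enters at \<open>x\<close>.\<close>

definition perm :: "nat list \<Rightarrow> nat \<Rightarrow> nat" where
  "perm W = fold swap W"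

lemma perm_Nil [simp]: "perm [] x = x"
  and perm_append [simp]: "perm (V @ W) x = perm W (perm V x)"
  and perm_Cons [simp]: "perm (a # W) x = perm W (swap a x)"
  unfolding perm_def by simp_all

lemma bij_perm: "bij (perm W)"
proof (induction W rule: rev_induct)
  case Nil
  then show ?case by (simp add: perm_def bij_betw_def)
next
  case (snoc a W)
  have eq: "perm (W @ [a]) = swap a \<circ> perm W" by (simp add: fun_eq_iff)
  show ?case unfolding eq by (rule bij_comp[OF snoc bij_swap])
qed

lemma perm_take_Suc: "c < length W \<Longrightarrow> perm (take (Suc c) W) x = swap (W ! c) (perm (take c W) x)"
  by (simp add: take_Suc_conv_app_nth)

text \<open>\<open>s i q\<close> is the position at which curve \<open>i\<close> begins its
  \<open>q\<close>-th turn, and each turn reads the word once. Positions taken by no strand are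
  vacant; this lets the word of a pair also describe one of its curves.\<close>

locale word_braid =
  fixes W :: "nat list" and L m :: nat and s :: "nat \<Rightarrow> int \<Rightarrow> nat"
  assumes L_pos: "L > 0" and m_pos: "m > 0" and W_ne: "W \<noteq> []"
    and s_Suc: "\<And>i q. i < L \<Longrightarrow> s i (q + 1) = perm W (s i q)"
    and s_periodic: "\<And>i q. i < L \<Longrightarrow> s i (q + int m) = s i q"
    and s_inj: "\<And>q. inj_on (\<lambda>(i, k). s i (q + int k)) ({..<L} \<times> {..<m})"
begin

abbreviation w :: nat where "w \<equiv> length W"

text \<open>Position of curve \<open>i\<close> just before letter \<open>n\<close>, where letters
  are numbered consecutively over all turns.\<close>

definition height :: "nat \<Rightarrow> int \<Rightarrow> nat" where
  "height i n = perm (take (nat (n mod w)) W) (s i (n div w))"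

text \<open>Position 0 is innermost, and the summand 1 keeps its radius positive. In one period the
  curve reads \<open>w\<close> letters in each of \<open>m\<close> turns.\<close>

definition R :: "nat \<Rightarrow> real \<Rightarrow> real" where
  "R i t = interp (\<lambda>n. 1 + real (height i n)) (real (m * w) * t)"

definition R' :: "nat \<Rightarrow> real \<Rightarrow> real" where
  "R' i t = real (m * w) * interp' (\<lambda>n. 1 + real (height i n)) (real (m * w) * t)"

lemma w_pos: "w > 0" using W_ne by simp

lemma height_Suc:
  assumes "i < L"
  shows "height i (n + 1) = (let a = W ! nat (n mod w) in swap a (height i n))"
proof -
  define c where "c = nat (n mod w)"
  have c: "int c = n mod w" "c < w" unfolding c_def using w_pos by (auto simp: nat_less_iff)
  have n: "n = int w * (n div w) + int c" using c(1) by simp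
  have "height i (n + 1) = perm (take (Suc c) W) (s i (n div w))"
  proof (cases "Suc c < w")
    case True
    have n': "n + 1 = int w * (n div w) + int (Suc c)" using n by simp
    have "(n + 1) mod w = int (Suc c)" "(n + 1) div w = n div w"
      by (rule int_mod_pos_eq[OF n'], use True in simp_all) (rule int_div_pos_eq[OF n'], use True in simp_all)
    then show ?thesis unfolding height_def by (simp only: nat_int)
  next
    case False
    then have "Suc c = w" using c(2) by simp
    then have n': "n + 1 = int w * (n div w + 1) + 0" using n by (simp add: algebra_simps)
    have "(n + 1) mod w = 0" "(n + 1) div w = n div w + 1"
      by (rule int_mod_pos_eq[OF n'], use w_pos in simp_all) (rule int_div_pos_eq[OF n'], use w_pos in simp_all)
    then show ?thesis unfolding height_def using s_Suc[OF assms] \<open>Suc c = w\<close> by simp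
  qed
  then show ?thesis unfolding perm_take_Suc[OF c(2)] height_def c_def[symmetric] by (simp add: Let_def)
qed

lemma height_add_turns: "height i (n + int w * k) = perm (take (nat (n mod w)) W) (s i (n div w + k))"
  unfolding height_def using w_pos by (simp add: add.commute)

lemma height_periodic: "i < L \<Longrightarrow> height i (n + int (m * w)) = height i n"
  using height_add_turns[of i n "int m"] s_periodic[of i "n div w"] by (simp add: height_def mult.commute)

lemma interp_pos: "interp (\<lambda>n. 1 + real (height i n)) x > 0"
proof -
  let ?s = "step (frac x)"
  have s: "0 \<le> ?s" "?s \<le> 1" by (rule step_nonneg step_le_1)+
  have "interp (\<lambda>n. 1 + real (height i n)) x
      = 1 + ((1 - ?s) * real (height i \<lfloor>x\<rfloor>) + ?s * real (height i (\<lfloor>x\<rfloor> + 1)))"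
    unfolding interp_def by (simp add: algebra_simps)
  moreover have "(1 - ?s) * real (height i \<lfloor>x\<rfloor>) + ?s * real (height i (\<lfloor>x\<rfloor> + 1)) \<ge> 0" using s by simp
  ultimately show ?thesis by linarith
qed

sublocale braid_curves L m R R'
proof
  fix i t assume i: "i < L"
  show "R i (t + 1) = R i t"
  proof -
    have "real (m * w) * (t + 1) = real (m * w) * t + of_int (int (m * w))" by (simp add: algebra_simps)
    then show ?thesis unfolding R_def using height_periodic[OF i] by (simp only: interp_shift)
  qed
  show "R i t > 0" unfolding R_def by (rule interp_pos)
  show "(R i has_real_derivative R' i t) (at t)"
  proof -
    have "((\<lambda>t. real (m * w) * t) has_real_derivative real (m * w)) (at t)"
      by (auto intro!: derivative_eq_intros)
    from DERIV_chain2[OF interp_deriv this, of "\<lambda>n. 1 + real (height i n)"]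
    show ?thesis unfolding R_def[abs_def] R'_def by (simp only: mult.commute)
  qed
qed (rule L_pos m_pos)+

lemma smooth_curve: "smooth (curve i)"
proof (rule smooth_class_smooth)
  have "(\<lambda>t. complex_of_real (interp (\<lambda>n. 1 + real (height i n)) (real (m * w) * t + 0)) *
      exp (complex_of_real t * (\<i> * complex_of_real (2 * pi * m)))) \<in> smooth_class"
    by (intro smooth_class.mult smooth_class.exp smooth_class.ident smooth_class.const
        smooth_class.affine[OF interp_in_smooth_class])
  moreover have "curve i t = complex_of_real (interp (\<lambda>n. 1 + real (height i n)) (real (m * w) * t + 0)) *
      exp (complex_of_real t * (\<i> * complex_of_real (2 * pi * m)))" for t
  proof -
    have "curve i t = polar (R i t) (real m * t)" by (simp only: curve_def)
    also have "R i t = interp (\<lambda>n. 1 + real (height i n)) (real (m * w) * t + 0)" by (simp only: R_def add_0_right)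
    finally show ?thesis by (simp add: cis_conv_exp scaleR_conv_of_real mult_ac)
  qed
  ultimately show "curve i \<in> smooth_class" by presburger
qed

definition place :: "nat \<times> nat \<Rightarrow> int \<Rightarrow> nat" where
  "place a n = perm (take (nat (n mod w)) W) (s (fst a) (n div w + int (snd a)))"

lemma inj_place: "inj_on (\<lambda>a. place a n) strands"
proof -
  have "inj_on (perm (take (nat (n mod w)) W) \<circ> (\<lambda>(i, k). s i (n div w + int k))) ({..<L} \<times> {..<m})"
    by (intro comp_inj_on s_inj) (meson bij_perm bij_betw_def inj_on_subset subset_UNIV)
  then show ?thesis unfolding strands_def place_def by (simp add: o_def split_beta)
qed

definition letter :: "real \<Rightarrow> nat" where
  "letter \<phi> = W ! nat (\<lfloor>real w * \<phi>\<rfloor> mod w)"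

text \<open>During a letter only the strands at its two positions move, along mirror-image profiles
  with opposite slopes. \<open>place a n\<close> is the position at the start of the letter.\<close>

lemma radius_cases:
  fixes \<phi> :: real
  assumes a: "a \<in> strands"
  defines "n \<equiv> \<lfloor>real w * \<phi>\<rfloor>" and "\<sigma> \<equiv> step (frac (real w * \<phi>))" and "\<sigma>' \<equiv> step' (frac (real w * \<phi>))"
  shows "radius a \<phi> = (if place a n = letter \<phi> then 1 + real (letter \<phi>) + \<sigma>
      else if place a n = Suc (letter \<phi>) then 2 + real (letter \<phi>) - \<sigma> else 1 + real (place a n))"
    and "place a n = letter \<phi> \<Longrightarrow> radius' a \<phi> = real (m * w) * \<sigma>'"
    and "place a n = Suc (letter \<phi>) \<Longrightarrow> radius' a \<phi> = - real (m * w) * \<sigma>'"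
proof -
  obtain i k where ik: "a = (i, k)" "i < L" using a unfolding strands_def by auto
  have e: "real (m * w) * ((\<phi> + k) / m) = real w * \<phi> + of_int (int w * int k)"
    using m_pos by (simp add: field_simps)
  have h0: "height i (n + int w * int k) = place a n"
    using height_add_turns[of i n "int k"] unfolding place_def ik by simp
  have md: "(n + int w * int k) mod w = n mod w" by simp
  have l: "letter \<phi> = W ! nat (n mod w)" unfolding letter_def n_def ..
  have h1: "height i (n + int w * int k + 1) = swap (letter \<phi>) (place a n)"
    using height_Suc[OF ik(2), of "n + int w * int k"] unfolding md h0 l Let_def .
  have r: "radius a \<phi> = 1 + real (place a n) + (real (swap (letter \<phi>) (place a n)) - real (place a n)) * \<sigma>"
    unfolding radius_def R_def ik(1) fst_conv snd_conv e interp_def floor_frac_add_int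
      n_def[symmetric] h0 h1 \<sigma>_def by simp
  have r': "radius' a \<phi> = real (m * w) * ((real (swap (letter \<phi>) (place a n)) - real (place a n)) * \<sigma>')"
    unfolding radius'_def R'_def ik(1) fst_conv snd_conv e interp'_def floor_frac_add_int
      n_def[symmetric] h0 h1 \<sigma>'_def by simp
  show "radius a \<phi> = (if place a n = letter \<phi> then 1 + real (letter \<phi>) + \<sigma>
      else if place a n = Suc (letter \<phi>) then 2 + real (letter \<phi>) - \<sigma> else 1 + real (place a n))"
    unfolding r by (auto simp: swap_def)
  show "radius' a \<phi> = real (m * w) * \<sigma>'" if "place a n = letter \<phi>"
    unfolding r' that by (simp add: swap_def)
  show "radius' a \<phi> = - real (m * w) * \<sigma>'" if "place a n = Suc (letter \<phi>)"
    unfolding r' that by (simp add: swap_def)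
qed

lemma step_frac: "0 \<le> step (frac x)" "step (frac x) < 1" "step (frac x) = 1/2 \<longleftrightarrow> frac x = 1/2"
proof -
  have f: "0 \<le> frac x" "frac x < 1" using frac_lt_1[of x] by auto
  show "0 \<le> step (frac x)" by (rule step_nonneg)
  show "step (frac x) < 1" using step_strict_mono[of "frac x" 1] step_ge_1[of 1] f by auto
  have "frac x < 1/2 \<Longrightarrow> step (frac x) < 1/2" "frac x > 1/2 \<Longrightarrow> step (frac x) > 1/2"
    using step_strict_mono[of "frac x" "1/2"] step_strict_mono[of "1/2" "frac x"] f step_half by auto
  then show "step (frac x) = 1/2 \<longleftrightarrow> frac x = 1/2" using step_half by (metis less_irrefl linorder_neqE_linordered_idom)
qed

text \<open>Resting strands have integer radii, and a moving strand has an integer radius only when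
  the letter starts, at its own position. So equal radii need two moving strands, and these meet
  only halfway.\<close>

lemma crossing_places:
  fixes \<phi> :: real
  assumes ab: "a \<in> strands" "b \<in> strands" "a \<noteq> b" "radius a \<phi> = radius b \<phi>"
  defines "n \<equiv> \<lfloor>real w * \<phi>\<rfloor>"
  shows "frac (real w * \<phi>) = 1/2" "{place a n, place b n} = {letter \<phi>, Suc (letter \<phi>)}"
proof -
  let ?s = "step (frac (real w * \<phi>))" and ?j = "letter \<phi>"
  have ne: "place a n \<noteq> place b n" using inj_place ab(1-3) by (meson inj_onD)
  have ints: "real x = real y + ?s \<Longrightarrow> x = y" "real x = real y - ?s \<Longrightarrow> x = y" for x y :: nat
    using step_frac(1,2)[of "real w * \<phi>"] by linarith+
  have val: "place c n = ?j \<and> radius c \<phi> = 1 + real ?j + ?s \<or> place c n = Suc ?j \<and> radius c \<phi> = 2 + real ?j - ?s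
      \<or> place c n \<noteq> ?j \<and> place c n \<noteq> Suc ?j \<and> radius c \<phi> = 1 + real (place c n)" if "c \<in> strands" for c
    using radius_cases(1)[OF that, of \<phi>] unfolding n_def by presburger
  have *: "(place a n = ?j \<and> place b n = Suc ?j \<or> place a n = Suc ?j \<and> place b n = ?j) \<and> ?s = 1/2"
    using val[OF ab(1)]
  proof (elim disjE conjE)
    assume a: "place a n = ?j" "radius a \<phi> = 1 + real ?j + ?s"
    then show ?thesis using val[OF ab(2)] ab(4) ne ints(1)[of "place b n" ?j] by auto
  next
    assume a: "place a n = Suc ?j" "radius a \<phi> = 2 + real ?j - ?s"
    then show ?thesis using val[OF ab(2)] ab(4) ne ints(2)[of "place b n" "Suc ?j"] by auto
  next
    assume a: "place a n \<noteq> ?j" "place a n \<noteq> Suc ?j" "radius a \<phi> = 1 + real (place a n)"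
    then show ?thesis
      using val[OF ab(2)] ab(4) ne ints(1)[of "place a n" ?j] ints(2)[of "place a n" "Suc ?j"] by auto
  qed
  then show "frac (real w * \<phi>) = 1/2" using step_frac(3) by blast
  show "{place a n, place b n} = {?j, Suc ?j}" using * by auto
qed

end

section \<open>Letters and the crossings they produce\<close>

context word_braid
begin

definition occupied :: "nat \<Rightarrow> nat set" where
  "occupied c = (\<lambda>a. place a (int c)) ` strands"

text \<open>The letters that produce a crossing. If one of its positions is vacant, a letter moves
  at most one strand and creates no double point.\<close>

definition active :: "nat set" where
  "active = {c. c < w \<and> W ! c \<in> occupied c \<and> Suc (W ! c) \<in> occupied c}"

definition midpoint :: "nat \<Rightarrow> real" where
  "midpoint c = (real c + 1/2) / real w"

lemma midpoint:
  assumes "c < w"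
  shows "\<lfloor>real w * midpoint c\<rfloor> = int c" "frac (real w * midpoint c) = 1/2" "letter (midpoint c) = W ! c"
proof -
  have e: "real w * midpoint c = real c + 1/2" unfolding midpoint_def using w_pos by simp
  show fl: "\<lfloor>real w * midpoint c\<rfloor> = int c" unfolding e by linarith
  show "frac (real w * midpoint c) = 1/2" unfolding frac_def fl unfolding e by simp
  show "letter (midpoint c) = W ! c" unfolding letter_def fl using assms by simp
qed

lemma card_places: "card {a \<in> strands. P (place a (int c))} = card {y \<in> occupied c. P y}"
proof -
  have "{y \<in> occupied c. P y} = (\<lambda>a. place a (int c)) ` {a \<in> strands. P (place a (int c))}"
    unfolding occupied_def by blast
  moreover have "card \<dots> = card {a \<in> strands. P (place a (int c))}"
    by (intro card_image inj_on_subset[OF inj_place]) blast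
  ultimately show ?thesis by simp
qed

text \<open>Halfway through the letter the two exchanged strands meet at a half-integer radius,
  while all others have integer radii. So the strands outside are read off from the occupied
  positions.\<close>

lemma count_midpoint:
  assumes c: "c \<in> active"
  shows "count (\<lambda>x. x = real (W ! c) + 3/2) (midpoint c) = 2"
    and "count (\<lambda>x. real (W ! c) + 3/2 < x) (midpoint c) = card {y \<in> occupied c. Suc (W ! c) < y}"
proof -
  let ?j = "W ! c"
  have cw: "c < w" using c unfolding active_def by simp
  have rad: "radius a (midpoint c) = (if place a (int c) = ?j \<or> place a (int c) = Suc ?j then real ?j + 3/2 else 1 + real (place a (int c)))"
    if "a \<in> strands" for a
    using radius_cases(1)[OF that, of "midpoint c"] unfolding midpoint[OF cw] step_half by simp
  have ni: "1 + real p \<noteq> real ?j + 3/2" for p :: nat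
  proof
    assume "1 + real p = real ?j + 3/2"
    then have "2 * p = 2 * ?j + 1" by linarith
    then show False by presburger
  qed
  have "{a \<in> strands. radius a (midpoint c) = real ?j + 3/2} = {a \<in> strands. place a (int c) = ?j \<or> place a (int c) = Suc ?j}"
  proof -
    have "radius a (midpoint c) = real ?j + 3/2 \<longleftrightarrow> place a (int c) = ?j \<or> place a (int c) = Suc ?j" if "a \<in> strands" for a
      using rad[OF that] ni by metis
    then show ?thesis by blast
  qed
  moreover have "{y \<in> occupied c. y = ?j \<or> y = Suc ?j} = {?j, Suc ?j}" using c unfolding active_def by auto
  ultimately show "count (\<lambda>x. x = real ?j + 3/2) (midpoint c) = 2"
    unfolding count_def using card_places[of "\<lambda>y. y = ?j \<or> y = Suc ?j" c] by simp
  have "{a \<in> strands. real ?j + 3/2 < radius a (midpoint c)} = {a \<in> strands. Suc ?j < place a (int c)}"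
  proof -
    have "real ?j + 3/2 < radius a (midpoint c) \<longleftrightarrow> Suc ?j < place a (int c)" if "a \<in> strands" for a
    proof (cases "place a (int c) = ?j \<or> place a (int c) = Suc ?j")
      case True
      then show ?thesis using rad[OF that] by auto
    next
      case False
      then have "real ?j + 3/2 < radius a (midpoint c) \<longleftrightarrow> ?j < place a (int c)"
        using rad[OF that] by auto
      then show ?thesis using False by linarith
    qed
    then show ?thesis by blast
  qed
  then show "count (\<lambda>x. real ?j + 3/2 < x) (midpoint c) = card {y \<in> occupied c. Suc ?j < y}"
    unfolding count_def using card_places[of "\<lambda>y. Suc ?j < y" c] by simp
qed

lemma crossing_active:
  assumes \<phi>: "0 \<le> \<phi>" "\<phi> < 1" and two: "count (\<lambda>x. x = r) \<phi> = 2"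
  shows "\<exists>c\<in>active. \<phi> = midpoint c \<and> r = real (W ! c) + 3/2"
proof -
  obtain a b where ab: "a \<in> strands" "b \<in> strands" "a \<noteq> b" "radius a \<phi> = r" "radius b \<phi> = r"
    using two unfolding count_def card_2_iff by blast
  have eq: "radius a \<phi> = radius b \<phi>" using ab by simp
  note cp = crossing_places[OF ab(1-3) eq]
  let ?n = "\<lfloor>real w * \<phi>\<rfloor>"
  have n: "0 \<le> ?n" "?n < int w" using \<phi> w_pos by (auto simp: floor_less_iff)
  define c where "c = nat ?n"
  have c: "int c = ?n" "c < w" unfolding c_def using n by (auto simp: nat_less_iff)
  have "real w * \<phi> = real c + 1/2" using cp(1) c(1) unfolding frac_def by linarith
  then have mid: "\<phi> = midpoint c" unfolding midpoint_def using w_pos by (simp add: field_simps)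
  have letter: "letter \<phi> = W ! c" unfolding mid by (rule midpoint[OF c(2)])
  have "W ! c \<in> occupied c" "Suc (W ! c) \<in> occupied c"
    using cp(2) ab(1,2) unfolding occupied_def letter c(1) by (metis imageI insertCI insertE singletonD)+
  then have "c \<in> active" unfolding active_def using c(2) by blast
  moreover have "r = real (W ! c) + 3/2"
  proof -
    have "place a ?n = letter \<phi> \<or> place a ?n = Suc (letter \<phi>)" using cp(2) by blast
    then show ?thesis
      using radius_cases(1)[OF ab(1), of \<phi>] ab(4) letter step_half unfolding cp(1) by auto
  qed
  ultimately show ?thesis using mid by blast
qed

end

text \<open>Levels count occupied positions only, so the level of a letter depends on which curves
  are present.\<close>

locale complete_word_braid = word_braid +
  assumes levels: "\<And>j. \<lbrakk>0 < j; j < L * m\<rbrakk> \<Longrightarrow> \<exists>c\<in>active. Suc (card {y \<in> occupied c. Suc (W ! c) < y}) = j"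
begin

sublocale generic_braid L m R R'
proof
  fix a b \<phi> assume ab: "a \<in> strands" "b \<in> strands" "a \<noteq> b" "radius a \<phi> = radius b \<phi>"
  note cp = crossing_places[OF ab]
  have pos: "real (m * w) * step' (frac (real w * \<phi>)) > 0"
    unfolding cp(1) using step'_pos[of "1/2"] m_pos w_pos by simp
  consider "place a \<lfloor>real w * \<phi>\<rfloor> = letter \<phi>" "place b \<lfloor>real w * \<phi>\<rfloor> = Suc (letter \<phi>)"
    | "place b \<lfloor>real w * \<phi>\<rfloor> = letter \<phi>" "place a \<lfloor>real w * \<phi>\<rfloor> = Suc (letter \<phi>)"
    using cp(2) by (auto simp: doubleton_eq_iff)
  then show "radius' a \<phi> \<noteq> radius' b \<phi>"
  proof cases
    case 1
    then show ?thesis using radius_cases(2)[OF ab(1), of \<phi>] radius_cases(3)[OF ab(2), of \<phi>] pos by linarith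
  next
    case 2
    then show ?thesis using radius_cases(3)[OF ab(1), of \<phi>] radius_cases(2)[OF ab(2), of \<phi>] pos by linarith
  qed
next
  fix r \<phi>
  let ?S = "{a \<in> strands. radius a \<phi> = r}" and ?n = "\<lfloor>real w * \<phi>\<rfloor>"
  have fin: "finite ?S" by simp
  show "count (\<lambda>x. x = r) \<phi> \<le> 2"
  proof (cases "\<forall>a\<in>?S. \<forall>b\<in>?S. a = b")
    case True
    then have "card ?S \<le> Suc 0" using card_le_Suc0_iff_eq[OF fin] by blast
    then show ?thesis unfolding count_def by linarith
  next
    case False
    then obtain a b where ab: "a \<in> ?S" "b \<in> ?S" "a \<noteq> b" by blast
    have "place c ?n \<in> {letter \<phi>, Suc (letter \<phi>)}" if c: "c \<in> ?S" for c
    proof -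
      obtain d where "d \<in> ?S" "c \<noteq> d" using ab by metis
      then show ?thesis using crossing_places(2)[of c d \<phi>] c by blast
    qed
    then have "(\<lambda>a. place a ?n) ` ?S \<subseteq> {letter \<phi>, Suc (letter \<phi>)}" by blast
    then have "card ((\<lambda>a. place a ?n) ` ?S) \<le> card {letter \<phi>, Suc (letter \<phi>)}" by (intro card_mono) auto
    moreover have "card ((\<lambda>a. place a ?n) ` ?S) = card ?S"
      by (intro card_image inj_on_subset[OF inj_place]) blast
    ultimately show ?thesis unfolding count_def by simp
  qed
next
  have "{\<phi> \<in> {0..<1}. \<exists>r. count (\<lambda>x. x = r) \<phi> = 2} \<subseteq> midpoint ` {..<w}"
    using crossing_active unfolding active_def by fastforce
  then show "finite {\<phi> \<in> {0..<1}. \<exists>r. count (\<lambda>x. x = r) \<phi> = 2}" by (rule finite_subset) simp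
next
  fix j assume "0 < j" "j < L * m"
  then obtain c where "c \<in> active" "Suc (card {y \<in> occupied c. Suc (W ! c) < y}) = j" using levels by blast
  then show "\<exists>r \<phi>. count (\<lambda>x. x = r) \<phi> = 2 \<and> Suc (count (\<lambda>x. r < x) \<phi>) = j" using count_midpoint by metis
qed

lemma card_double_points: "card (double_points curves) = card active"
proof -
  define f where "f = (\<lambda>c. polar (real (W ! c) + 3/2) (midpoint c))"
  have mid: "0 \<le> midpoint c" "midpoint c < 1" if "c < w" for c
  proof -
    have "real c + 1 \<le> real w" using that by linarith
    then show "0 \<le> midpoint c" "midpoint c < 1" unfolding midpoint_def using w_pos by auto
  qed
  have "inj_on f active"
  proof (rule inj_onI)
    fix c d assume cd: "c \<in> active" "d \<in> active" "f c = f d"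
    then have cdw: "c < w" "d < w" unfolding active_def by auto
    have "2 * pi * midpoint c = 2 * pi * midpoint d"
      using Arg2pi_polar[of "real (W ! c) + 3/2" "midpoint c"] Arg2pi_polar[of "real (W ! d) + 3/2" "midpoint d"]
        mid[OF cdw(1)] mid[OF cdw(2)] cd(3) unfolding f_def by simp
    then show "c = d" unfolding midpoint_def using w_pos by simp
  qed
  moreover have "f ` active = double_points curves"
  proof (intro equalityI subsetI)
    fix p assume "p \<in> f ` active"
    then obtain c where "c \<in> active" "p = f c" by blast
    then show "p \<in> double_points curves" unfolding f_def using polar_double_point count_midpoint(1) by simp
  next
    fix p assume "p \<in> double_points curves"
    then obtain r \<phi> where p: "r > 0" "0 \<le> \<phi>" "\<phi> < 1" "p = polar r \<phi>" "count (\<lambda>x. x = r) \<phi> = 2"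
      using double_points_polar by blast
    then obtain c where "c \<in> active" "\<phi> = midpoint c" "r = real (W ! c) + 3/2" using crossing_active by blast
    then show "p \<in> f ` active" unfolding f_def using p(4) by blast
  qed
  ultimately show ?thesis using card_image by metis
qed

lemma generic_word_braid: "generic curves"
  by (rule generic_curves) (rule smooth_curve)

lemma viro_sum:
  "real (card (double_points curves))
     - (\<Sum>C\<in>components (- curves_image curves). (real_of_int (omega curves C))\<^sup>2)
     + (\<Sum>p\<in>double_points curves. (ind curves p)\<^sup>2) = real (card active) - (real (L * m))\<^sup>2"
  using sum_ind_omega card_double_points by simp

end

section \<open>The braid of two ladders\<close>

lemma swap_less_iff: "Suc a \<noteq> t \<Longrightarrow> swap a x < t \<longleftrightarrow> x < t"
  unfolding swap_def by auto

text \<open>Only the letter \<open>t - 1\<close> exchanges a position below \<open>t\<close> with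
  one that is not.\<close>

lemma perm_less_iff: "(\<And>a. a \<in> set V \<Longrightarrow> Suc a \<noteq> t) \<Longrightarrow> perm V x < t \<longleftrightarrow> x < t"
  by (induction V arbitrary: x) (simp_all add: swap_less_iff)

lemma perm_image_lessThan:
  assumes "\<And>a. a \<in> set V \<Longrightarrow> Suc a \<noteq> t"
  shows "perm V ` {..<t} = {..<t}"
proof (intro equalityI subsetI)
  fix y assume "y \<in> {..<t}"
  moreover obtain x where "y = perm V x" using bij_perm[of V] by (metis bij_pointE)
  ultimately show "y \<in> perm V ` {..<t}" using perm_less_iff[OF assms] by auto
qed (use perm_less_iff[OF assms] in auto)

lemma perm_image_atLeastLessThan:
  assumes "\<And>a. a \<in> set V \<Longrightarrow> Suc a \<noteq> t \<and> Suc a \<noteq> u"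
  shows "perm V ` {t..<u} = {t..<u}"
proof -
  have "{t..<u} = {..<u} - {..<t}" by auto
  moreover have "perm V ` ({..<u} - {..<t}) = perm V ` {..<u} - perm V ` {..<t}"
    by (rule image_set_diff[OF bij_is_inj[OF bij_perm]])
  ultimately show ?thesis using perm_image_lessThan[of V t] perm_image_lessThan[of V u] assms by simp
qed

lemma perm_replicate: "perm (replicate n a) x = (if even n then x else swap a x)"
  by (induction n arbitrary: x) auto

text \<open>The strand at \<open>b\<close> is carried up to \<open>b + l\<close>, and each strand
  that it passes moves down by one.\<close>

lemma perm_upt: "perm [b..<b + l] x = (if x = b then b + l else if b < x \<and> x \<le> b + l then x - 1 else x)"
  by (induction l) (auto simp: swap_def)

text \<open>A braid on the positions \<open>b, ..., b + m - 1\<close>. For odd \<open>p\<close> its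
  permutation is an \<open>m\<close>-cycle, so repeating the first letter adjusts the number of
  crossings and keeps the curve in one piece.\<close>

definition ladder :: "nat \<Rightarrow> nat \<Rightarrow> nat \<Rightarrow> nat list" where
  "ladder p b m = replicate p b @ [Suc b..<b + m - 1]"

lemma perm_ladder:
  assumes "odd p" "m \<ge> 2"
  shows "perm (ladder p b m) x = (if x = b then b + m - 1 else if b < x \<and> x < b + m then x - 1 else x)"
proof -
  have "perm (ladder p b m) x = perm (b # [Suc b..<b + m - 1]) x"
    using assms(1) unfolding ladder_def by (simp add: perm_replicate)
  also have "b # [Suc b..<b + m - 1] = [b..<b + (m - 1)]" using assms(2) by (simp add: upt_conv_Cons)
  finally show ?thesis unfolding perm_upt using assms(2) by auto
qed

lemma set_ladder: "p > 0 \<Longrightarrow> m \<ge> 2 \<Longrightarrow> set (ladder p b m) = {b..<b + m - 1}"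
  unfolding ladder_def by auto

lemma length_ladder: "m \<ge> 2 \<Longrightarrow> length (ladder p b m) = p + (m - 2)"
  unfolding ladder_def by simp

locale two_ladders =
  fixes m p1 p2 e :: nat
  assumes m: "m \<ge> 2" and p1: "odd p1" and p2: "odd p2" and e: "even e" "e > 0"
begin

text \<open>\<open>A\<close> acts on the inner positions \<open>0, ..., m - 1\<close> and
  \<open>B\<close> on the outer ones \<open>m, ..., 2 m - 1\<close>. Only the letter
  \<open>m - 1\<close> joins the two blocks.\<close>

definition A where "A = ladder p1 0 m"
definition B where "B = ladder p2 m m"
definition W where "W = A @ replicate e (m - 1) @ B"

text \<open>Each turn lowers the position within the block by one, cyclically, hence the minus sign.
  Curve 0 has the inner block and curve 1 the outer one.\<close>

definition start :: "nat \<Rightarrow> int \<Rightarrow> nat" where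
  "start i q = i * m + nat (- q mod int m)"

lemma set_A: "set A = {..<m - 1}"
  unfolding A_def set_ladder[OF odd_pos[OF p1] m] by auto

lemma set_B: "set B = {m..<2 * m - 1}"
  unfolding B_def set_ladder[OF odd_pos[OF p2] m] by (simp add: mult_2)

lemma set_W: "set W = {..<2 * m - 1}"
  unfolding W_def set_append set_A set_B using e m by (auto simp: set_replicate_conv_if)

lemma length_A: "length A = p1 + (m - 2)" and length_B: "length B = p2 + (m - 2)"
  and length_W: "length W = length A + e + length B"
  unfolding W_def A_def B_def using length_ladder[OF m] by simp_all

lemma nat_mod_less: "nat (q mod int m) < m"
  using m by (simp add: nat_less_iff)

lemma perm_W_start:
  assumes "i < 2" shows "perm W (start i q) = start i (q + 1)"
proof -
  define y where "y = nat (- q mod int m)"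
  have y: "y < m" unfolding y_def by (rule nat_mod_less)
  have nxt: "nat (- (q + 1) mod int m) = (if y = 0 then m - 1 else y - 1)"
  proof -
    have "- (q + 1) mod int m = (- q mod int m - 1) mod int m" by (simp add: mod_diff_left_eq)
    also have "- q mod int m = int y" unfolding y_def using m by simp
    also have "(int y - 1) mod int m = (if y = 0 then int m - 1 else int y - 1)"
      using y m by (auto simp: zmod_minus1)
    finally show ?thesis using y m by auto
  qed
  have pA: "perm A x = (if x = 0 then m - 1 else if x < m then x - 1 else x)" for x
    unfolding A_def perm_ladder[OF p1 m] by auto
  have pB: "perm B x = (if x = m then 2 * m - 1 else if m < x \<and> x < 2 * m then x - 1 else x)" for x
    unfolding B_def perm_ladder[OF p2 m] by (auto simp: mult_2)
  have "perm W x = perm B (perm A x)" for x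
    unfolding W_def using e by (simp add: perm_replicate)
  moreover have "i = 0 \<or> i = 1" using assms by auto
  ultimately show ?thesis
    unfolding start_def y_def[symmetric] nxt using y m by (auto simp: pA pB)
qed

lemma start_periodic: "start i (q + int m) = start i q"
proof -
  have "- (q + int m) mod int m = - q mod int m"
    using mod_add_self2[of "- q - int m" "int m"] by (simp add: algebra_simps)
  then show ?thesis unfolding start_def by simp
qed

lemma start_inj:
  assumes "start i (q + int k) = start i' (q + int k')" "k < m" "k' < m"
  shows "i = i' \<and> k = k'"
proof -
  have "start i q div m = i" "start i q mod m = nat (- q mod int m)" for i q
    unfolding start_def using nat_mod_less[of "- q"] m by auto
  then have ii: "i = i'" and "nat (- (q + int k) mod int m) = nat (- (q + int k') mod int m)"
    using assms(1) by metis+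
  then have "- (q + int k) mod int m = - (q + int k') mod int m" using m by (simp add: eq_nat_nat_iff)
  then have "int m dvd int k - int k'" by (simp add: mod_eq_dvd_iff dvd_diff_commute)
  then have "int k mod int m = int k' mod int m" by (simp add: mod_eq_dvd_iff)
  then have "k = k'" using assms(2,3) by simp
  then show ?thesis using ii by simp
qed

text \<open>\<open>t\<close> selects the curves that are kept: the identity for the pair, a constant
  for one curve alone.\<close>

lemma word_braid_start:
  assumes "L > 0" "\<And>i. i < L \<Longrightarrow> t i < 2" "inj_on t {..<L}"
  shows "word_braid W L m (\<lambda>i. start (t i))"
proof
  show "W \<noteq> []"
  proof
    assume "W = []"
    then have "{..<2 * m - 1} = {}" using set_W by (metis list.set(1))
    then show False using m by (auto simp: lessThan_empty_iff)
  qed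
  show "inj_on (\<lambda>(i, k). start (t i) (q + int k)) ({..<L} \<times> {..<m})" for q
  proof (rule inj_onI, clarify)
    fix i k i' k' assume *: "i < L" "k < m" "i' < L" "k' < m" "start (t i) (q + int k) = start (t i') (q + int k')"
    then have "t i = t i'" "k = k'" using start_inj by blast+
    then show "i = i' \<and> k = k'" using assms(3) * by (auto dest: inj_onD)
  qed
qed (use assms m perm_W_start start_periodic in auto)

lemma start_image: "(\<lambda>k. start i (int k)) ` {..<m} = {i * m..<i * m + m}"
proof (rule card_subset_eq)
  have "inj_on (\<lambda>k. start i (int k)) {..<m}"
    using start_inj[of i 0 _ i] by (intro inj_onI) auto
  then show "card ((\<lambda>k. start i (int k)) ` {..<m}) = card {i * m..<i * m + m}" by (simp add: card_image)
qed (use nat_mod_less in \<open>auto simp: start_def\<close>)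

lemma occupied_start:
  assumes wb: "word_braid W L m (\<lambda>i. start (t i))" and c: "c < length W"
  shows "word_braid.occupied W L m (\<lambda>i. start (t i)) c = perm (take c W) ` (\<Union>i<L. {t i * m..<t i * m + m})"
proof -
  interpret word_braid W L m "\<lambda>i. start (t i)" by (rule wb)
  have "occupied c = (\<lambda>(i, k). perm (take c W) (start (t i) (int k))) ` ({..<L} \<times> {..<m})"
    unfolding occupied_def strands_def place_def using c by (simp add: split_beta)
  also have "\<dots> = perm (take c W) ` (\<Union>i<L. (\<lambda>k. start (t i) (int k)) ` {..<m})" by auto
  finally show ?thesis unfolding start_image .
qed

lemma W_cases:
  assumes c: "c < length W"
  obtains "c < length A" "take c W = take c A" "W ! c \<in> set A"
  | i where "length A \<le> c" "c < length A + e" "take c W = A @ replicate i (m - 1)" "W ! c = m - 1"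
  | i where "length A + e \<le> c" "take c W = A @ replicate e (m - 1) @ take i B" "W ! c \<in> set B"
proof -
  consider "c < length A" | "length A \<le> c" "c < length A + e" | "length A + e \<le> c" by linarith
  then show thesis
  proof cases
    case 1
    then show thesis using that(1) unfolding W_def by (simp add: nth_append)
  next
    case 2
    then show thesis using that(2)[of "c - length A"] unfolding W_def by (simp add: nth_append)
  next
    case 3
    have "c - length A - e < length B" using c 3 length_W by simp
    moreover have "W ! c = B ! (c - length A - e)"
      using 3 nth_append[of "A @ replicate e (m - 1)" B c] unfolding W_def by simp
    moreover have "take c W = A @ replicate e (m - 1) @ take (c - length A - e) B"
      using 3 unfolding W_def by simp
    ultimately show thesis using that(3) 3 by simp
  qed
qed

lemma take_W_set: "a \<in> set (take c W) \<Longrightarrow> a < 2 * m - 1"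
  using set_take_subset[of c W] set_W by auto

text \<open>With the block \<open>{b..<t}\<close> occupied, this is the level of letter
  \<open>a\<close>: positions are numbered outwards and levels inwards.\<close>

lemma card_above: "Suc (card {y \<in> {b..<t}. Suc a < y}) = t - 1 - a" if "b \<le> a" "Suc a < t"
proof -
  have "{y \<in> {b..<t}. Suc a < y} = {Suc (Suc a)..<t}" using that by auto
  then show ?thesis using that by simp
qed

end

section \<open>The two loops and their invariants\<close>

context two_ladders
begin

declare One_nat_def [simp del]

definition loop :: "nat \<Rightarrow> real \<Rightarrow> complex" where
  "loop i = braid_curves.curve m (word_braid.R W m start) i"

lemma word_braid_pair: "word_braid W 2 m start"
  using word_braid_start[of 2 "\<lambda>i. i"] by simp

lemma word_braid_single: "j < 2 \<Longrightarrow> word_braid W 1 m (\<lambda>_. start j)"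
  using word_braid_start[of 1 "\<lambda>_. j"] by (simp add: inj_on_def)

lemma curves_pair: "braid_curves.curves 2 m (word_braid.R W m start) = [loop 0, loop 1]"
proof -
  interpret word_braid W 2 m start by (rule word_braid_pair)
  have "[0..<2] = [0, 1::nat]" by (simp add: upt_rec One_nat_def)
  then show ?thesis unfolding curves_def loop_def by simp
qed

text \<open>The radius of a curve depends on its own positions only, so leaving out the other curve
  does not change it. This ties the one-curve braids to the pair.\<close>

lemma curves_single:
  assumes "j < 2" shows "braid_curves.curves 1 m (word_braid.R W m (\<lambda>_. start j)) = [loop j]"
proof -
  interpret P: word_braid W 2 m start by (rule word_braid_pair)
  interpret S: word_braid W 1 m "\<lambda>_. start j" by (rule word_braid_single[OF assms])
  have h: "S.height 0 n = P.height j n" for n unfolding S.height_def P.height_def ..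
  have r: "S.R 0 t = P.R j t" for t unfolding S.R_def P.R_def h ..
  have "S.curve 0 = P.curve j" unfolding fun_eq_iff S.curve_def P.curve_def r by simp
  moreover have "[0..<1] = [0::nat]" by (simp add: One_nat_def)
  ultimately show ?thesis unfolding S.curves_def loop_def by simp
qed

lemma occupied_pair:
  assumes "c < length W" shows "word_braid.occupied W 2 m start c = {..<2 * m}"
proof -
  have "(\<Union>i<2. {i * m..<i * m + m}) = {..<2 * m}"
    by (auto simp: numeral_2_eq_2 lessThan_Suc)
  moreover have "Suc a \<noteq> 2 * m" if "a \<in> set (take c W)" for a using take_W_set[OF that] by simp
  ultimately show ?thesis
    using occupied_start[of 2 "\<lambda>i. i", OF word_braid_pair assms] perm_image_lessThan[of "take c W" "2 * m"] by simp
qed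

lemma occupied_single:
  assumes "j < 2" "c < length W"
  shows "word_braid.occupied W 1 m (\<lambda>_. start j) c = perm (take c W) ` {j * m..<j * m + m}"
  unfolding occupied_start[of 1 "\<lambda>_. j", OF word_braid_single[OF assms(1)] assms(2)]
  by (rule arg_cong[of _ _ "image _"]) auto

lemma perm_image_A: "j < 2 \<Longrightarrow> perm (take c A) ` {j * m..<j * m + m} = {j * m..<j * m + m}"
  using set_take_subset[of c A] set_A m
  by (intro perm_image_atLeastLessThan) (auto simp: less_2_cases_iff subset_iff)

lemma perm_image_B: "j < 2 \<Longrightarrow> perm (A @ replicate e (m - 1) @ take c B) ` {j * m..<j * m + m} = {j * m..<j * m + m}"
proof -
  assume j: "j < 2"
  have "perm (A @ replicate e (m - 1) @ take c B) ` X = perm (take c B) ` perm A ` X" for X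
    using e(1) by (simp add: perm_replicate image_image)
  moreover have "perm A ` {j * m..<j * m + m} = {j * m..<j * m + m}"
    using perm_image_A[OF j, of "length A"] by simp
  moreover have "perm (take c B) ` {j * m..<j * m + m} = {j * m..<j * m + m}"
    using set_take_subset[of c B] set_B m j
    by (intro perm_image_atLeastLessThan) (auto simp: less_2_cases_iff subset_iff)
  ultimately show ?thesis by simp
qed

text \<open>Each middle letter exchanges the border positions \<open>m - 1\<close> and
  \<open>m\<close> between the curves, so one curve alone always occupies exactly one of them. These
  letters therefore give mutual crossings and no self-crossings.\<close>

lemma perm_image_E:
  assumes j: "j < 2" and V: "V = perm (A @ replicate i (m - 1)) ` {j * m..<j * m + m}"
  shows "m - 1 \<in> V \<longleftrightarrow> (even i \<longleftrightarrow> j = 0)" "m \<in> V \<longleftrightarrow> (even i \<longleftrightarrow> j = 1)"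
proof -
  have "V = perm (replicate i (m - 1)) ` perm A ` {j * m..<j * m + m}" unfolding V by (simp add: image_image)
  also have "perm A ` {j * m..<j * m + m} = {j * m..<j * m + m}" using perm_image_A[OF j, of "length A"] by simp
  finally have V': "V = (if even i then {j * m..<j * m + m} else swap (m - 1) ` {j * m..<j * m + m})"
    by (auto simp: perm_replicate)
  have sw: "y \<in> swap a ` X \<longleftrightarrow> swap a y \<in> X" for a y X by (metis image_iff swap_swap)
  have "swap (m - 1) (m - 1) = m" "swap (m - 1) m = m - 1" unfolding swap_def using m by auto
  then show "m - 1 \<in> V \<longleftrightarrow> (even i \<longleftrightarrow> j = 0)" "m \<in> V \<longleftrightarrow> (even i \<longleftrightarrow> j = 1)"
    unfolding V' using j m by (auto simp: sw less_2_cases_iff)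
qed

lemma active_pair: "word_braid.active W 2 m start = {..<length W}"
proof -
  interpret word_braid W 2 m start by (rule word_braid_pair)
  have "W ! c \<in> occupied c \<and> Suc (W ! c) \<in> occupied c" if c: "c < length W" for c
    using nth_mem[OF c] unfolding set_W occupied_pair[OF c] by auto
  then show ?thesis unfolding active_def by blast
qed

lemma active_0: "word_braid.active W 1 m (\<lambda>_. start 0) = {..<length A}"
proof -
  interpret word_braid W 1 m "\<lambda>_. start 0" by (rule word_braid_single) simp
  have "W ! c \<in> occupied c \<and> Suc (W ! c) \<in> occupied c \<longleftrightarrow> c < length A" if c: "c < length W" for c
    using c
  proof (cases rule: W_cases)
    case 1
    then have "W ! c < m - 1" using set_A by auto
    then show ?thesis using 1 occupied_single[of 0, OF _ c] perm_image_A[of 0 c] by auto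
  next
    case (2 i)
    have "\<not> (m - 1 \<in> occupied c \<and> m \<in> occupied c)"
      using perm_image_E[of 0 _ i] occupied_single[of 0, OF _ c] 2 by auto
    then show ?thesis using 2 m by simp
  next
    case (3 i)
    then have "W ! c \<ge> m" using set_B by auto
    then show ?thesis using 3 occupied_single[of 0, OF _ c] perm_image_B[of 0 i] by auto
  qed
  then have "active = {c. c < length W \<and> c < length A}" unfolding active_def by blast
  also have "\<dots> = {..<length A}" unfolding length_W by auto
  finally show ?thesis .
qed

lemma active_1: "word_braid.active W 1 m (\<lambda>_. start 1) = {length A + e..<length W}"
proof -
  interpret word_braid W 1 m "\<lambda>_. start 1" by (rule word_braid_single) simp
  have "W ! c \<in> occupied c \<and> Suc (W ! c) \<in> occupied c \<longleftrightarrow> length A + e \<le> c" if c: "c < length W" for c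
    using c
  proof (cases rule: W_cases)
    case 1
    then have "W ! c < m - 1" using set_A by auto
    then show ?thesis using 1 occupied_single[of 1, OF _ c] perm_image_A[of 1 c] by auto
  next
    case (2 i)
    have "\<not> (m - 1 \<in> occupied c \<and> m \<in> occupied c)"
      using perm_image_E[of 1 _ i] occupied_single[of 1, OF _ c] 2 by auto
    then show ?thesis using 2 m by simp
  next
    case (3 i)
    then have "W ! c \<ge> m" "W ! c < 2 * m - 1" using set_B by auto
    then show ?thesis using 3 occupied_single[of 1, OF _ c] perm_image_B[of 1 i] by auto
  qed
  then have "active = {c. c < length W \<and> length A + e \<le> c}" unfolding active_def by blast
  also have "\<dots> = {length A + e..<length W}" by auto
  finally show ?thesis .
qed

lemma complete_pair: "complete_word_braid W 2 m start"
proof -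
  interpret word_braid W 2 m start by (rule word_braid_pair)
  show ?thesis
  proof
    fix j assume j: "0 < j" "j < 2 * m"
    \<comment> \<open>Letters are numbered from the inside, so level \<open>j\<close> belongs to the
      letter \<open>2 * m - 1 - j\<close>.\<close>
    then have "2 * m - 1 - j \<in> set W" unfolding set_W by auto
    then obtain c where c: "c < length W" "W ! c = 2 * m - 1 - j" by (metis in_set_conv_nth)
    have "Suc (card {y \<in> occupied c. Suc (W ! c) < y}) = j"
      using card_above[of 0 "2 * m - 1 - j" "2 * m"] j unfolding c(2) occupied_pair[OF c(1)] by (simp add: atLeast0LessThan)
    then show "\<exists>c\<in>active. Suc (card {y \<in> occupied c. Suc (W ! c) < y}) = j"
      using c(1) active_pair by auto
  qed
qed

lemma complete_0: "complete_word_braid W 1 m (\<lambda>_. start 0)"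
proof -
  interpret word_braid W 1 m "\<lambda>_. start 0" by (rule word_braid_single) simp
  show ?thesis
  proof
    fix j assume j: "0 < j" "j < 1 * m"
    then have "m - 1 - j \<in> set A" unfolding set_A by auto
    then obtain c where c: "c < length A" "A ! c = m - 1 - j" by (metis in_set_conv_nth)
    have cW: "c < length W" "W ! c = m - 1 - j" "take c W = take c A"
      using c unfolding W_def by (simp_all add: nth_append)
    have "occupied c = {0..<m}" using occupied_single[of 0, OF _ cW(1)] perm_image_A[of 0 c] cW(3) by simp
    then have "Suc (card {y \<in> occupied c. Suc (W ! c) < y}) = j"
      using card_above[of 0 "m - 1 - j" m] j unfolding cW(2) by simp
    then show "\<exists>c\<in>active. Suc (card {y \<in> occupied c. Suc (W ! c) < y}) = j"
      using c(1) active_0 by auto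
  qed
qed

lemma complete_1: "complete_word_braid W 1 m (\<lambda>_. start 1)"
proof -
  interpret word_braid W 1 m "\<lambda>_. start 1" by (rule word_braid_single) simp
  show ?thesis
  proof
    fix j assume j: "0 < j" "j < 1 * m"
    then have "2 * m - 1 - j \<in> set B" unfolding set_B by auto
    then obtain k where k: "k < length B" "B ! k = 2 * m - 1 - j" by (metis in_set_conv_nth)
    define c where "c = length A + e + k"
    have cW: "c < length W" "W ! c = 2 * m - 1 - j" "take c W = A @ replicate e (m - 1) @ take k B"
      using k length_W nth_append[of "A @ replicate e (m - 1)" B c] unfolding c_def W_def by simp_all
    have "occupied c = {m..<2 * m}"
      using occupied_single[of 1, OF _ cW(1)] perm_image_B[of 1 k] cW(3) by (simp add: mult_2)
    then have "Suc (card {y \<in> occupied c. Suc (W ! c) < y}) = j"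
      using card_above[of m "2 * m - 1 - j" "2 * m"] j unfolding cW(2) by simp
    then show "\<exists>c\<in>active. Suc (card {y \<in> occupied c. Suc (W ! c) < y}) = j"
      using cW(1) active_1 unfolding c_def by auto
  qed
qed

lemma generic_pair_loops: "generic_pair (loop 0) (loop 1)"
proof -
  interpret complete_word_braid W 2 m start by (rule complete_pair)
  show ?thesis using generic_word_braid unfolding curves_pair .
qed

lemma J_plus_loop_0: "J_plus (loop 0) = 1 + real (length A) - (real m)\<^sup>2"
proof -
  interpret complete_word_braid W 1 m "\<lambda>_. start 0" by (rule complete_0)
  have c: "curves = [loop 0]" by (rule curves_single) simp
  show ?thesis using viro_sum unfolding c active_0 J_plus_def by simp
qed

lemma J_plus_loop_1: "J_plus (loop 1) = 1 + real (length B) - (real m)\<^sup>2"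
proof -
  interpret complete_word_braid W 1 m "\<lambda>_. start 1" by (rule complete_1)
  have c: "curves = [loop 1]" by (rule curves_single) simp
  show ?thesis using viro_sum unfolding c active_1 J_plus_def length_W by simp
qed

lemma loops_intersect: "path_image (loop 0) \<inter> path_image (loop 1) \<noteq> {}"
proof -
  interpret complete_word_braid W 2 m start by (rule complete_pair)
  \<comment> \<open>The first middle letter, present because \<open>e > 0\<close>: there the two
    curves occupy the border positions \<open>m - 1\<close> and \<open>m\<close>, and they meet at
    radius \<open>m + 1/2\<close>.\<close>
  let ?c = "length A"
  have cW: "?c < length W" "W ! ?c = m - 1" "take ?c W = A @ replicate 0 (m - 1)"
    using e length_W unfolding W_def by (simp_all add: nth_append)
  have act: "?c \<in> active" unfolding active_pair using cW(1) by simp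
  have place: "\<exists>k<m. place (j, k) (int ?c) = m - 1 + j" if j: "j < 2" for j
  proof -
    have "j = 0 \<or> j = 1" using j by auto
    then have "m - 1 + j \<in> perm (take ?c W) ` {j * m..<j * m + m}"
      using perm_image_E[OF j refl, of 0] m unfolding cW(3) by auto
    then show ?thesis unfolding start_image[symmetric] place_def using cW(1) by auto
  qed
  obtain k l where kl: "k < m" "place (0, k) (int ?c) = m - 1" "l < m" "place (1, l) (int ?c) = m"
    using place[of 0] place[of 1] m by auto
  have rad: "radius a (midpoint ?c) = real m + 1/2" if "a \<in> strands" "place a (int ?c) \<in> {m - 1, m}" for a
    using radius_cases(1)[OF that(1), of "midpoint ?c"] that(2) m
    unfolding midpoint[OF cW(1)] cW(2) step_half by (auto simp: of_nat_diff)
  have st: "(0, k) \<in> strands" "(1, l) \<in> strands" using kl unfolding strands_def by auto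
  have pos: "real m + 1/2 > 0" by simp
  have "polar (real m + 1/2) (midpoint ?c) \<in> path_image (curve 0)"
    using path_image_curve_iff[OF _ pos, of 0] rad[OF st(1)] kl by auto
  moreover have "polar (real m + 1/2) (midpoint ?c) \<in> path_image (curve 1)"
    using path_image_curve_iff[OF _ pos, of 1] rad[OF st(2)] kl by auto
  ultimately show ?thesis unfolding loop_def by blast
qed

lemma J2_plus_loops: "J2_plus (loop 0) (loop 1) = 2 + real (length W) - (2 * real m)\<^sup>2"
proof -
  interpret complete_word_braid W 2 m start by (rule complete_pair)
  have "encircling_index (loop 0) (loop 1) = 0"
    unfolding encircling_index_def using loops_intersect by simp
  then show ?thesis using viro_sum unfolding curves_pair active_pair J2_plus_def by simp
qed

end

theorem theoremB:
  fixes x y z :: int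
  assumes "even x" and "even y" and "even z"
  shows "\<exists>S1 S2. generic_pair S1 S2 \<and>
           J_plus S1 = real_of_int x \<and> J_plus S2 = real_of_int y \<and> J2_plus S1 S2 = real_of_int z"
proof -
  \<comment> \<open>The number of turns of each curve. The summand 2 gives
    \<open>M * M \<ge> 2 * M\<close>, and the absolute values then make all exponents
    positive.\<close>
  define M where "M = \<bar>x\<bar> + \<bar>y\<bar> + \<bar>z\<bar> + 2"
  have M2: "M \<ge> 2" unfolding M_def by simp
  then have M: "M * M \<ge> 2 * M" by (intro mult_right_mono) auto
  \<comment> \<open>Solved from \<open>1 + (p1 + M - 2) - M * M = x\<close>, since the ladder has
    \<open>p1 + M - 2\<close> letters; likewise for \<open>p2\<close>.\<close>
  define p1 where "p1 = x + 1 + M * M - M"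
  define p2 where "p2 = y + 1 + M * M - M"
  \<comment> \<open>Solved from
    \<open>2 + (p1 + M - 2) + e + (p2 + M - 2) - 4 * (M * M) = z\<close>.\<close>
  define e where "e = z - x - y + 2 * (M * M)"
  have pos: "p1 > 0" "p2 > 0" "e > 0" 
  proof -
    have "M > - x" "M > - y" "M > x + y - z - M" unfolding M_def by linarith+
    then show "p1 > 0" "p2 > 0" "e > 0" using M M2 unfolding p1_def p2_def e_def by linarith+
  qed
  \<comment> \<open>\<open>M * M - M\<close> is always even, so the parities come from those of
    \<open>x\<close>, \<open>y\<close> and \<open>z\<close>.\<close>
  have par: "odd p1" "odd p2" "even e" unfolding p1_def p2_def e_def using assms by auto
  interpret two_ladders "nat M" "nat p1" "nat p2" "nat e"
    by unfold_locales (use M2 pos par in \<open>auto simp: even_nat_iff\<close>)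
  have rM: "real (nat M) = real_of_int M" using M2 by simp
  have lA: "real (length A) = real_of_int (p1 + (M - 2))" and lB: "real (length B) = real_of_int (p2 + (M - 2))"
    unfolding length_A length_B using M2 pos by (auto simp: of_nat_diff)
  have lW: "real (length W) = real_of_int (p1 + (M - 2) + e + (p2 + (M - 2)))"
    unfolding length_W using lA lB pos by simp
  have "J_plus (loop 0) = real_of_int x"
    unfolding J_plus_loop_0 lA rM by (simp add: p1_def power2_eq_square)
  moreover have "J_plus (loop 1) = real_of_int y"
    unfolding J_plus_loop_1 lB rM by (simp add: p2_def power2_eq_square)
  moreover have "J2_plus (loop 0) (loop 1) = real_of_int z"
    unfolding J2_plus_loops lW rM by (simp add: p1_def p2_def e_def power2_eq_square)
  ultimately show ?thesis using generic_pair_loops by blast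
qed

end
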